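(* Let $N\ge 2$, $R\in(0,\infty)$, $\delta\in[0,R)$ and $\alpha>R$. Let $f:[\delta,R]\times[0,\alpha)\to[0,\infty)$ be continuous with $f(r,s)>0$ for all $(r,s)\in[\delta,R]\times(0,\alpha)$. Suppose that $\lim_{s\to0^+}\frac{f(r,s)}{s}=m(r)$ uniformly in $r\in[\delta,R]$, where $m\in C[\delta,R]$, $m(r)\ge0$ on $[\delta,R]$ and $m\not\equiv0$ on any subinterval of $[\delta,R]$. Let $\lambda_1(m,\delta)$ be the principal eigenvalue of $$-(r^{N-1}u')'=\lambda r^{N-1}m(r)u,\qquad u'(\delta)=u(R)=0.$$ Then there exists a connected component $\zeta$ of $\Sigma_\delta$ (the closure of the set of nontrivial solutions, defined in the context) such that: (a) $\zeta\setminus\{(\lambda_1(m,\delta),\theta)\}\subset(0,\infty)\times\operatorname{int}P_\delta$; (b) $\zeta$ joins $(\lambda_1(m,\delta),\theta)$ with infinity in the $\lambda$ direction; (c) $\operatorname{Proj}_{\mathbb R}\zeta=[\lambda_*,\infty)\subset(0,\infty)$ for some $\lambda_*$; (d) for every $n\in\mathbb N$, $\displaystyle\lim_{(\lambda,u)\in\zeta,\ \lambda\to\infty}\operatorname{meas}\Big\{r\in[\delta,R]:|u'(r)-(-1)|>\tfrac1n\Big\}=0$; (e) $\displaystyle\lim_{(\lambda,u)\in\zeta,\ \lambda\to\infty}\|u\|_{C[\delta,R]}=R-\delta$.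
   Context: Let $\phi_1(s)=\frac{s}{\sqrt{1-s^2}}$ for $|s|<1$. For $\lambda\ge0$ consider the boundary value problem $$(r^{N-1}\phi_1(u'))'+\lambda r^{N-1}f(r,u)=0\ \text{ on }(\delta,R),\qquad u'(\delta)=u(R)=0. \tag{P}$$ A solution of (P) is a function $u\in C^1[\delta,R]$ with values in $[0,\alpha)$ (where $f$ is defined), with $|u'|<1$ on $[\delta,R]$, with $r^{N-1}\phi_1(u')$ continuously differentiable, satisfying (P). $E_\delta=\{u\in C^1[\delta,R]:u'(\delta)=u(R)=0\}$ with norm $\|u\|_{C^1[\delta,R]}=\sup|u|+\sup|u'|$; $\|u\|_{C[\delta,R]}=\sup_{[\delta,R]}|u|$; $\theta$ is the zero element of $E_\delta$. $P_\delta=\{u\in E_\delta:u(t)\ge0,\ t\in[\delta,R]\}$, and $\operatorname{int}P_\delta$ is its interior in $E_\delta$. $\Sigma_\delta$ is the closure in $\mathbb R\times E_\delta$ of $\{(\lambda,u)\in[0,\infty)\times C^1[\delta,R]: u\text{ satisfies (P)},\ u\not\equiv0\}$. A component of a set is a maximal connected subset. $\operatorname{Proj}_{\mathbb R}\zeta$ is the set of $\lambda$ such that $(\lambda,u)\in\zeta$ for some $u$. "$\zeta$ joins $(\lambda_0,\theta)$ with infinity in the $\lambda$ direction" means that $(\lambda_0,\theta)\in\zeta$ and $\zeta$ contains pairs $(\lambda,u)$ with $\lambda$ arbitrarily large. $\operatorname{meas}$ is Lebesgue measure. *)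

theory Defs
  imports "HOL-Analysis.Analysis"
begin

text \<open>Continuously differentiable functions on a compact interval, with one-sided derivatives
  at the endpoints.\<close>

definition iderivative :: "real \<Rightarrow> real \<Rightarrow> (real \<Rightarrow> real) \<Rightarrow> real \<Rightarrow> real" where
  "iderivative a b u r = vector_derivative u (at r within {a..b})"

definition C1_on :: "real \<Rightarrow> real \<Rightarrow> (real \<Rightarrow> real) \<Rightarrow> bool" where
  "C1_on a b u \<longleftrightarrow> u differentiable_on {a..b} \<and> continuous_on {a..b} (iderivative a b u)"

definition C_norm :: "real \<Rightarrow> real \<Rightarrow> (real \<Rightarrow> real) \<Rightarrow> real" where
  "C_norm a b u = (SUP r\<in>{a..b}. \<bar>u r\<bar>)"

definition C1_norm :: "real \<Rightarrow> real \<Rightarrow> (real \<Rightarrow> real) \<Rightarrow> real" where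
  "C1_norm a b u = C_norm a b u + C_norm a b (iderivative a b u)"

text \<open>A function on \<open>[\<delta>, R]\<close> is represented by its extension by zero to the real line; hence
  the zero element of \<open>E \<delta> R\<close> is \<open>\<lambda>_. 0\<close>, and distinct elements differ on \<open>[\<delta>, R]\<close>.\<close>

definition E :: "real \<Rightarrow> real \<Rightarrow> (real \<Rightarrow> real) set" where
  "E \<delta> R = {u. (\<forall>r. r \<notin> {\<delta>..R} \<longrightarrow> u r = 0) \<and> C1_on \<delta> R u \<and> iderivative \<delta> R u \<delta> = 0 \<and> u R = 0}"

text \<open>The distance is set to \<open>0\<close> outside \<open>E \<delta> R\<close> because the locale \<open>Metric_space\<close> demands
  symmetry and nonnegativity for all elements of the type.\<close>

definition E_dist :: "real \<Rightarrow> real \<Rightarrow> (real \<Rightarrow> real) \<Rightarrow> (real \<Rightarrow> real) \<Rightarrow> real" where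
  "E_dist \<delta> R u v = (if u \<in> E \<delta> R \<and> v \<in> E \<delta> R then C1_norm \<delta> R (\<lambda>r. u r - v r) else 0)"

definition E_topology :: "real \<Rightarrow> real \<Rightarrow> (real \<Rightarrow> real) topology" where
  "E_topology \<delta> R = Metric_space.mtopology (E \<delta> R) (E_dist \<delta> R)"

definition P_cone :: "real \<Rightarrow> real \<Rightarrow> (real \<Rightarrow> real) set" where
  "P_cone \<delta> R = {u \<in> E \<delta> R. \<forall>t\<in>{\<delta>..R}. 0 \<le> u t}"

definition phi1 :: "real \<Rightarrow> real" where
  "phi1 s = s / sqrt (1 - s\<^sup>2)"

definition is_solution ::
  "nat \<Rightarrow> real \<Rightarrow> real \<Rightarrow> real \<Rightarrow> (real \<Rightarrow> real \<Rightarrow> real) \<Rightarrow> real \<Rightarrow> (real \<Rightarrow> real) \<Rightarrow> bool" where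
  "is_solution N \<delta> R \<alpha> f lam u \<longleftrightarrow>
     C1_on \<delta> R u \<and>
     (\<forall>r\<in>{\<delta>..R}. 0 \<le> u r \<and> u r < \<alpha> \<and> \<bar>iderivative \<delta> R u r\<bar> < 1) \<and>
     C1_on \<delta> R (\<lambda>r. r ^ (N - 1) * phi1 (iderivative \<delta> R u r)) \<and>
     (\<forall>r\<in>{\<delta><..<R}.
        iderivative \<delta> R (\<lambda>t. t ^ (N - 1) * phi1 (iderivative \<delta> R u t)) r
          + lam * r ^ (N - 1) * f r (u r) = 0) \<and>
     iderivative \<delta> R u \<delta> = 0 \<and> u R = 0"

definition nontrivial_solutions ::
  "nat \<Rightarrow> real \<Rightarrow> real \<Rightarrow> real \<Rightarrow> (real \<Rightarrow> real \<Rightarrow> real) \<Rightarrow> (real \<times> (real \<Rightarrow> real)) set" where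
  "nontrivial_solutions N \<delta> R \<alpha> f =
     {(lam, u). 0 \<le> lam \<and> u \<in> E \<delta> R \<and> is_solution N \<delta> R \<alpha> f lam u \<and> (\<exists>r\<in>{\<delta>..R}. u r \<noteq> 0)}"

definition RE_topology :: "real \<Rightarrow> real \<Rightarrow> (real \<times> (real \<Rightarrow> real)) topology" where
  "RE_topology \<delta> R = prod_topology euclideanreal (E_topology \<delta> R)"

definition Sigma_sol ::
  "nat \<Rightarrow> real \<Rightarrow> real \<Rightarrow> real \<Rightarrow> (real \<Rightarrow> real \<Rightarrow> real) \<Rightarrow> (real \<times> (real \<Rightarrow> real)) set" where
  "Sigma_sol N \<delta> R \<alpha> f = RE_topology \<delta> R closure_of nontrivial_solutions N \<delta> R \<alpha> f"

definition is_eigenfunction ::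
  "nat \<Rightarrow> real \<Rightarrow> real \<Rightarrow> (real \<Rightarrow> real) \<Rightarrow> real \<Rightarrow> (real \<Rightarrow> real) \<Rightarrow> bool" where
  "is_eigenfunction N \<delta> R m lam u \<longleftrightarrow>
     C1_on \<delta> R u \<and>
     C1_on \<delta> R (\<lambda>r. r ^ (N - 1) * iderivative \<delta> R u r) \<and>
     (\<forall>r\<in>{\<delta><..<R}.
        - iderivative \<delta> R (\<lambda>t. t ^ (N - 1) * iderivative \<delta> R u t) r
          = lam * r ^ (N - 1) * m r * u r) \<and>
     iderivative \<delta> R u \<delta> = 0 \<and> u R = 0 \<and> (\<exists>r\<in>{\<delta>..R}. u r \<noteq> 0)"

text \<open>The principal eigenvalue is the eigenvalue possessing a positive eigenfunction.\<close>

definition principal_eigenvalue :: "nat \<Rightarrow> real \<Rightarrow> (real \<Rightarrow> real) \<Rightarrow> real \<Rightarrow> real" where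
  "principal_eigenvalue N R m \<delta> =
     (THE lam. \<exists>u. is_eigenfunction N \<delta> R m lam u \<and> (\<forall>r\<in>{\<delta>..<R}. 0 < u r))"

text \<open>The filter of pairs \<open>(lam, u) \<in> \<zeta>\<close> with \<open>lam \<rightarrow> \<infinity>\<close>.\<close>

definition lambda_at_top :: "(real \<times> (real \<Rightarrow> real)) set \<Rightarrow> (real \<times> (real \<Rightarrow> real)) filter" where
  "lambda_at_top \<zeta> = inf (filtercomap fst at_top) (principal \<zeta>)"

definition joins_with_infinity :: "(real \<times> (real \<Rightarrow> real)) set \<Rightarrow> real \<times> (real \<Rightarrow> real) \<Rightarrow> bool" where
  "joins_with_infinity \<zeta> p \<longleftrightarrow> p \<in> \<zeta> \<and> (\<forall>\<Lambda>. \<exists>(lam, u)\<in>\<zeta>. \<Lambda> < lam)"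

text \<open>The metric axioms hold, so \<open>E_topology\<close> is indeed the topology of the \<open>C\<^sup>1\<close>-norm.\<close>

lemma iderivative_has:
  assumes "C1_on a b u" "r \<in> {a..b}"
  shows "(u has_vector_derivative iderivative a b u r) (at r within {a..b})"
  using assms unfolding C1_on_def iderivative_def differentiable_on_def
  by (simp add: vector_derivative_works)

lemma iderivative_diff:
  assumes "C1_on a b u" "C1_on a b v" "a < b" "r \<in> {a..b}"
  shows "iderivative a b (\<lambda>r. u r - v r) r = iderivative a b u r - iderivative a b v r"
  unfolding iderivative_def[of a b "\<lambda>r. u r - v r"]
  using assms
  by (intro vector_derivative_within_closed_interval has_vector_derivative_diff
      iderivative_has) auto

lemma C1_norm_diff:
  assumes "C1_on a b u" "C1_on a b v" "a < b"
  shows "C1_norm a b (\<lambda>r. u r - v r)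
    = C_norm a b (\<lambda>r. u r - v r) + C_norm a b (\<lambda>r. iderivative a b u r - iderivative a b v r)"
  unfolding C1_norm_def
  by (auto simp: C_norm_def iderivative_diff[OF assms] intro!: arg_cong[where f = Sup] image_cong)

lemma C_norm_upper:
  assumes "continuous_on {a..b} u" "r \<in> {a..b}"
  shows "\<bar>u r\<bar> \<le> C_norm a b u"
proof -
  have "bdd_above ((\<lambda>r. \<bar>u r\<bar>) ` {a..b})"
    by (intro bounded_imp_bdd_above compact_imp_bounded compact_continuous_image
        continuous_intros assms) auto
  then show ?thesis
    unfolding C_norm_def using assms by (intro cSUP_upper) auto
qed

lemma C_norm_nonneg:
  assumes "continuous_on {a..b} u" "a < b"
  shows "0 \<le> C_norm a b u"
  using C_norm_upper[OF assms(1), of a] assms(2) by auto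

lemma C_norm_triangle:
  assumes "continuous_on {a..b} u" "continuous_on {a..b} v" "continuous_on {a..b} w" "a < b"
  shows "C_norm a b (\<lambda>r. u r - w r) \<le> C_norm a b (\<lambda>r. u r - v r) + C_norm a b (\<lambda>r. v r - w r)"
  unfolding C_norm_def[of a b "\<lambda>r. u r - w r"]
proof (rule cSUP_least)
  fix r assume r: "r \<in> {a..b}"
  have "\<bar>u r - v r\<bar> \<le> C_norm a b (\<lambda>r. u r - v r)" "\<bar>v r - w r\<bar> \<le> C_norm a b (\<lambda>r. v r - w r)"
    using C_norm_upper[OF _ r, of "\<lambda>r. u r - v r"] C_norm_upper[OF _ r, of "\<lambda>r. v r - w r"] assms
    by (auto intro!: continuous_intros)
  then show "\<bar>u r - w r\<bar> \<le> C_norm a b (\<lambda>r. u r - v r) + C_norm a b (\<lambda>r. v r - w r)"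
    by linarith
qed (use assms in auto)

lemma E_Metric_space:
  assumes "\<delta> < R"
  shows "Metric_space (E \<delta> R) (E_dist \<delta> R)"
proof -
  let ?D = "iderivative \<delta> R"
  have C1: "C1_on \<delta> R u" if "u \<in> E \<delta> R" for u
    using that by (simp add: E_def)
  have cont: "continuous_on {\<delta>..R} u" "continuous_on {\<delta>..R} (?D u)" if "u \<in> E \<delta> R" for u
    using C1[OF that] by (auto simp: C1_on_def differentiable_imp_continuous_on)
  have dist: "E_dist \<delta> R u v
      = C_norm \<delta> R (\<lambda>r. u r - v r) + C_norm \<delta> R (\<lambda>r. ?D u r - ?D v r)"
    if "u \<in> E \<delta> R" "v \<in> E \<delta> R" for u v
    using that by (simp add: E_dist_def C1_norm_diff C1 assms)
  have nonneg: "0 \<le> C_norm \<delta> R (\<lambda>r. u r - v r)" "0 \<le> C_norm \<delta> R (\<lambda>r. ?D u r - ?D v r)"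
    if "u \<in> E \<delta> R" "v \<in> E \<delta> R" for u v
    using cont that by (auto intro!: C_norm_nonneg continuous_intros assms)
  show ?thesis
  proof
    show "0 \<le> E_dist \<delta> R u v" for u v
      using nonneg[of u v] dist[of u v] by (cases "u \<in> E \<delta> R \<and> v \<in> E \<delta> R") (auto simp: E_dist_def)
    show "E_dist \<delta> R u v = E_dist \<delta> R v u" for u v
    proof (cases "u \<in> E \<delta> R \<and> v \<in> E \<delta> R")
      case True
      then show ?thesis
        by (simp add: dist C_norm_def abs_minus_commute)
    qed (auto simp: E_dist_def)
    show "E_dist \<delta> R u v = 0 \<longleftrightarrow> u = v" if uv: "u \<in> E \<delta> R" "v \<in> E \<delta> R" for u v
    proof
      assume "E_dist \<delta> R u v = 0"
      then have *: "C_norm \<delta> R (\<lambda>r. u r - v r) = 0"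
        using nonneg[OF uv] dist[OF uv] by linarith
      have "u r = v r" if "r \<in> {\<delta>..R}" for r
        using C_norm_upper[OF _ that, of "\<lambda>r. u r - v r"] cont(1)[OF uv(1)] cont(1)[OF uv(2)] *
        by (auto intro: continuous_on_diff)
      then show "u = v"
        using uv by (intro ext) (metis (mono_tags, lifting) E_def mem_Collect_eq)
    next
      assume "u = v"
      then show "E_dist \<delta> R u v = 0"
        using dist[OF uv] assms by (simp add: C_norm_def)
    qed
    show "E_dist \<delta> R u w \<le> E_dist \<delta> R u v + E_dist \<delta> R v w"
      if "u \<in> E \<delta> R" "v \<in> E \<delta> R" "w \<in> E \<delta> R" for u v w
      using C_norm_triangle[OF cont(1)[OF that(1)] cont(1)[OF that(2)] cont(1)[OF that(3)] assms]
        C_norm_triangle[OF cont(2)[OF that(1)] cont(2)[OF that(2)] cont(2)[OF that(3)] assms]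
      by (simp add: dist that)
  qed
qed

end

theory Submission
  imports Defs "HOL-Complex_Analysis.Great_Picard"
begin

text \<open>
  A nontrivial solution is nonincreasing and 1-Lipschitz, hence it attains its maximum, its
  \<^emph>\<open>height\<close>, at the left endpoint \<open>\<delta>\<close>. The proof follows the solutions by their height instead of
  by \<open>\<lambda>\<close>. Integrating the equation twice turns the problem into \<open>u = T(\<lambda>, u)\<close>, where
  \<open>T(\<lambda>, u)(r)\<close> is the integral over \<open>[r, R]\<close> of \<open>\<phi>\<^sub>1\<^sup>-\<^sup>1\<close> applied to \<open>\<lambda>\<close> times a radial average of
  \<open>f(\<cdot>, u)\<close>. For fixed \<open>u\<close> of positive height the number \<open>T(\<lambda>, u)(\<delta>)\<close> grows strictly and
  continuously in \<open>\<lambda>\<close> from \<open>0\<close> to \<open>R - \<delta>\<close>. So for every height \<open>c\<close> in \<open>(0, R - \<delta>)\<close> exactly one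
  \<open>\<lambda>\<close> gives \<open>T(\<lambda>, u)\<close> the height \<open>c\<close>, and it depends continuously on \<open>c\<close> and \<open>u\<close>. Consequently a
  solution may be sought with any continuous functional \<open>h\<close> prescribing its height: Schauder's
  theorem, on the compact convex set of nonincreasing 1-Lipschitz profiles with height in \<open>[a, b]\<close>,
  yields a solution \<open>u\<close> with height \<open>h(u)\<close> (\<open>prescribed_left_solution\<close>).

  This freedom produces connected sets of solutions without degree theory
  (\<open>connected_branch\<close>). The solutions of height at most \<open>b\<close>, together with \<open>0\<close>, form a compact
  set \<open>S\<close>. If no connected subset of \<open>S\<close> joined \<open>0\<close> to the solutions of height \<open>b\<close>, then \<open>S\<close> would
  split into disjoint compact sets \<open>A\<close>, containing \<open>0\<close>, and \<open>B\<close>, containing the solutions of height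
  \<open>b\<close>. Let \<open>a\<close> be smaller than all heights in \<open>B\<close>, and let \<open>h\<close> be \<open>b\<close> on \<open>A\<close> and \<open>a\<close> on \<open>B\<close>. A
  solution with height \<open>h(u)\<close> can lie neither in \<open>A\<close> nor in \<open>B\<close>: a contradiction.

  The bifurcation point is found by rescaling. Along solutions whose height tends to \<open>0\<close> the
  parameter stays bounded, the profiles divided by their heights converge along a subsequence to a
  positive eigenfunction of the linear problem (\<open>normalized_limit\<close>), and a positive eigenfunction
  exists for one eigenvalue only, by Green's identity (\<open>positive_eigenvalue_unique\<close>). Hence the
  parameter converges to \<open>\<lambda>\<^sub>1(m, \<delta>)\<close>, and the closure of the nontrivial solutions gains precisely
  the point \<open>(\<lambda>\<^sub>1(m, \<delta>), 0)\<close> (\<open>Sigma_sol_eq\<close>).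

  The component \<open>\<zeta>\<close> through this point contains the connected sets above for all \<open>b < R - \<delta>\<close>. On
  these the parameter is unbounded, because a bounded parameter keeps \<open>|u'|\<close> away from \<open>1\<close> and hence
  the height away from \<open>R - \<delta>\<close>. The projection of \<open>\<zeta>\<close> is therefore an unbounded interval, and it
  contains its infimum by compactness. Conversely, a large parameter forces the height towards
  \<open>R - \<delta>\<close>, since small heights occur only near \<open>\<lambda>\<^sub>1(m, \<delta>)\<close>; as \<open>R - \<delta>\<close> minus the height is the
  integral of \<open>1 + u' \<ge> 0\<close>, Markov's inequality gives the convergence of \<open>u'\<close> to \<open>-1\<close> in measure.
\<close>


section \<open>Schauder's fixed point theorem\<close>

text \<open>Kuhn's lemma provides an approximate form of Brouwer's theorem on cubes whose dimension \<open>n\<close> is a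
  number and not a type. Label a grid point by the sign of its \<open>i\<close>-th displacement. Some small grid
  cell carries both labels in every coordinate, so by uniform continuity all displacements in that
  cell are small.\<close>

lemma cube_approximate_fixpoint:
  fixes F :: "(nat \<Rightarrow> real) \<Rightarrow> nat \<Rightarrow> real" and n :: nat
  defines "Q \<equiv> {x. \<forall>i<n. 0 \<le> x i \<and> x i \<le> 1}"
  assumes self: "\<And>x. x \<in> Q \<Longrightarrow> F x \<in> Q"
    and unif: "\<And>e. 0 < e \<Longrightarrow> \<exists>d>0. \<forall>x\<in>Q. \<forall>y\<in>Q. (\<forall>i<n. \<bar>x i - y i\<bar> \<le> d) \<longrightarrow> (\<forall>i<n. \<bar>F x i - F y i\<bar> \<le> e)"
    and "0 < e"
  shows "\<exists>x\<in>Q. \<forall>i<n. \<bar>F x i - x i\<bar> \<le> e"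
proof -
  have e3: "0 < e / 3"
    using \<open>0 < e\<close> by simp
  obtain d where d: "0 < d"
    "\<And>x y i. x \<in> Q \<Longrightarrow> y \<in> Q \<Longrightarrow> (\<forall>i<n. \<bar>x i - y i\<bar> \<le> d) \<Longrightarrow> i < n \<Longrightarrow> \<bar>F x i - F y i\<bar> \<le> e / 3"
    using unif[OF e3] by blast
  \<comment> \<open>The mesh width \<open>1 / p\<close> is chosen so that one grid step moves both \<open>x\<close> and \<open>F x\<close> by at most \<open>e / 3\<close>.\<close>
  obtain p :: nat where p: "1 / min d (e / 3) \<le> real p"
    using real_arch_simple by blast
  have "0 < 1 / min d (e / 3)"
    using d(1) \<open>0 < e\<close> by simp
  with p have p0: "0 < p"
    by (metis gr0I not_less of_nat_0)
  have "1 \<le> real p * min d (e / 3)"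
    using p d(1) \<open>0 < e\<close> by (simp add: pos_divide_le_eq)
  moreover have "real p * min d (e / 3) \<le> real p * d" "real p * min d (e / 3) \<le> real p * (e / 3)"
    by (intro mult_left_mono; simp)+
  ultimately have "1 \<le> real p * d" "1 \<le> real p * (e / 3)"
    by linarith+
  then have step: "1 / real p \<le> d" "1 / real p \<le> e / 3"
    using p0 by (simp_all add: pos_divide_le_eq mult.commute)
  obtain l :: "(nat \<Rightarrow> real) \<Rightarrow> nat \<Rightarrow> nat" where label: "(\<forall>x i. l x i \<le> 1) \<and>
      (\<forall>x i. x \<in> Q \<and> i < n \<and> x i = 0 \<longrightarrow> l x i = 0) \<and>
      (\<forall>x i. x \<in> Q \<and> i < n \<and> x i = 1 \<longrightarrow> l x i = 1) \<and>
      (\<forall>x i. x \<in> Q \<and> i < n \<and> l x i = 0 \<longrightarrow> x i \<le> F x i) \<and>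
      (\<forall>x i. x \<in> Q \<and> i < n \<and> l x i = 1 \<longrightarrow> F x i \<le> x i)"
    by (atomize_elim, rule kuhn_labelling_lemma'[of "\<lambda>x. x \<in> Q" F "\<lambda>i. i < n"])
      (use self in \<open>auto simp: Q_def\<close>)
  have l: "l x i \<le> 1"
    "x \<in> Q \<Longrightarrow> i < n \<Longrightarrow> x i = 0 \<Longrightarrow> l x i = 0"
    "x \<in> Q \<Longrightarrow> i < n \<Longrightarrow> x i = 1 \<Longrightarrow> l x i = 1"
    "x \<in> Q \<Longrightarrow> i < n \<Longrightarrow> l x i = 0 \<Longrightarrow> x i \<le> F x i"
    "x \<in> Q \<Longrightarrow> i < n \<Longrightarrow> l x i = 1 \<Longrightarrow> F x i \<le> x i" for x i
    using label by metis+
  define g where "g x i = real (x i) / real p" for x :: "nat \<Rightarrow> nat" and i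
  have gQ: "g x \<in> Q" if "\<forall>i<n. x i \<le> p" for x
    using that p0 by (auto simp: Q_def g_def)
  obtain q where q: "\<forall>i<n. q i < p"
    "\<forall>i<n. \<exists>r s. (\<forall>j<n. q j \<le> r j \<and> r j \<le> q j + 1) \<and> (\<forall>j<n. q j \<le> s j \<and> s j \<le> q j + 1)
        \<and> l (g r) i \<noteq> l (g s) i"
  proof (rule kuhn_lemma[of p n "\<lambda>x. l (g x)"])
    show "\<forall>x. (\<forall>i<n. x i \<le> p) \<longrightarrow> (\<forall>i<n. l (g x) i = 0 \<or> l (g x) i = 1)"
      using l(1) by (metis less_one linorder_not_le nat_less_le)
    show "\<forall>x. (\<forall>i<n. x i \<le> p) \<longrightarrow> (\<forall>i<n. x i = 0 \<longrightarrow> l (g x) i = 0)"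
      using gQ by (auto intro!: l(2) simp: g_def)
    show "\<forall>x. (\<forall>i<n. x i \<le> p) \<longrightarrow> (\<forall>i<n. x i = p \<longrightarrow> l (g x) i = 1)"
    proof (intro allI impI)
      fix x i assume "\<forall>i<n. x i \<le> p" "i < n" "x i = p"
      then show "l (g x) i = 1"
        using p0 by (intro l(3) gQ) (auto simp: g_def)
    qed
  qed (use p0 in auto)
  have near: "g x \<in> Q" "\<forall>j<n. \<bar>g x j - g q j\<bar> \<le> 1 / real p"
    if "\<forall>j<n. q j \<le> x j \<and> x j \<le> q j + 1" for x
  proof -
    show "g x \<in> Q"
      using that q(1) by (intro gQ) (metis Suc_eq_plus1 Suc_leI le_trans)
    show "\<forall>j<n. \<bar>g x j - g q j\<bar> \<le> 1 / real p"
    proof (intro allI impI)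
      fix j assume "j < n"
      then have "real (q j) \<le> real (x j)" "real (x j) \<le> real (q j) + 1"
        using that by (force simp flip: of_nat_Suc)+
      then show "\<bar>g x j - g q j\<bar> \<le> 1 / real p"
        unfolding g_def by (simp add: divide_right_mono flip: diff_divide_distrib)
    qed
  qed
  have qQ: "g q \<in> Q"
    using near(1)[of q] by simp
  show ?thesis
  proof (intro bexI[OF _ qQ] allI impI)
    fix i assume i: "i < n"
    obtain r s where rs: "\<forall>j<n. q j \<le> r j \<and> r j \<le> q j + 1" "\<forall>j<n. q j \<le> s j \<and> s j \<le> q j + 1"
      "l (g r) i \<noteq> l (g s) i"
      using q(2) i by blast
    \<comment> \<open>A vertex labelled 0 bounds the displacement from below, one labelled 1 from above.\<close>
    have close: "\<bar>F (g x) i - F (g q) i\<bar> \<le> e / 3" "\<bar>g x i - g q i\<bar> \<le> e / 3"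
      if "\<forall>j<n. q j \<le> x j \<and> x j \<le> q j + 1" for x
    proof -
      show "\<bar>F (g x) i - F (g q) i\<bar> \<le> e / 3"
        using near[OF that] step(1) by (intro d(2) qQ i) force+
      show "\<bar>g x i - g q i\<bar> \<le> e / 3"
        using near(2)[OF that] i step(2) by force
    qed
    have up: "- e \<le> F (g q) i - g q i"
      if "\<forall>j<n. q j \<le> x j \<and> x j \<le> q j + 1" "l (g x) i = 0" for x
      using close[OF that(1)] l(4)[OF near(1)[OF that(1)] i that(2)] \<open>0 < e\<close> by linarith
    have down: "F (g q) i - g q i \<le> e"
      if "\<forall>j<n. q j \<le> x j \<and> x j \<le> q j + 1" "l (g x) i = 1" for x
      using close[OF that(1)] l(5)[OF near(1)[OF that(1)] i that(2)] \<open>0 < e\<close> by linarith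
    have "(l (g r) i = 0 \<and> l (g s) i = 1) \<or> (l (g r) i = 1 \<and> l (g s) i = 0)"
      using rs(3) l(1)[of "g r" i] l(1)[of "g s" i] by linarith
    then show "\<bar>F (g q) i - g q i\<bar> \<le> e"
      using up down rs(1,2) by (auto simp: abs_le_iff) (smt (verit))+
  qed
qed

lemma sum_scaleR_diff:
  "(\<Sum>i\<in>I. a i *\<^sub>R (p i - z)) = (\<Sum>i\<in>I. a i *\<^sub>R p i) - (\<Sum>i\<in>I. a i) *\<^sub>R (z :: 'a::real_vector)"
  by (simp only: scaleR_right_diff_distrib sum_subtractf scaleR_left.sum)

lemma sum_scaleR_diff':
  "(\<Sum>i\<in>I. a i *\<^sub>R (z - p i)) = (\<Sum>i\<in>I. a i) *\<^sub>R z - (\<Sum>i\<in>I. a i *\<^sub>R (p i :: 'a::real_vector))"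
  by (simp only: scaleR_right_diff_distrib sum_subtractf scaleR_left.sum)

text \<open>Cover \<open>K\<close> by finitely many balls of radius \<open>e / 2\<close> with centres \<open>p i\<close>. The map sends the cube of
  coefficient vectors \<open>c\<close> to \<open>K\<close> by \<open>Y\<close>, then applies \<open>T\<close>, and finally returns to the cube by the
  partition of unity \<open>a i\<close> of the cover. An approximate fixed point \<open>c\<close> of this map of the cube
  yields a point \<open>Y c\<close> that \<open>T\<close> moves by at most \<open>e\<close>, and compactness of \<open>K\<close> removes the \<open>e\<close>.\<close>

theorem schauder_fixpoint:
  fixes T :: "'a::real_normed_vector \<Rightarrow> 'a"
  assumes K: "compact K" "convex K" "K \<noteq> {}"
    and T: "continuous_on K T" "T \<in> K \<rightarrow> K"
  obtains x where "x \<in> K" "T x = x"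
proof -
  have approx: "\<exists>x\<in>K. norm (T x - x) \<le> e" if e: "0 < e" for e
  proof -
    have e2: "0 < e / 2" using e by simp
    obtain C where C: "finite C" "C \<subseteq> K" "K \<subseteq> (\<Union>x\<in>C. ball x (e / 2))"
      using seq_compact_imp_totally_bounded[of K] K(1) e2 unfolding compact_eq_seq_compact_metric by blast
    then have "C \<noteq> {}"
      using K(3) by auto
    obtain z where z: "z \<in> C"
      using \<open>C \<noteq> {}\<close> by blast
    obtain n and p :: "nat \<Rightarrow> 'a" where p: "C = p ` {i. i < n}"
      using C(1) by (metis finite_imp_nat_seg_image_inj_on)
    have pK: "p i \<in> K" if "i < n" for i
      using p C(2) that by auto
    have zK: "z \<in> K" using z C by auto
    define w where "w i y = max 0 (e / 2 - dist (p i) y)" for i y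
    define W where "W y = (\<Sum>i<n. w i y)" for y
    define a where "a i y = w i y / W y" for i y
    have w0: "0 \<le> w i y" for i y
      by (simp add: w_def)
    have W0: "0 < W y" if "y \<in> K" for y
    proof -
      have "y \<in> (\<Union>x\<in>C. ball x (e / 2))"
        using C(3) that by blast
      then obtain i where "i < n" "dist (p i) y < e / 2"
        unfolding p by auto
      then have "0 < w i y" by (simp add: w_def)
      moreover have "w i y \<le> W y"
        unfolding W_def using \<open>i < n\<close> w0 by (intro member_le_sum) auto
      ultimately show ?thesis by linarith
    qed
    have cont_w: "continuous_on K (\<lambda>y. a i y)" for i
      using W0 unfolding a_def w_def W_def
      by (intro continuous_intros) (auto simp: less_le)
    have sum1: "(\<Sum>i<n. a i y) = 1" if "y \<in> K" for y
      using W0[OF that] by (simp add: a_def W_def flip: sum_divide_distrib)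
    have le1: "a i y \<le> 1" if "y \<in> K" "i < n" for y i
      using W0[OF that(1)] that(2) w0 by (auto simp: a_def W_def intro!: member_le_sum)
    define D where "D = (\<Sum>i<n. norm (p i - z))"
    have D: "0 \<le> D" "\<And>i. i < n \<Longrightarrow> norm (p i - z) \<le> D"
      by (auto simp: D_def intro!: sum_nonneg member_le_sum)
    define Q where "Q = {x. \<forall>i<n. 0 \<le> x i \<and> x i \<le> (1::real)}"
    \<comment> \<open>Division by \<open>\<sigma> c\<close> maps the cube to the coefficient vectors of sum at most 1, and the missing weight
       falls on \<open>z\<close>; a vector whose coefficients sum to 1 is left unchanged.\<close>
    define \<sigma> where "\<sigma> c = max 1 (\<Sum>i<n. c i)" for c :: "nat \<Rightarrow> real"
    define Y where "Y c = z + (\<Sum>i<n. (c i / \<sigma> c) *\<^sub>R (p i - z))" for c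
    have \<sigma>1: "1 \<le> \<sigma> c" "(\<Sum>i<n. c i) \<le> \<sigma> c" for c
      by (auto simp: \<sigma>_def)
    have YK: "Y c \<in> K" if "c \<in> Q" for c
    proof -
      have s: "(\<Sum>i<n. c i / \<sigma> c) \<le> 1"
        using \<sigma>1[of c] by (simp flip: sum_divide_distrib)
      have "Y c = (1 - (\<Sum>i<n. c i / \<sigma> c)) *\<^sub>R z + (\<Sum>i<n. (c i / \<sigma> c) *\<^sub>R p i)"
        by (simp add: Y_def sum_scaleR_diff scaleR_left_diff_distrib)
      also have "\<dots> = (\<Sum>i\<in>insert n {..<n}. (if i = n then 1 - (\<Sum>i<n. c i / \<sigma> c) else c i / \<sigma> c) *\<^sub>R (if i = n then z else p i))"
        by (subst sum.insert) (auto intro!: sum.cong)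
      also have "\<dots> \<in> K"
      proof (rule convex_sum[OF _ K(2)])
        show "(\<Sum>i\<in>insert n {..<n}. (if i = n then 1 - (\<Sum>i<n. c i / \<sigma> c) else c i / \<sigma> c)) = 1"
          by (subst sum.insert) auto
      next
        fix i assume "i \<in> insert n {..<n}"
        then show "0 \<le> (if i = n then 1 - (\<Sum>i<n. c i / \<sigma> c) else c i / \<sigma> c)"
          using that s \<sigma>1(1)[of c] by (auto simp: Q_def)
      qed (auto simp: zK pK)
      finally show ?thesis .
    qed
    have YL: "norm (Y c - Y c') \<le> D * (real n + real n * real n) * d"
      if c: "c \<in> Q" "c' \<in> Q" "\<forall>i<n. \<bar>c i - c' i\<bar> \<le> d" for c c' d
    proof (cases "n = 0")
      case False
      have d0: "0 \<le> d" using c(3) False by fastforce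
      have sd: "\<bar>(\<Sum>i<n. c i) - (\<Sum>i<n. c' i)\<bar> \<le> real n * d"
        using c(3) sum_abs[of "\<lambda>i. c i - c' i" "{..<n}"]
          sum_bounded_above[of "{..<n}" "\<lambda>i. \<bar>c i - c' i\<bar>" d]
        by (auto simp: sum_subtractf)
      then have \<sigma>d: "\<bar>\<sigma> c - \<sigma> c'\<bar> \<le> real n * d"
        unfolding \<sigma>_def by linarith
      have coeff: "\<bar>c i / \<sigma> c - c' i / \<sigma> c'\<bar> \<le> d + real n * d" if "i < n" for i
      proof -
        have "c i / \<sigma> c - c' i / \<sigma> c' = (c i - c' i) / \<sigma> c + c' i * (\<sigma> c' - \<sigma> c) / (\<sigma> c * \<sigma> c')"
          using \<sigma>1(1)[of c] \<sigma>1(1)[of c'] by (simp add: field_simps)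
        also have "\<bar>\<dots>\<bar> \<le> \<bar>(c i - c' i) / \<sigma> c\<bar> + \<bar>c' i * (\<sigma> c' - \<sigma> c) / (\<sigma> c * \<sigma> c')\<bar>"
          by (rule abs_triangle_ineq)
        also have "\<bar>(c i - c' i) / \<sigma> c\<bar> \<le> d / 1"
          unfolding abs_divide using c(3) that \<sigma>1(1)[of c] d0 by (intro frac_le) auto
        also have "\<bar>c' i * (\<sigma> c' - \<sigma> c) / (\<sigma> c * \<sigma> c')\<bar> \<le> (1 * (real n * d)) / 1"
          unfolding abs_divide abs_mult
          using c(2) that \<sigma>1(1)[of c] \<sigma>1(1)[of c'] d0 \<sigma>d mult_mono[of 1 "\<sigma> c" 1 "\<sigma> c'"]
          by (intro frac_le mult_mono) (auto simp: Q_def abs_minus_commute)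
        finally show ?thesis by simp
      qed
      have "norm (Y c - Y c') = norm (\<Sum>i<n. (c i / \<sigma> c - c' i / \<sigma> c') *\<^sub>R (p i - z))"
        by (simp add: Y_def scaleR_left_diff_distrib sum_subtractf)
      also have "\<dots> \<le> (\<Sum>i<n. (d + real n * d) * D)"
        using coeff D(2) d0 by (intro sum_norm_le) (auto intro!: mult_mono)
      also have "\<dots> = D * (real n + real n * real n) * d"
        by (simp add: algebra_simps)
      finally show ?thesis .
    qed (use D in \<open>simp add: Y_def\<close>)
    define \<eta> where "\<eta> = e / (2 * (2 * D * real n + 1))"
    have \<eta>0: "0 < \<eta>" using e D(1) by (simp add: \<eta>_def add_nonneg_pos)
    have "\<exists>c\<in>Q. \<forall>i<n. \<bar>a i (T (Y c)) - c i\<bar> \<le> \<eta>"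
      unfolding Q_def
    proof (rule cube_approximate_fixpoint[where F = "\<lambda>c i. a i (T (Y c))", OF _ _ \<eta>0], fold Q_def)
      fix c assume "c \<in> Q"
      then have "T (Y c) \<in> K" using YK T by auto
      then show "(\<lambda>i. a i (T (Y c))) \<in> Q"
        using le1 w0 W0[of "T (Y c)"] by (auto simp: Q_def) (simp add: a_def less_imp_le)
    next
      fix \<epsilon> :: real assume \<epsilon>: "0 < \<epsilon>"
      have "\<exists>d>0. \<forall>x\<in>K. \<forall>y\<in>K. dist y x < d \<longrightarrow> \<bar>a i (T y) - a i (T x)\<bar> < \<epsilon>" for i
      proof -
        have "continuous_on K (\<lambda>y. a i (T y))"
          using continuous_on_compose2[OF cont_w T(1)] T(2) by auto
        then have "uniformly_continuous_on K (\<lambda>y. a i (T y))"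
          by (rule compact_uniformly_continuous[OF _ K(1)])
        from this[unfolded uniformly_continuous_on_def dist_real_def, rule_format, OF \<epsilon>] show ?thesis
          by blast
      qed
      then obtain \<rho> where \<rho>: "\<And>i. 0 < \<rho> i"
        "\<And>i x y. x \<in> K \<Longrightarrow> y \<in> K \<Longrightarrow> dist y x < \<rho> i \<Longrightarrow> \<bar>a i (T y) - a i (T x)\<bar> < \<epsilon>"
        by metis
      define \<rho>0 where "\<rho>0 = Min (insert 1 (\<rho> ` {..<n}))"
      have \<rho>0: "0 < \<rho>0" "\<And>i. i < n \<Longrightarrow> \<rho>0 \<le> \<rho> i"
        using \<rho>(1) by (auto simp: \<rho>0_def)
      define L where "L = D * (real n + real n * real n) + 1"
      have L: "1 \<le> L" using D by (simp add: L_def)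
      show "\<exists>d>0. \<forall>x\<in>Q. \<forall>y\<in>Q. (\<forall>i<n. \<bar>x i - y i\<bar> \<le> d) \<longrightarrow>
          (\<forall>i<n. \<bar>a i (T (Y x)) - a i (T (Y y))\<bar> \<le> \<epsilon>)"
      proof (intro exI[of _ "\<rho>0 / (2 * L)"] conjI ballI impI allI)
        show "0 < \<rho>0 / (2 * L)" using \<rho>0 L by simp
        fix x y i assume *: "x \<in> Q" "y \<in> Q" "\<forall>i<n. \<bar>x i - y i\<bar> \<le> \<rho>0 / (2 * L)" "i < n"
        have "norm (Y x - Y y) \<le> (L - 1) * (\<rho>0 / (2 * L))"
          using YL[OF *(1-3)] by (simp add: L_def)
        also have "\<dots> \<le> L * (\<rho>0 / (2 * L))"
          using \<rho>0 L by (intro mult_right_mono) auto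
        also have "\<dots> < \<rho>0" using L \<rho>0 by simp
        finally have "dist (Y x) (Y y) < \<rho> i" using \<rho>0(2)[OF *(4)] by (simp add: dist_norm)
        then show "\<bar>a i (T (Y x)) - a i (T (Y y))\<bar> \<le> \<epsilon>"
          using \<rho>(2)[OF YK[OF *(2)] YK[OF *(1)], of i] by simp
      qed
    qed
    then obtain c where c: "c \<in> Q" "\<And>i. i < n \<Longrightarrow> \<bar>a i (T (Y c)) - c i\<bar> \<le> \<eta>"
      by blast
    define y where "y = T (Y c)"
    have yK: "y \<in> K" using YK[OF c(1)] T by (auto simp: y_def)
    have a: "0 \<le> a i y" "(\<Sum>i<n. a i y) = 1" for i
      using w0 W0[OF yK] sum1[OF yK] by (auto simp: a_def less_imp_le)
    have ac: "\<bar>a i y - c i\<bar> \<le> \<eta>" if "i < n" for i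
      using c(2)[OF that] by (simp add: y_def)
    have "norm (y - (\<Sum>i<n. a i y *\<^sub>R p i)) \<le> e / 2"
    proof -
      have "y - (\<Sum>i<n. a i y *\<^sub>R p i) = (\<Sum>i<n. a i y *\<^sub>R (y - p i))"
        using a(2) by (simp add: sum_scaleR_diff')
      also have "norm \<dots> \<le> (\<Sum>i<n. a i y * (e / 2))"
      proof (rule sum_norm_le)
        fix i
        show "norm (a i y *\<^sub>R (y - p i)) \<le> a i y * (e / 2)"
        proof (cases "a i y = 0")
          case False
          then have "w i y > 0" using w0[of i y] by (auto simp: a_def less_le)
          then have "norm (y - p i) \<le> e / 2"
            by (auto simp: w_def dist_norm norm_minus_commute)
          then show ?thesis using a(1)[of i] mult_left_mono[of "norm (y - p i)" "e / 2" "a i y"] by simp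
        qed simp
      qed
      also have "\<dots> = e / 2" using a(2) by (simp flip: sum_divide_distrib sum_distrib_right)
      finally show ?thesis .
    qed
    moreover have "norm ((\<Sum>i<n. a i y *\<^sub>R p i) - Y c) \<le> e / 2"
    proof -
      have "(\<Sum>i<n. a i y *\<^sub>R p i) = z + (\<Sum>i<n. a i y *\<^sub>R (p i - z))"
        using a(2) by (simp add: sum_scaleR_diff)
      then have "norm ((\<Sum>i<n. a i y *\<^sub>R p i) - Y c) = norm (\<Sum>i<n. (a i y - c i / \<sigma> c) *\<^sub>R (p i - z))"
        by (simp add: Y_def scaleR_left_diff_distrib sum_subtractf)
      also have "\<dots> \<le> (\<Sum>i<n. (\<eta> + (c i - c i / \<sigma> c)) * D)"
      proof (rule sum_norm_le)
        fix i assume "i \<in> {..<n}"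
        then have i: "i < n" by simp
        have "c i / \<sigma> c \<le> c i"
          using c(1) i \<sigma>1(1)[of c] by (auto simp: Q_def divide_le_eq mult_le_cancel_left1)
        then have "\<bar>a i y - c i / \<sigma> c\<bar> \<le> \<eta> + (c i - c i / \<sigma> c)" using ac[OF i] by linarith
        then show "norm ((a i y - c i / \<sigma> c) *\<^sub>R (p i - z)) \<le> (\<eta> + (c i - c i / \<sigma> c)) * D"
          using D(2)[OF i] by (auto intro!: mult_mono)
      qed
      also have "\<dots> = (real n * \<eta> + ((\<Sum>i<n. c i) - (\<Sum>i<n. c i) / \<sigma> c)) * D"
        by (simp add: sum.distrib sum_subtractf flip: sum_distrib_right sum_divide_distrib)
      also have "\<dots> \<le> (real n * \<eta> + real n * \<eta>) * D"
      proof -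
        have "\<bar>(\<Sum>i<n. a i y) - (\<Sum>i<n. c i)\<bar> \<le> real n * \<eta>"
          using ac sum_abs[of "\<lambda>i. a i y - c i" "{..<n}"]
            sum_bounded_above[of "{..<n}" "\<lambda>i. \<bar>a i y - c i\<bar>" \<eta>]
          by (auto simp: sum_subtractf)
        then have "(\<Sum>i<n. c i) - (\<Sum>i<n. c i) / \<sigma> c \<le> real n * \<eta>"
          using a(2) \<eta>0 by (auto simp: \<sigma>_def max_def)
        then show ?thesis using D(1) by (intro mult_right_mono) linarith+
      qed
      also have "\<dots> = (2 * D * real n) * \<eta>" by simp
      also have "\<dots> \<le> (2 * D * real n + 1) * \<eta>" using \<eta>0 by (intro mult_right_mono) auto
      also have "\<dots> = e / 2"
      proof -
        have "2 * D * real n + 1 > 0" using D by (simp add: add_nonneg_pos)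
        moreover have "k * (e / (2 * k)) = e / 2" if "0 < k" for k
          using that by simp
        ultimately show ?thesis unfolding \<eta>_def by blast
      qed
      finally show ?thesis .
    qed
    ultimately have "norm (y - Y c) \<le> e"
      using norm_triangle_ineq[of "y - (\<Sum>i<n. a i y *\<^sub>R p i)" "(\<Sum>i<n. a i y *\<^sub>R p i) - Y c"] by simp
    then show ?thesis using YK[OF c(1)] by (auto simp: y_def)
  qed
  have "continuous_on K (\<lambda>x. norm (T x - x))"
    using T(1) by (intro continuous_intros)
  then obtain x where x: "x \<in> K" "\<And>y. y \<in> K \<Longrightarrow> norm (T x - x) \<le> norm (T y - y)"
    using continuous_attains_inf[OF K(1,3)] by blast
  have "norm (T x - x) \<le> e" if "0 < e" for e
    using approx[OF that] x(2) by (meson order_trans)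
  then have "norm (T x - x) \<le> 0"
    by (meson field_le_epsilon add_0 dense_ge)
  then show thesis
    using that x(1) by auto
qed

section \<open>Connected sets in compact metric spaces\<close>

text \<open>In a compact Hausdorff space the components agree with the quasi-components, so failure to be joined
  by a connected set is witnessed by a splitting into two closed pieces (the cut-wire theorem).\<close>

lemma connected_subset_joining_or_separation:
  fixes S :: "'a::metric_space set"
  assumes "compact S" "closed D" "D \<subseteq> S" "x \<in> S"
  obtains C where "connected C" "C \<subseteq> S" "x \<in> C" "C \<inter> D \<noteq> {}"
  | A B where "compact A" "compact B" "A \<union> B = S" "A \<inter> B = {}" "x \<in> A" "D \<subseteq> B"
proof (cases "\<exists>C. connected C \<and> C \<subseteq> S \<and> x \<in> C \<and> C \<inter> D \<noteq> {}")
  case False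
  have "separated_between (top_of_set S) {x} D"
  proof (rule cut_wire_fence_theorem)
    show "compact_space (top_of_set S)"
      using assms(1) by (simp add: compact_space_subtopology)
    show "Hausdorff_space (top_of_set S)"
      by (intro Hausdorff_space_subtopology Hausdorff_space_euclidean)
    show "closedin (top_of_set S) {x}" "closedin (top_of_set S) D"
      using assms by (auto intro: closed_subset)
    fix C assume "connectedin (top_of_set S) C"
    then have "connected C" "C \<subseteq> S"
      by (auto simp: connectedin_subtopology)
    then show "disjnt C {x} \<or> disjnt C D"
      using False by (auto simp: disjnt_def)
  qed
  then obtain A B where "closedin (top_of_set S) A" "closedin (top_of_set S) B"
    "A \<union> B = S" "disjnt A B" "x \<in> A" "D \<subseteq> B"
    by (auto simp: separated_between_alt)
  then show thesis
    using that(2)[of A B] assms(1) closedin_compact by (auto simp: disjnt_def)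
qed (use that in blast)

section \<open>The inverse of \<open>\<phi>\<^sub>1\<close>\<close>

definition phi1_inv :: "real \<Rightarrow> real" where
  "phi1_inv y = y / sqrt (1 + y\<^sup>2)"

lemma one_plus_sq_pos [simp]: "0 < 1 + (y::real)\<^sup>2"
  by (simp add: add_pos_nonneg)

lemma one_plus_sq_neq_0 [simp]: "1 + (y::real)\<^sup>2 \<noteq> 0"
  using one_plus_sq_pos[of y] by linarith

lemma phi1_inv_0 [simp]: "phi1_inv 0 = 0"
  by (simp add: phi1_inv_def)

lemma phi1_inv_sq: "1 - (phi1_inv y)\<^sup>2 = 1 / (1 + y\<^sup>2)"
proof -
  have "1 - y\<^sup>2 / k = 1 / k" if "k = 1 + y\<^sup>2" "0 < k" for k
    using that diff_divide_distrib[of k "y\<^sup>2" k] by simp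
  then show ?thesis
    by (simp add: phi1_inv_def power_divide)
qed

lemma abs_phi1_inv_less_1: "\<bar>phi1_inv y\<bar> < 1"
  using phi1_inv_sq[of y] one_plus_sq_pos[of y]
  by (metis abs_square_less_1 diff_gt_0_iff_gt zero_less_divide_1_iff)

lemma phi1_phi1_inv [simp]: "phi1 (phi1_inv y) = y"
proof -
  have "sqrt (1 - (phi1_inv y)\<^sup>2) = 1 / sqrt (1 + y\<^sup>2)"
    by (simp add: phi1_inv_sq real_sqrt_divide)
  moreover have "0 < sqrt (1 + y\<^sup>2)"
    by simp
  ultimately show ?thesis
    unfolding phi1_def by (simp add: phi1_inv_def del: real_sqrt_gt_0_iff)
qed

lemma phi1_inv_phi1:
  assumes "\<bar>s\<bar> < 1"
  shows "phi1_inv (phi1 s) = s"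
proof -
  have s: "0 < 1 - s\<^sup>2"
    using assms by (simp add: abs_square_less_1)
  then have "1 + (phi1 s)\<^sup>2 = 1 / (1 - s\<^sup>2)"
    by (simp add: phi1_def power_divide field_simps)
  then have "sqrt (1 + (phi1 s)\<^sup>2) = 1 / sqrt (1 - s\<^sup>2)"
    by (simp add: real_sqrt_divide)
  then show ?thesis
    using s by (simp add: phi1_inv_def phi1_def)
qed

lemma phi1_inv_minus: "phi1_inv (- y) = - phi1_inv y"
  by (simp add: phi1_inv_def)

lemma phi1_minus: "phi1 (- y) = - phi1 y"
  by (simp add: phi1_def)

lemma phi1_inv_eq_sin_arctan: "phi1_inv = (\<lambda>y. sin (arctan y))"
  by (simp add: phi1_inv_def [abs_def] sin_arctan)

lemma phi1_inv_deriv: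
  "(phi1_inv has_real_derivative cos (arctan y) * inverse (1 + y\<^sup>2)) (at y)"
  unfolding phi1_inv_eq_sin_arctan by (auto intro!: derivative_eq_intros)

lemma phi1_inv_strict_mono: "x < y \<Longrightarrow> phi1_inv x < phi1_inv y"
  by (rule DERIV_pos_imp_increasing)
    (use phi1_inv_deriv in \<open>force simp: cos_arctan intro!: mult_pos_pos\<close>)+

lemma phi1_inv_mono: "x \<le> y \<Longrightarrow> phi1_inv x \<le> phi1_inv y"
  using phi1_inv_strict_mono[of x y] by (cases "x = y") auto

lemma phi1_inv_nonneg: "0 \<le> y \<Longrightarrow> 0 \<le> phi1_inv y"
  by (simp add: phi1_inv_def)

lemma phi1_inv_less_1: "phi1_inv y < 1"
  using abs_phi1_inv_less_1[of y] by simp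

lemma phi1_inv_Lipschitz: "\<bar>phi1_inv x - phi1_inv y\<bar> \<le> \<bar>x - y\<bar>"
proof -
  have "\<bar>cos (arctan z) * inverse (1 + z\<^sup>2)\<bar> \<le> 1 * 1" for z :: real
    unfolding abs_mult by (intro mult_mono abs_cos_le_one) (auto simp: inverse_le_1_iff)
  then have "norm (phi1_inv x - phi1_inv y) \<le> 1 * norm (x - y)"
    by (intro field_differentiable_bound[where S = UNIV and f' = "\<lambda>z. cos (arctan z) * inverse (1 + z\<^sup>2)"])
      (use phi1_inv_deriv in auto)
  then show ?thesis by simp
qed

lemma continuous_on_phi1_inv [continuous_intros]:
  assumes "continuous_on S g"
  shows "continuous_on S (\<lambda>x. phi1_inv (g x))"
  unfolding phi1_inv_def using assms by (intro continuous_intros) (auto simp: less_imp_neq[symmetric])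

lemma phi1_inv_tendsto_1: "(phi1_inv \<longlongrightarrow> 1) at_top"
  unfolding phi1_inv_eq_sin_arctan using tendsto_sin[OF tendsto_arctan_at_top] by simp

lemma abs_divide_pos: "0 < d \<Longrightarrow> \<bar>x\<bar> / d = \<bar>x / d\<bar>" for d :: real
  by simp

text \<open>Near the origin \<open>\<phi>\<^sub>1\<^sup>-\<^sup>1\<close> differs from the identity by a term of higher order; this is what makes the
  rescaled small solutions linear in the limit.\<close>

lemma phi1_inv_quadratic: "\<bar>phi1_inv z - z\<bar> \<le> z\<^sup>2"
proof -
  define k where "k = sqrt (1 + z\<^sup>2)"
  have k: "1 \<le> k" by (simp add: k_def)
  have "k \<le> 1 + \<bar>z\<bar>"
    unfolding k_def by (rule real_le_lsqrt) (auto simp: power2_eq_square algebra_simps)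
  have "\<bar>1 / k - 1\<bar> \<le> \<bar>z\<bar>"
  proof -
    have "\<bar>1 / k - 1\<bar> = (k - 1) / k"
      using k by (simp add: diff_divide_distrib)
    also have "\<dots> \<le> (k - 1) / 1"
      using k by (intro divide_left_mono) auto
    finally show ?thesis
      using \<open>k \<le> 1 + \<bar>z\<bar>\<close> by simp
  qed
  moreover have "phi1_inv z - z = z * (1 / k - 1)"
    by (simp add: phi1_inv_def k_def algebra_simps)
  moreover have "\<bar>z\<bar> * \<bar>1 / k - 1\<bar> \<le> \<bar>z\<bar> * \<bar>z\<bar>"
    using calculation(1) by (rule mult_left_mono) simp
  ultimately show ?thesis
    by (simp add: abs_mult power2_eq_square)
qed

lemma uniform_limit_phi1_inv:
  assumes "uniform_limit S g l F"
  shows "uniform_limit S (\<lambda>n s. phi1_inv (g n s)) (\<lambda>s. phi1_inv (l s)) F"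
proof (rule uniform_limitI)
  fix e :: real assume "0 < e"
  from uniform_limitD[OF assms this]
  show "\<forall>\<^sub>F n in F. \<forall>s\<in>S. dist (phi1_inv (g n s)) (phi1_inv (l s)) < e"
    by eventually_elim (auto simp: dist_real_def intro: le_less_trans[OF phi1_inv_Lipschitz])
qed

section \<open>Radial integrals\<close>

text \<open>The radial average that inverts \<open>p \<mapsto> r\<^sup>1\<^sup>-\<^sup>N (r\<^sup>N\<^sup>-\<^sup>1 p)'\<close>: the function \<open>r\<^sup>N\<^sup>-\<^sup>1 flux h r\<close> is the primitive of \<open>r\<^sup>N\<^sup>-\<^sup>1 h\<close> vanishing at
  \<open>\<delta>\<close>. For \<open>\<delta> = 0\<close> the value at the origin is \<open>0 / 0 = 0\<close>, which is also the limit there.\<close>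

definition flux :: "nat \<Rightarrow> real \<Rightarrow> (real \<Rightarrow> real) \<Rightarrow> real \<Rightarrow> real" where
  "flux N \<delta> h s = integral {\<delta>..s} (\<lambda>t. t ^ (N - 1) * h t) / s ^ (N - 1)"

locale radial_interval =
  fixes N :: nat and \<delta> R :: real
  assumes N: "2 \<le> N" and \<delta>: "0 \<le> \<delta>" "\<delta> < R"
begin

lemma flux_integrand:
  assumes "continuous_on {\<delta>..R} h" "\<delta> \<le> a" "b \<le> R"
  shows "(\<lambda>t. t ^ (N - 1) * h t) integrable_on {a..b}"
  by (intro integrable_continuous_real continuous_intros continuous_on_subset[OF assms(1)])
    (use assms in auto)

lemma flux_at_left [simp]: "flux N \<delta> h \<delta> = 0"
  by (simp add: flux_def)

lemma power_times_flux:
  assumes "s \<in> {\<delta>..R}"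
  shows "s ^ (N - 1) * flux N \<delta> h s = integral {\<delta>..s} (\<lambda>t. t ^ (N - 1) * h t)"
proof (cases "s = 0")
  case True
  then have "\<delta> = s" using assms \<delta> by auto
  then show ?thesis by (simp add: flux_def)
qed (simp add: flux_def)

text \<open>The weight \<open>t\<^sup>N\<^sup>-\<^sup>1\<close> is largest at \<open>t = s\<close>, where it is cancelled by the denominator. The factor
  \<open>s - \<delta>\<close> takes care of the singularity of the equation at \<open>r = 0\<close>.\<close>

lemma flux_bound:
  assumes h: "continuous_on {\<delta>..R} h" and s: "s \<in> {\<delta>..R}" and B: "\<And>t. t \<in> {\<delta>..s} \<Longrightarrow> \<bar>h t\<bar> \<le> B"
  shows "\<bar>flux N \<delta> h s\<bar> \<le> B * (s - \<delta>)"
proof (cases "s = \<delta>")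
  case False
  then have s0: "0 < s" "\<delta> < s" using s \<delta> by auto
  have "0 \<le> B" using B[of \<delta>] s by fastforce
  have "norm (integral {\<delta>..s} (\<lambda>t. t ^ (N - 1) * h t)) \<le> (s ^ (N - 1) * B) * (s - \<delta>)"
  proof (rule integral_bound)
    fix t assume t: "t \<in> {\<delta>..s}"
    then have "\<bar>t ^ (N - 1)\<bar> \<le> s ^ (N - 1)"
      using \<delta> by (auto intro!: power_mono)
    then show "norm (t ^ (N - 1) * h t) \<le> s ^ (N - 1) * B"
      using B[OF t] by (auto simp: abs_mult intro!: mult_mono)
  qed (use s in \<open>auto intro!: continuous_intros continuous_on_subset[OF h]\<close>)
  then have "\<bar>integral {\<delta>..s} (\<lambda>t. t ^ (N - 1) * h t)\<bar> / s ^ (N - 1) \<le> B * (s - \<delta>)"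
    using s0 by (simp add: pos_divide_le_eq mult_ac)
  then show ?thesis
    using s0 by (simp add: flux_def abs_divide)
qed simp

lemma continuous_on_flux:
  assumes h: "continuous_on {\<delta>..R} h"
  shows "continuous_on {\<delta>..R} (flux N \<delta> h)"
  unfolding continuous_on_eq_continuous_within
proof
  fix s assume s: "s \<in> {\<delta>..R}"
  show "continuous (at s within {\<delta>..R}) (flux N \<delta> h)"
  proof (cases "s = \<delta>")
    case True
    obtain B where "\<forall>y\<in>h ` {\<delta>..R}. norm y \<le> B"
      using compact_imp_bounded[OF compact_continuous_image[OF h compact_Icc]]
      unfolding bounded_iff by blast
    then have B: "\<bar>h t\<bar> \<le> B" if "t \<in> {\<delta>..R}" for t
      using that by auto
    have "(flux N \<delta> h \<longlongrightarrow> 0) (at \<delta> within {\<delta>..R})"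
    proof (rule tendsto_0_le[where f = "\<lambda>s. s - \<delta>" and K = "B"])
      show "((\<lambda>s. s - \<delta>) \<longlongrightarrow> 0) (at \<delta> within {\<delta>..R})"
        by (auto intro!: tendsto_eq_intros)
      show "\<forall>\<^sub>F s in at \<delta> within {\<delta>..R}. norm (flux N \<delta> h s) \<le> norm (s - \<delta>) * B"
        unfolding eventually_at_filter
        using flux_bound[OF h] B by (intro always_eventually) (auto simp: mult.commute)
    qed
    then show ?thesis
      using True by (simp add: continuous_within)
  next
    case False
    then have "s \<noteq> 0" using s \<delta> by auto
    moreover have "continuous_on {\<delta>..R} (\<lambda>s. integral {\<delta>..s} (\<lambda>t. t ^ (N - 1) * h t))"
      by (rule indefinite_integral_continuous_1) (use flux_integrand[OF h] in auto)
    ultimately show ?thesis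
      unfolding flux_def using s
      by (intro continuous_intros) (auto simp: continuous_on_eq_continuous_within)
  qed
qed

lemma flux_diff:
  assumes "continuous_on {\<delta>..R} h" "continuous_on {\<delta>..R} k" "s \<in> {\<delta>..R}"
  shows "flux N \<delta> (\<lambda>t. h t - k t) s = flux N \<delta> h s - flux N \<delta> k s"
  using flux_integrand[OF assms(1), of \<delta> s] flux_integrand[OF assms(2), of \<delta> s] assms(3)
  by (simp add: flux_def right_diff_distrib Henstock_Kurzweil_Integration.integral_diff diff_divide_distrib)

lemma flux_scale: "flux N \<delta> (\<lambda>t. c * h t) s = c * flux N \<delta> h s"
  by (simp add: flux_def mult.left_commute[of _ c])

lemma flux_cong:
  assumes "\<And>t. t \<in> {\<delta>..s} \<Longrightarrow> h t = k t"
  shows "flux N \<delta> h s = flux N \<delta> k s"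
  using assms by (auto simp: flux_def intro!: arg_cong2[where f = divide] Henstock_Kurzweil_Integration.integral_cong)

lemma flux_nonneg:
  assumes "continuous_on {\<delta>..R} h" "s \<in> {\<delta>..R}" "\<And>t. t \<in> {\<delta>..s} \<Longrightarrow> 0 \<le> h t"
  shows "0 \<le> flux N \<delta> h s"
  unfolding flux_def using assms \<delta>
  by (intro divide_nonneg_nonneg Henstock_Kurzweil_Integration.integral_nonneg flux_integrand[OF assms(1)]) auto

text \<open>A minorant on an initial interval suffices, because the numerator of \<open>flux\<close> increases with \<open>s\<close> and
  its denominator is at most \<open>R\<^sup>N\<^sup>-\<^sup>1\<close>.\<close>

lemma flux_lower_bound:
  assumes h: "continuous_on {\<delta>..R} h" "\<And>t. t \<in> {\<delta>..R} \<Longrightarrow> 0 \<le> h t"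
    and k: "continuous_on {\<delta>..R} k" "\<And>t. t \<in> {\<delta>..b} \<Longrightarrow> k t \<le> h t" "\<And>t. t \<in> {\<delta>..b} \<Longrightarrow> 0 \<le> k t"
    and s: "\<delta> < b" "b \<le> s" "s \<le> R"
  shows "integral {\<delta>..b} (\<lambda>t. t ^ (N - 1) * k t) / R ^ (N - 1) \<le> flux N \<delta> h s"
proof -
  have "integral {\<delta>..b} (\<lambda>t. t ^ (N - 1) * k t) \<le> integral {\<delta>..b} (\<lambda>t. t ^ (N - 1) * h t)"
    using \<delta> s k by (intro integral_le flux_integrand[OF h(1)] flux_integrand[OF k(1)] mult_left_mono) auto
  also have "\<dots> \<le> integral {\<delta>..s} (\<lambda>t. t ^ (N - 1) * h t)"
    using \<delta> s h by (intro integral_subset_le flux_integrand[OF h(1)]) auto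
  finally have le: "integral {\<delta>..b} (\<lambda>t. t ^ (N - 1) * k t) \<le> integral {\<delta>..s} (\<lambda>t. t ^ (N - 1) * h t)" .
  have "0 \<le> integral {\<delta>..b} (\<lambda>t. t ^ (N - 1) * k t)"
    using \<delta> s k by (intro Henstock_Kurzweil_Integration.integral_nonneg flux_integrand[OF k(1)]) auto
  with le show ?thesis
    unfolding flux_def using s \<delta> by (intro frac_le) (auto intro!: power_mono)
qed

lemma weighted_integral_pos:
  assumes k: "continuous_on {\<delta>..R} k" "\<And>t. t \<in> {\<delta>..b} \<Longrightarrow> 0 \<le> k t"
    and b: "\<delta> < b" "b \<le> R" and t0: "t0 \<in> {\<delta><..b}" "0 < k t0"
  shows "0 < integral {\<delta>..b} (\<lambda>t. t ^ (N - 1) * k t)"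
proof -
  let ?g = "\<lambda>t. t ^ (N - 1) * k t"
  have nonneg: "0 \<le> integral {\<delta>..b} ?g"
    using \<delta> b k by (intro Henstock_Kurzweil_Integration.integral_nonneg flux_integrand[OF k(1)]) auto
  have "integral {\<delta>..b} ?g \<noteq> 0"
  proof
    assume "integral {\<delta>..b} ?g = 0"
    then have *: "(?g has_integral 0) (cbox \<delta> b)"
      using flux_integrand[OF k(1), of \<delta> b] b by (simp add: has_integral_iff)
    have "?g t0 = 0"
      using b t0 \<delta> k
      by (intro has_integral_0_cbox_imp_0[OF _ _ *])
        (auto intro!: continuous_intros continuous_on_subset[OF k(1)])
    then show False using t0 \<delta> by auto
  qed
  with nonneg show ?thesis by simp
qed

lemma flux_pos:
  assumes h: "continuous_on {\<delta>..R} h" "\<And>t. t \<in> {\<delta>..R} \<Longrightarrow> 0 \<le> h t"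
    and s: "\<delta> < s" "s \<le> R" and t0: "t0 \<in> {\<delta><..s}" "0 < h t0"
  shows "0 < flux N \<delta> h s"
  unfolding flux_def using weighted_integral_pos[OF h(1) _ s t0] h(2) s \<delta> by (intro divide_pos_pos) auto

lemma flux_uniform_limit:
  assumes "\<And>n. continuous_on {\<delta>..R} (h n)" "continuous_on {\<delta>..R} k"
    and lim: "uniform_limit {\<delta>..R} h k sequentially"
  shows "uniform_limit {\<delta>..R} (\<lambda>n. flux N \<delta> (h n)) (flux N \<delta> k) sequentially"
proof (rule uniform_limitI)
  fix e :: real assume e: "0 < e"
  then have "0 < e / (2 * (R - \<delta>))" using \<delta> by simp
  from uniform_limitD[OF lim this]
  show "\<forall>\<^sub>F n in sequentially. \<forall>s\<in>{\<delta>..R}. dist (flux N \<delta> (h n) s) (flux N \<delta> k s) < e"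
  proof eventually_elim
    case (elim n)
    show ?case
    proof
      fix s assume s: "s \<in> {\<delta>..R}"
      have "\<bar>flux N \<delta> (h n) s - flux N \<delta> k s\<bar> = \<bar>flux N \<delta> (\<lambda>t. h n t - k t) s\<bar>"
        using assms s by (simp add: flux_diff)
      also have "\<dots> \<le> e / (2 * (R - \<delta>)) * (s - \<delta>)"
        using elim s assms by (intro flux_bound) (auto intro!: continuous_intros simp: dist_real_def less_imp_le)
      also have "\<dots> \<le> e / (2 * (R - \<delta>)) * (R - \<delta>)"
        using s e \<delta> by (intro mult_left_mono) auto
      also have "\<dots> = e / 2"
        using \<delta> times_divide_eq_left[of e "2 * (R - \<delta>)" "R - \<delta>"] mult_divide_mult_cancel_right[of "R - \<delta>" e 2]
        by (metis diff_gt_0_iff_gt less_irrefl)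
      finally show "dist (flux N \<delta> (h n) s) (flux N \<delta> k s) < e"
        using e by (simp add: dist_real_def)
    qed
  qed
qed

lemma flux_has_derivative:
  assumes "continuous_on {\<delta>..R} h" "s \<in> {\<delta>..R}"
  shows "((\<lambda>s. s ^ (N - 1) * flux N \<delta> h s) has_real_derivative s ^ (N - 1) * h s) (at s within {\<delta>..R})"
proof (rule has_field_derivative_transform_within[OF _ zero_less_one assms(2)])
  show "((\<lambda>s. integral {\<delta>..s} (\<lambda>t. t ^ (N - 1) * h t)) has_real_derivative s ^ (N - 1) * h s) (at s within {\<delta>..R})"
    using assms by (intro integral_has_real_derivative continuous_intros)
qed (simp add: power_times_flux del: One_nat_def)

end

section \<open>Continuous differentiability and uniform limits\<close>

lemma C1_on_realI:
  assumes "a < b" "\<And>r. r \<in> {a..b} \<Longrightarrow> (u has_real_derivative u' r) (at r within {a..b})" "continuous_on {a..b} u'"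
  shows "C1_on a b u" "r \<in> {a..b} \<Longrightarrow> iderivative a b u r = u' r"
proof -
  have vd: "(u has_vector_derivative u' r) (at r within {a..b})" if "r \<in> {a..b}" for r
    using assms(2)[OF that] by (simp add: has_real_derivative_iff_has_vector_derivative)
  have id: "iderivative a b u r = u' r" if "r \<in> {a..b}" for r
    unfolding iderivative_def using vd[OF that] that assms(1)
    by (intro vector_derivative_within_closed_interval) auto
  then show "r \<in> {a..b} \<Longrightarrow> iderivative a b u r = u' r" .
  show "C1_on a b u"
    unfolding C1_on_def
  proof
    show "u differentiable_on {a..b}"
      using assms(2) unfolding differentiable_on_def has_field_derivative_def differentiable_def by blast
    show "continuous_on {a..b} (iderivative a b u)"
      using assms(3) by (rule continuous_on_eq) (simp add: id)
  qed
qed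

lemma C1_on_has_real_derivative:
  assumes "C1_on a b u" "r \<in> {a..b}"
  shows "(u has_real_derivative iderivative a b u r) (at r within {a..b})"
  using iderivative_has[OF assms] by (simp add: has_real_derivative_iff_has_vector_derivative)

lemma C1_on_continuous:
  assumes "C1_on a b u"
  shows "continuous_on {a..b} u" "continuous_on {a..b} (iderivative a b u)"
  using assms by (auto simp: C1_on_def differentiable_imp_continuous_on)

lemma C_norm_least:
  assumes "a < b" "\<And>r. r \<in> {a..b} \<Longrightarrow> \<bar>u r\<bar> \<le> c"
  shows "C_norm a b u \<le> c"
  unfolding C_norm_def using assms by (intro cSUP_least) auto

lemma
  assumes "a < b" "u \<in> E a b" "v \<in> E a b"
  shows E_dist_le: "(\<And>r. r \<in> {a..b} \<Longrightarrow> \<bar>u r - v r\<bar> \<le> c) \<Longrightarrow>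
      (\<And>r. r \<in> {a..b} \<Longrightarrow> \<bar>iderivative a b u r - iderivative a b v r\<bar> \<le> d) \<Longrightarrow> E_dist a b u v \<le> c + d"
    and E_dist_ge: "r \<in> {a..b} \<Longrightarrow> \<bar>u r - v r\<bar> \<le> E_dist a b u v"
      "r \<in> {a..b} \<Longrightarrow> \<bar>iderivative a b u r - iderivative a b v r\<bar> \<le> E_dist a b u v"
proof -
  let ?D = "iderivative a b"
  have C1: "C1_on a b u" "C1_on a b v"
    using assms by (auto simp: E_def)
  have dist: "E_dist a b u v = C_norm a b (\<lambda>r. u r - v r) + C_norm a b (\<lambda>r. ?D u r - ?D v r)"
    using assms C1 by (simp add: E_dist_def C1_norm_diff)
  note cont = continuous_on_diff[OF C1_on_continuous(1)[OF C1(1)] C1_on_continuous(1)[OF C1(2)]]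
    continuous_on_diff[OF C1_on_continuous(2)[OF C1(1)] C1_on_continuous(2)[OF C1(2)]]
  show "E_dist a b u v \<le> c + d" if "\<And>r. r \<in> {a..b} \<Longrightarrow> \<bar>u r - v r\<bar> \<le> c"
    "\<And>r. r \<in> {a..b} \<Longrightarrow> \<bar>?D u r - ?D v r\<bar> \<le> d"
    unfolding dist using that by (intro add_mono C_norm_least assms)
  show "r \<in> {a..b} \<Longrightarrow> \<bar>u r - v r\<bar> \<le> E_dist a b u v" "r \<in> {a..b} \<Longrightarrow> \<bar>?D u r - ?D v r\<bar> \<le> E_dist a b u v"
    using C_norm_upper[OF cont(1), of r] C_norm_upper[OF cont(2), of r] C_norm_nonneg[OF cont(1) assms(1)]
      C_norm_nonneg[OF cont(2) assms(1)] dist by linarith+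
qed

lemma uniform_limit_scale:
  fixes g :: "nat \<Rightarrow> 'a \<Rightarrow> real"
  assumes "uniform_limit S g l sequentially" "c \<longlonglongrightarrow> d" "bounded (l ` S)"
  shows "uniform_limit S (\<lambda>n s. c n * g n s) (\<lambda>s. d * l s) sequentially"
proof (rule uniform_lim_mult)
  show "uniform_limit S (\<lambda>n s. c n) (\<lambda>s. d) sequentially"
  proof (rule uniform_limitI)
    fix e :: real assume "0 < e"
    from tendstoD[OF assms(2) this] show "\<forall>\<^sub>F n in sequentially. \<forall>s\<in>S. dist (c n) d < e"
      by eventually_elim auto
  qed
qed (use assms in \<open>auto intro: finite_imp_bounded finite_subset[of _ "{d}"]\<close>)

lemma tendsto_apply_bcontfun:
  fixes v :: "'i \<Rightarrow> 'a::topological_space \<Rightarrow>\<^sub>C 'b::metric_space"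
  assumes "(v \<longlongrightarrow> l) F"
  shows "((\<lambda>n. v n x) \<longlongrightarrow> l x) F"
  using tendsto_bcontfun_uniform_limit[OF assms] by (rule tendsto_uniform_limitI) simp

lemma continuous_on_eval_bcontfun:
  "continuous_on S (\<lambda>v. apply_bcontfun v x)"
  unfolding continuous_on_def by (auto intro: tendsto_apply_bcontfun tendsto_ident_at)

section \<open>Profiles\<close>

locale bvp = radial_interval N \<delta> R for N :: nat and \<delta> R :: real +
  fixes \<alpha> :: real and f :: "real \<Rightarrow> real \<Rightarrow> real" and m :: "real \<Rightarrow> real"
  assumes \<alpha>: "R < \<alpha>"
    and f_cont: "continuous_on ({\<delta>..R} \<times> {0..<\<alpha>}) (\<lambda>(r, s). f r s)"
    and f_nonneg: "r \<in> {\<delta>..R} \<Longrightarrow> s \<in> {0..<\<alpha>} \<Longrightarrow> 0 \<le> f r s"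
    and f_pos: "r \<in> {\<delta>..R} \<Longrightarrow> s \<in> {0<..<\<alpha>} \<Longrightarrow> 0 < f r s"
    and f_linear: "uniform_limit {\<delta>..R} (\<lambda>s r. f r s / s) m (at_right 0)"
    and m_cont: "continuous_on {\<delta>..R} m"
    and m_nonneg: "r \<in> {\<delta>..R} \<Longrightarrow> 0 \<le> m r"
    and m_nonzero: "\<delta> \<le> a \<Longrightarrow> a < b \<Longrightarrow> b \<le> R \<Longrightarrow> \<exists>r\<in>{a..b}. m r \<noteq> 0"
begin

text \<open>The nearest-point retraction to \<open>[\<delta>, R]\<close>. It makes functions on the interval into bounded continuous
  functions on the line, which form a Banach space.\<close>

definition proj :: "real \<Rightarrow> real" where
  "proj r = max \<delta> (min R r)"

lemma proj_in [simp]: "proj r \<in> {\<delta>..R}" and proj_id: "r \<in> {\<delta>..R} \<Longrightarrow> proj r = r"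
  and proj_proj [simp]: "proj (proj r) = proj r"
  and proj_mono: "x \<le> y \<Longrightarrow> proj x \<le> proj y"
  and proj_Lip: "x \<le> y \<Longrightarrow> proj y - proj x \<le> y - x"
  and proj_left [simp]: "proj \<delta> = \<delta>" and proj_right [simp]: "proj R = R"
  using \<delta> by (auto simp: proj_def)

lemma proj_ge [simp]: "\<delta> \<le> proj r" and proj_le [simp]: "proj r \<le> R"
  using proj_in[of r] by auto

lemma continuous_on_proj [continuous_intros]: "continuous_on S proj"
  unfolding proj_def by (intro continuous_intros)

text \<open>The candidates for solutions: nonincreasing, 1-Lipschitz, vanishing at \<open>R\<close>, and constant on either
  side of \<open>[\<delta>, R]\<close>. This set is convex and, by the theorem of Arzela and Ascoli, compact; the Lipschitz
  bound 1 is built in because \<open>|\<phi>\<^sub>1\<^sup>-\<^sup>1| < 1\<close>.\<close>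

definition profiles :: "(real \<Rightarrow>\<^sub>C real) set" where
  "profiles = {v :: real \<Rightarrow>\<^sub>C real. (\<forall>x y. \<bar>v x - v y\<bar> \<le> \<bar>x - y\<bar>) \<and> (\<forall>x y. x \<le> y \<longrightarrow> v y \<le> v x) \<and>
     (\<forall>x. v x = v (proj x)) \<and> v R = 0}"

lemma
  assumes "v \<in> profiles"
  shows profile_Lipschitz: "\<bar>v x - v y\<bar> \<le> \<bar>x - y\<bar>"
    and profile_antimono: "x \<le> y \<Longrightarrow> v y \<le> v x"
    and profile_proj: "v x = v (proj x)"
    and profile_right: "v R = 0"
  using assms unfolding profiles_def by blast+

lemma
  assumes "v \<in> profiles"
  shows profile_nonneg: "0 \<le> v x"
    and profile_le_left: "v x \<le> v \<delta>"
    and profile_left_le: "v \<delta> \<le> R - \<delta>"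
proof -
  show "0 \<le> v x"
    using profile_antimono[OF assms proj_le, of x] profile_right[OF assms] profile_proj[OF assms, of x] by simp
  show "v x \<le> v \<delta>"
    using profile_antimono[OF assms proj_ge, of x] profile_proj[OF assms, of x] by simp
  show "v \<delta> \<le> R - \<delta>"
    using profile_Lipschitz[OF assms, of \<delta> R] profile_right[OF assms] \<delta> by simp
qed

lemma profile_le: "v \<in> profiles \<Longrightarrow> v x \<le> R - \<delta>"
  using profile_le_left[of v x] profile_left_le[of v] by linarith

lemma profile_range: "v \<in> profiles \<Longrightarrow> v x \<in> {0..<\<alpha>}"
  using profile_nonneg[of v x] profile_le[of v x] \<delta> \<alpha> by simp

lemma profile_eqI:
  assumes "v \<in> profiles" "w \<in> profiles" "\<And>x. x \<in> {\<delta>..R} \<Longrightarrow> v x = w x"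
  shows "v = w"
proof (rule bcontfun_eqI)
  show "v x = w x" for x
    using profile_proj[OF assms(1), of x] profile_proj[OF assms(2), of x] assms(3)[OF proj_in] by simp
qed

lemma zero_profile: "0 \<in> profiles"
  by (simp add: profiles_def)

lemma profile_eq_0:
  assumes "v \<in> profiles" "v \<delta> = 0"
  shows "v = 0"
proof (rule bcontfun_eqI)
  show "v x = apply_bcontfun 0 x" for x
    using profile_nonneg[OF assms(1), of x] profile_le_left[OF assms(1), of x] assms(2) by simp
qed

lemma
  assumes u: "\<And>x y. \<delta> \<le> x \<Longrightarrow> x \<le> y \<Longrightarrow> y \<le> R \<Longrightarrow> 0 \<le> u x - u y \<and> u x - u y \<le> y - x" "u R = 0"
  shows Bcontfun_proj: "apply_bcontfun (Bcontfun (\<lambda>x. u (proj x))) x = u (proj x)"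
    and Bcontfun_proj_profile: "Bcontfun (\<lambda>x. u (proj x)) \<in> profiles"
proof -
  have mono: "u (proj y) \<le> u (proj x)" "u (proj x) - u (proj y) \<le> y - x" if "x \<le> y" for x y
    using u(1)[OF proj_ge proj_mono[OF that] proj_le] proj_Lip[OF that] by auto
  then have Lip: "\<bar>u (proj x) - u (proj y)\<bar> \<le> \<bar>x - y\<bar>" for x y
    using mono[of x y] mono[of y x] by (cases "x \<le> y") auto
  have "(\<lambda>x. u (proj x)) \<in> bcontfun"
  proof (rule bcontfun_normI)
    have "1-lipschitz_on UNIV (\<lambda>x. u (proj x))"
      by (rule lipschitz_onI) (use Lip in \<open>auto simp: dist_real_def\<close>)
    then show "continuous_on UNIV (\<lambda>x. u (proj x))"
      by (rule lipschitz_on_continuous_on)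
    show "norm (u (proj x)) \<le> R - \<delta>" for x
      using u(1)[of "proj x" R] u(2) by (auto intro: order_trans[OF _ diff_left_mono[OF proj_ge]])
  qed
  then have app: "Bcontfun (\<lambda>x. u (proj x)) x = u (proj x)" for x
    by (simp add: Bcontfun_inverse)
  then show "Bcontfun (\<lambda>x. u (proj x)) x = u (proj x)" .
  show "Bcontfun (\<lambda>x. u (proj x)) \<in> profiles"
    unfolding profiles_def mem_Collect_eq app by (intro conjI allI impI Lip mono(1)) (simp_all add: u(2))
qed

lemma convex_profiles: "convex profiles"
proof (rule convexI)
  fix v w :: "real \<Rightarrow>\<^sub>C real" and a b :: real
  assume *: "v \<in> profiles" "w \<in> profiles" "0 \<le> a" "0 \<le> b" "a + b = 1"
  have ev: "(a *\<^sub>R v + b *\<^sub>R w) x = a * v x + b * w x" for x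
    by (simp add: plus_bcontfun.rep_eq scaleR_bcontfun.rep_eq)
  have Lip: "\<bar>a * v x + b * w x - (a * v y + b * w y)\<bar> \<le> \<bar>x - y\<bar>" for x y
  proof -
    have "\<bar>a * v x + b * w x - (a * v y + b * w y)\<bar> = \<bar>a * (v x - v y) + b * (w x - w y)\<bar>"
      by (simp add: algebra_simps)
    also have "\<dots> \<le> a * \<bar>v x - v y\<bar> + b * \<bar>w x - w y\<bar>"
      using * abs_triangle_ineq[of "a * (v x - v y)" "b * (w x - w y)"] by (simp add: abs_mult)
    also have "\<dots> \<le> a * \<bar>x - y\<bar> + b * \<bar>x - y\<bar>"
      using * profile_Lipschitz by (intro add_mono mult_left_mono) auto
    also have "\<dots> = \<bar>x - y\<bar>"
      using * by (simp flip: distrib_right)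
    finally show ?thesis .
  qed
  have anti: "a * v y + b * w y \<le> a * v x + b * w x" if "x \<le> y" for x y
    using * that profile_antimono by (intro add_mono mult_left_mono) auto
  have proj: "a * v x + b * w x = a * v (proj x) + b * w (proj x)" for x
    using profile_proj[OF *(1), of x] profile_proj[OF *(2), of x] by simp
  have right: "a * v R + b * w R = 0"
    using * profile_right by simp
  show "a *\<^sub>R v + b *\<^sub>R w \<in> profiles"
    unfolding profiles_def mem_Collect_eq ev by (intro conjI allI impI Lip anti proj right)
qed

lemma closed_profiles: "closed profiles"
proof -
  have "closed {v :: real \<Rightarrow>\<^sub>C real. \<bar>v x - v y\<bar> \<le> c}" for x y c
    by (intro closed_Collect_le continuous_intros continuous_on_eval_bcontfun)
  moreover have "closed {v :: real \<Rightarrow>\<^sub>C real. x \<le> y \<longrightarrow> v y \<le> v x}" for x y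
    by (cases "x \<le> y") (auto intro!: closed_Collect_le continuous_on_eval_bcontfun)
  moreover have "closed {v :: real \<Rightarrow>\<^sub>C real. v x = v y}" for x y
    by (intro closed_Collect_eq continuous_on_eval_bcontfun)
  moreover have "closed {v :: real \<Rightarrow>\<^sub>C real. v R = 0}"
    by (intro closed_Collect_eq continuous_on_eval_bcontfun continuous_intros)
  ultimately show ?thesis
    unfolding profiles_def by (intro closed_Collect_conj closed_Collect_all)
qed

text \<open>All profiles are 1-Lipschitz with values in \<open>[0, R - \<delta>]\<close>, and uniform convergence on \<open>[\<delta>, R]\<close>
  is uniform convergence on the line.\<close>

lemma compact_profiles: "compact profiles"
  unfolding compact_eq_seq_compact_metric seq_compact_def
proof (intro allI impI)
  fix v :: "nat \<Rightarrow> real \<Rightarrow>\<^sub>C real" assume v: "\<forall>n. v n \<in> profiles"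
  obtain g k where k: "strict_mono (k :: nat \<Rightarrow> nat)"
    and g: "\<And>e. 0 < e \<Longrightarrow> \<exists>N. \<forall>n x. n \<ge> N \<and> x \<in> {\<delta>..R} \<longrightarrow> norm (v (k n) x - g x) < e"
  proof (rule Arzela_Ascoli[of "{\<delta>..R}" "\<lambda>n. apply_bcontfun (v n)" "R - \<delta>"])
    show "norm (v n x) \<le> R - \<delta>" for n x
      using v profile_nonneg[of "v n" x] profile_le[of "v n" x] by auto
    show "\<exists>d>0. \<forall>n y. y \<in> {\<delta>..R} \<and> norm (x - y) < d \<longrightarrow> norm (v n x - v n y) < e" if "0 < e" for x e
      using that v by (intro exI[of _ e]) (auto intro: le_less_trans[OF profile_Lipschitz])
  qed auto
  have "uniform_limit UNIV (\<lambda>n. apply_bcontfun (v (k n))) (\<lambda>x. g (proj x)) sequentially"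
  proof (rule uniform_limitI)
    fix e :: real assume "0 < e"
    from g[OF this] obtain N where "\<forall>n\<ge>N. \<forall>x\<in>{\<delta>..R}. norm (v (k n) x - g x) < e"
      by blast
    then have "\<forall>n\<ge>N. \<forall>x. dist (v (k n) x) (g (proj x)) < e"
      using v profile_proj by (metis dist_norm proj_in)
    then show "\<forall>\<^sub>F n in sequentially. \<forall>x\<in>UNIV. dist (v (k n) x) (g (proj x)) < e"
      by (auto simp: eventually_sequentially)
  qed
  then obtain l where "(\<lambda>n. v (k n)) \<longlonglongrightarrow> l"
    by (rule uniform_limit_bcontfunE) auto
  moreover have "l \<in> profiles"
    using closed_sequentially[OF closed_profiles _ \<open>(\<lambda>n. v (k n)) \<longlonglongrightarrow> l\<close>] v by blast
  ultimately show "\<exists>l\<in>profiles. \<exists>r. strict_mono r \<and> (v \<circ> r) \<longlonglongrightarrow> l"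
    using k by (auto simp: o_def)
qed

lemma continuous_on_f_compose:
  assumes "continuous_on S g" "continuous_on S u" "\<And>t. t \<in> S \<Longrightarrow> g t \<in> {\<delta>..R} \<and> u t \<in> {0..<\<alpha>}"
  shows "continuous_on S (\<lambda>t. f (g t) (u t))"
proof -
  have "(\<lambda>t. (g t, u t)) ` S \<subseteq> {\<delta>..R} \<times> {0..<\<alpha>}"
    using assms(3) by auto
  from continuous_on_compose2[OF f_cont continuous_on_Pair[OF assms(1,2)] this] show ?thesis
    by simp
qed

lemma profile_source_continuous:
  assumes "v \<in> profiles"
  shows "continuous_on {\<delta>..R} (\<lambda>t. f t (v t))"
  using profile_range[OF assms] by (intro continuous_on_f_compose continuous_on_id) auto

lemma profile_source_nonneg: "v \<in> profiles \<Longrightarrow> t \<in> {\<delta>..R} \<Longrightarrow> 0 \<le> f t (v t)"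
  using f_nonneg profile_range by simp

text \<open>Profiles take values in \<open>[0, R - \<delta>]\<close>, on which \<open>f\<close> is uniformly continuous since \<open>R - \<delta> < \<alpha>\<close>.\<close>

lemma profile_source_limit:
  assumes "\<And>n. v n \<in> profiles" "w \<in> profiles" "v \<longlonglongrightarrow> w"
  shows "uniform_limit {\<delta>..R} (\<lambda>n t. f t (v n t)) (\<lambda>t. f t (w t)) sequentially"
proof (rule uniform_limitI)
  fix e :: real assume e: "0 < e"
  have "uniformly_continuous_on ({\<delta>..R} \<times> {0..R - \<delta>}) (\<lambda>(r, s). f r s)"
    using \<delta> \<alpha> by (intro compact_uniformly_continuous continuous_on_subset[OF f_cont] compact_Times) auto
  then obtain d where d: "0 < d" "\<And>p q. p \<in> {\<delta>..R} \<times> {0..R - \<delta>} \<Longrightarrow> q \<in> {\<delta>..R} \<times> {0..R - \<delta>} \<Longrightarrow>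
      dist q p < d \<Longrightarrow> dist (case_prod f q) (case_prod f p) < e"
    using e unfolding uniformly_continuous_on_def by metis
  from tendstoD[OF assms(3) d(1)]
  show "\<forall>\<^sub>F n in sequentially. \<forall>t\<in>{\<delta>..R}. dist (f t (v n t)) (f t (w t)) < e"
  proof eventually_elim
    case (elim n)
    have "dist (t, v n t) (t, w t) < d" for t
      using elim dist_bounded[of "v n" t w] by (simp add: dist_Pair_Pair)
    then show ?case
      using d(2)[of "(_, w _)" "(_, v n _)"] assms profile_nonneg profile_le by auto
  qed
qed

lemma f_bounded: obtains B where "0 < B" "\<And>r s. r \<in> {\<delta>..R} \<Longrightarrow> s \<in> {0..R - \<delta>} \<Longrightarrow> f r s \<le> B"
proof -
  have "compact ((\<lambda>(r, s). f r s) ` ({\<delta>..R} \<times> {0..R - \<delta>}))"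
    using \<delta> \<alpha> by (intro compact_continuous_image continuous_on_subset[OF f_cont] compact_Times) auto
  then obtain B where B: "\<forall>y\<in>(\<lambda>(r, s). f r s) ` ({\<delta>..R} \<times> {0..R - \<delta>}). norm y \<le> B"
    using compact_imp_bounded[of "(\<lambda>(r, s). f r s) ` ({\<delta>..R} \<times> {0..R - \<delta>})"]
    unfolding bounded_iff by blast
  show thesis
  proof (rule that[of "max B 1"])
    fix r s assume "r \<in> {\<delta>..R}" "s \<in> {0..R - \<delta>}"
    then have "norm (f r s) \<le> B" using B by force
    then show "f r s \<le> max B 1" by simp
  qed auto
qed

section \<open>The solution operator\<close>

text \<open>One integration of the equation turns it into \<open>- \<phi>\<^sub>1(v') = \<lambda> rhs v\<close>.\<close>

definition rhs :: "(real \<Rightarrow>\<^sub>C real) \<Rightarrow> real \<Rightarrow> real" where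
  "rhs v = flux N \<delta> (\<lambda>t. f t (v t))"

lemma continuous_on_rhs: "v \<in> profiles \<Longrightarrow> continuous_on {\<delta>..R} (rhs v)"
  unfolding rhs_def by (intro continuous_on_flux profile_source_continuous)

lemma rhs_nonneg: "v \<in> profiles \<Longrightarrow> s \<in> {\<delta>..R} \<Longrightarrow> 0 \<le> rhs v s"
  unfolding rhs_def by (intro flux_nonneg profile_source_continuous profile_source_nonneg) auto

lemma rhs_limit:
  assumes "\<And>n. v n \<in> profiles" "w \<in> profiles" "v \<longlonglongrightarrow> w" "lam \<longlonglongrightarrow> \<mu>"
  shows "uniform_limit {\<delta>..R} (\<lambda>n s. lam n * rhs (v n) s) (\<lambda>s. \<mu> * rhs w s) sequentially"
proof (rule uniform_limit_scale[OF _ assms(4)])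
  show "uniform_limit {\<delta>..R} (\<lambda>n. rhs (v n)) (rhs w) sequentially"
    unfolding rhs_def using assms
    by (intro flux_uniform_limit profile_source_continuous profile_source_limit) auto
  show "bounded (rhs w ` {\<delta>..R})"
    by (intro compact_imp_bounded compact_continuous_image continuous_on_rhs assms) auto
qed

text \<open>Minus the derivative of \<open>solve lam v\<close>.\<close>

definition slope :: "real \<Rightarrow> (real \<Rightarrow>\<^sub>C real) \<Rightarrow> real \<Rightarrow> real" where
  "slope lam v s = phi1_inv (lam * rhs v s)"

lemma continuous_on_slope: "v \<in> profiles \<Longrightarrow> continuous_on {\<delta>..R} (slope lam v)"
  unfolding slope_def by (intro continuous_intros continuous_on_rhs)

lemma slope_integrable:
  "v \<in> profiles \<Longrightarrow> \<delta> \<le> a \<Longrightarrow> b \<le> R \<Longrightarrow> slope lam v integrable_on {a..b}"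
  by (intro integrable_continuous_real continuous_on_subset[OF continuous_on_slope]) auto

lemma slope_limit:
  assumes "\<And>n. v n \<in> profiles" "w \<in> profiles" "v \<longlonglongrightarrow> w" "lam \<longlonglongrightarrow> \<mu>"
  shows "uniform_limit {\<delta>..R} (\<lambda>n. slope (lam n) (v n)) (slope \<mu> w) sequentially"
  unfolding slope_def by (intro uniform_limit_phi1_inv rhs_limit assms)

lemma slope_nonneg: "v \<in> profiles \<Longrightarrow> 0 \<le> lam \<Longrightarrow> s \<in> {\<delta>..R} \<Longrightarrow> 0 \<le> slope lam v s"
  unfolding slope_def by (intro phi1_inv_nonneg mult_nonneg_nonneg rhs_nonneg)

lemma slope_less_1: "slope lam v s < 1"
  unfolding slope_def by (rule phi1_inv_less_1)

text \<open>The operator \<open>T(\<lambda>, v)\<close>, whose fixed points are the solutions for the parameter \<open>\<lambda>\<close>.\<close>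

definition solve :: "real \<Rightarrow> (real \<Rightarrow>\<^sub>C real) \<Rightarrow> (real \<Rightarrow>\<^sub>C real)" where
  "solve lam v = Bcontfun (\<lambda>r. integral {proj r..R} (slope lam v))"

lemma abs_integral_le:
  assumes "continuous_on {\<delta>..R} g" "\<And>s. s \<in> {\<delta>..R} \<Longrightarrow> \<bar>g s\<bar> \<le> B" "\<delta> \<le> a" "a \<le> b" "b \<le> R"
  shows "\<bar>integral {a..b} g\<bar> \<le> B * (b - a)"
  using integral_bound[of a b g B] continuous_on_subset[OF assms(1), of "{a..b}"] assms by auto

lemma solve_apply:
  assumes "v \<in> profiles"
  shows "solve lam v r = integral {proj r..R} (slope lam v)"
proof -
  have "(\<lambda>r. integral {proj r..R} (slope lam v)) \<in> bcontfun"
  proof (rule bcontfun_normI)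
    have "continuous_on {\<delta>..R} (\<lambda>r. integral {r..R} (slope lam v))"
      by (rule indefinite_integral_continuous_1') (use slope_integrable assms in auto)
    then show "continuous_on UNIV (\<lambda>r. integral {proj r..R} (slope lam v))"
      by (rule continuous_on_compose2) (auto intro!: continuous_intros)
    fix r
    have "\<bar>integral {proj r..R} (slope lam v)\<bar> \<le> 1 * (R - proj r)"
      using abs_phi1_inv_less_1
      by (intro abs_integral_le continuous_on_slope assms) (auto simp: slope_def less_imp_le)
    also have "\<dots> \<le> R - \<delta>" by simp
    finally show "norm (integral {proj r..R} (slope lam v)) \<le> R - \<delta>" by simp
  qed
  then show ?thesis
    by (simp add: solve_def Bcontfun_inverse)
qed

lemma solve_profile:
  assumes "v \<in> profiles" "0 \<le> lam"
  shows "solve lam v \<in> profiles"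
  unfolding solve_def
proof (rule Bcontfun_proj_profile, intro conjI)
  fix x y assume xy: "\<delta> \<le> x" "x \<le> y" "y \<le> R"
  have diff: "integral {x..R} (slope lam v) - integral {y..R} (slope lam v) = integral {x..y} (slope lam v)"
    using Henstock_Kurzweil_Integration.integral_combine[of x y R "slope lam v"]
      slope_integrable[OF assms(1), of x R lam] xy by simp
  show "0 \<le> integral {x..R} (slope lam v) - integral {y..R} (slope lam v)"
    unfolding diff using assms xy
    by (intro Henstock_Kurzweil_Integration.integral_nonneg slope_integrable slope_nonneg) auto
  have "\<bar>integral {x..y} (slope lam v)\<bar> \<le> 1 * (y - x)"
    using abs_phi1_inv_less_1 xy
    by (intro abs_integral_le continuous_on_slope assms) (auto simp: slope_def less_imp_le)
  then show "integral {x..R} (slope lam v) - integral {y..R} (slope lam v) \<le> y - x"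
    unfolding diff by simp
qed simp

lemma solve_has_derivative:
  assumes "v \<in> profiles" "r \<in> {\<delta>..R}"
  shows "(solve lam v has_real_derivative - slope lam v r) (at r within {\<delta>..R})"
proof (rule has_field_derivative_transform_within[OF _ zero_less_one assms(2)])
  show "((\<lambda>r. integral {r..R} (slope lam v)) has_real_derivative - slope lam v r) (at r within {\<delta>..R})"
    by (intro integral_has_real_derivative' continuous_on_slope assms)
qed (auto simp: solve_apply[OF assms(1)] proj_id)

lemma solve_tendsto:
  assumes "\<And>n. v n \<in> profiles" "w \<in> profiles" "v \<longlonglongrightarrow> w" "lam \<longlonglongrightarrow> \<mu>"
  shows "(\<lambda>n. solve (lam n) (v n)) \<longlonglongrightarrow> solve \<mu> w"
proof (rule uniform_limit_tendsto_bcontfun, rule uniform_limitI)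
  fix e :: real assume e: "0 < e"
  then have "0 < e / (2 * (R - \<delta>))" using \<delta> by simp
  from uniform_limitD[OF slope_limit[OF assms] this]
  show "\<forall>\<^sub>F n in sequentially. \<forall>x\<in>UNIV. dist (solve (lam n) (v n) x) (solve \<mu> w x) < e"
  proof eventually_elim
    case (elim n)
    show ?case
    proof
      fix x
      have "\<bar>integral {proj x..R} (\<lambda>s. slope (lam n) (v n) s - slope \<mu> w s)\<bar> \<le> e / (2 * (R - \<delta>)) * (R - proj x)"
        using elim by (intro abs_integral_le continuous_intros continuous_on_slope assms)
          (auto simp: dist_real_def less_imp_le)
      also have "\<dots> \<le> e / (2 * (R - \<delta>)) * (R - \<delta>)"
        using e \<delta> by (intro mult_left_mono) auto
      also have "\<dots> < e"
        using e \<delta> by (simp add: field_simps)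
      finally show "dist (solve (lam n) (v n) x) (solve \<mu> w x) < e"
        using slope_integrable assms
        by (simp add: solve_apply dist_real_def Henstock_Kurzweil_Integration.integral_diff)
    qed
  qed
qed

text \<open>A profile of positive height is positive near \<open>\<delta>\<close> by its Lipschitz bound, and so is \<open>f\<close> along it.\<close>

lemma rhs_pos:
  assumes v: "v \<in> profiles" "0 < v \<delta>" and s: "s \<in> {\<delta><..R}"
  shows "0 < rhs v s"
proof -
  define t0 where "t0 = min s (\<delta> + v \<delta> / 2)"
  have t0: "t0 \<in> {\<delta><..s}" "t0 - \<delta> \<le> v \<delta> / 2"
    using s v(2) by (auto simp: t0_def min_def field_simps)
  have "v \<delta> - v t0 \<le> t0 - \<delta>"
    using profile_Lipschitz[OF v(1), of \<delta> t0] t0 by auto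
  with t0 v(2) have "0 < v t0"
    by linarith
  then have "0 < f t0 (v t0)"
    using profile_range[OF v(1), of t0] t0 s by (intro f_pos) auto
  then show ?thesis
    unfolding rhs_def using s t0
    by (intro flux_pos[where ?t0.0 = t0] profile_source_continuous profile_source_nonneg v) auto
qed

lemma solve_left: "v \<in> profiles \<Longrightarrow> solve lam v \<delta> = integral {\<delta>..R} (slope lam v)"
  by (simp add: solve_apply)

lemma solve_left_strict_mono:
  assumes v: "v \<in> profiles" "0 < v \<delta>" and "lam < \<mu>"
  shows "solve lam v \<delta> < solve \<mu> v \<delta>"
  unfolding solve_left[OF v(1)]
proof (rule integral_less_real)
  fix s assume "s \<in> {\<delta><..<R}"
  then show "slope lam v s < slope \<mu> v s"
    unfolding slope_def using rhs_pos[OF v, of s] assms(3) by (intro phi1_inv_strict_mono mult_strict_right_mono) auto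
qed (use \<delta> v continuous_on_slope in auto)

lemma solve_left_less:
  assumes "v \<in> profiles"
  shows "solve lam v \<delta> < R - \<delta>"
proof -
  have "integral {\<delta>..R} (slope lam v) < integral {\<delta>..R} (\<lambda>_. 1)"
    using \<delta> assms by (intro integral_less_real continuous_on_slope slope_less_1 continuous_intros) auto
  then show ?thesis
    using \<delta> by (simp add: solve_left[OF assms])
qed

text \<open>Profiles of height at least \<open>a\<close> stay above \<open>a / 2\<close> up to distance \<open>a / 2\<close> from \<open>\<delta>\<close>, so that \<open>rhs\<close> has a
  uniform positive lower bound \<open>\<beta>\<close> away from \<open>\<delta>\<close>. For large \<open>\<lambda>\<close> the slope is then uniformly close to 1
  on all but a short initial interval of length \<open>\<eta>\<close>.\<close>

lemma solve_left_large:
  assumes a: "0 < a" and c: "0 \<le> c" "c < R - \<delta>"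
  obtains \<Lambda> where "0 \<le> \<Lambda>" "\<And>lam v. \<Lambda> \<le> lam \<Longrightarrow> v \<in> profiles \<Longrightarrow> a \<le> v \<delta> \<Longrightarrow> c < solve lam v \<delta>"
proof (cases "a \<le> R - \<delta>")
  case True
  have "\<exists>p\<in>{\<delta>..R} \<times> {a / 2..R - \<delta>}. \<forall>q\<in>{\<delta>..R} \<times> {a / 2..R - \<delta>}. (\<lambda>(r, s). f r s) p \<le> (\<lambda>(r, s). f r s) q"
    using True a \<delta> \<alpha> by (intro continuous_attains_inf compact_Times continuous_on_subset[OF f_cont]) auto
  then obtain r0 s0 where r0s0: "r0 \<in> {\<delta>..R}" "s0 \<in> {a / 2..R - \<delta>}"
    and min: "\<And>r s. r \<in> {\<delta>..R} \<Longrightarrow> s \<in> {a / 2..R - \<delta>} \<Longrightarrow> f r0 s0 \<le> f r s"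
    by force
  define \<kappa> where "\<kappa> = f r0 s0"
  have \<kappa>: "0 < \<kappa>"
    unfolding \<kappa>_def using r0s0 a \<delta> \<alpha> by (intro f_pos) auto
  \<comment> \<open>The first bound keeps the profiles above \<open>a / 2\<close> on \<open>[\<delta>, \<delta> + \<eta>]\<close>; the second lets a slope below 1 on
     \<open>[\<delta> + \<eta>, R]\<close> produce a height above \<open>c\<close>.\<close>
  define \<eta> where "\<eta> = min (a / 2) ((R - \<delta> - c) / 2)"
  have \<eta>: "0 < \<eta>" "\<eta> \<le> a / 2" "c < R - \<delta> - \<eta>"
    using a c by (auto simp: \<eta>_def min_def field_simps)
  define \<beta> where "\<beta> = integral {\<delta>..\<delta> + \<eta>} (\<lambda>t. t ^ (N - 1) * \<kappa>) / R ^ (N - 1)"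
  have "0 < integral {\<delta>..\<delta> + \<eta>} (\<lambda>t. t ^ (N - 1) * \<kappa>)"
    using \<eta> c \<kappa> by (intro weighted_integral_pos[where ?t0.0 = "\<delta> + \<eta>"]) auto
  then have \<beta>: "0 < \<beta>"
    using \<delta> by (simp add: \<beta>_def)
  have "((\<lambda>lam. phi1_inv (lam * \<beta>)) \<longlongrightarrow> 1) at_top"
    by (rule filterlim_compose[OF phi1_inv_tendsto_1])
      (use \<beta> in \<open>auto intro!: filterlim_at_top_mult_tendsto_pos[OF tendsto_const] filterlim_ident\<close>)
  moreover have "c / (R - \<delta> - \<eta>) < 1"
    using \<eta> c by simp
  ultimately have "\<forall>\<^sub>F lam in at_top. c / (R - \<delta> - \<eta>) < phi1_inv (lam * \<beta>)"
    by (rule order_tendstoD)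
  then obtain \<Lambda>0 where \<Lambda>0: "\<And>lam. \<Lambda>0 \<le> lam \<Longrightarrow> c / (R - \<delta> - \<eta>) < phi1_inv (lam * \<beta>)"
    unfolding eventually_at_top_linorder by blast
  show thesis
  proof (rule that[of "max 0 \<Lambda>0"])
    fix lam v assume *: "max 0 \<Lambda>0 \<le> lam" "v \<in> profiles" "a \<le> v \<delta>"
    have rhs: "\<beta> \<le> rhs v s" if "s \<in> {\<delta> + \<eta>..R}" for s
      unfolding \<beta>_def rhs_def
    proof (rule flux_lower_bound)
      fix t assume t: "t \<in> {\<delta>..\<delta> + \<eta>}"
      have "a / 2 \<le> v t"
        using profile_Lipschitz[OF *(2), of \<delta> t] t *(3) \<eta> by auto
      then show "\<kappa> \<le> f t (v t)"
        unfolding \<kappa>_def using t \<eta> c profile_le[OF *(2), of t] by (intro min) auto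
    qed (use that \<eta> \<kappa> * profile_source_continuous profile_source_nonneg in auto)
    have "c < (R - \<delta> - \<eta>) * phi1_inv (lam * \<beta>)"
      using \<Lambda>0[of lam] * \<eta> c by (simp add: pos_divide_less_eq mult.commute)
    also have "\<dots> = integral {\<delta> + \<eta>..R} (\<lambda>_. phi1_inv (lam * \<beta>))"
      using \<eta> c by simp
    also have "\<dots> \<le> integral {\<delta> + \<eta>..R} (slope lam v)"
      using \<eta> c * rhs
      by (intro integral_le slope_integrable) (auto simp: slope_def intro!: phi1_inv_mono mult_left_mono)
    also have "\<dots> \<le> integral {\<delta>..R} (slope lam v)"
      using \<eta> c * by (intro integral_subset_le slope_integrable) (auto intro!: slope_nonneg)
    finally show "c < solve lam v \<delta>"
      using solve_left[OF *(2)] by simp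
  qed simp
next
  case False
  then show thesis
    using that[of 0] profile_left_le by force
qed

section \<open>The parameter belonging to a prescribed height\<close>

text \<open>Well defined for profiles of positive height and \<open>0 < c < R - \<delta>\<close>, because the height of \<open>solve \<lambda> v\<close>
  is strictly increasing in \<open>\<lambda>\<close> and takes all these values.\<close>

definition lam_of :: "real \<Rightarrow> (real \<Rightarrow>\<^sub>C real) \<Rightarrow> real" where
  "lam_of c v = (THE lam. 0 \<le> lam \<and> solve lam v \<delta> = c)"

lemma lam_of_unique:
  assumes "v \<in> profiles" "0 < v \<delta>" "0 \<le> lam" "solve lam v \<delta> = c"
  shows "lam_of c v = lam"
  unfolding lam_of_def
  by (rule the_equality) (use assms solve_left_strict_mono[OF assms(1,2)] in \<open>auto simp: neq_iff\<close>, metis less_irrefl linorder_neqE)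

lemma lam_of:
  assumes v: "v \<in> profiles" "0 < v \<delta>" and c: "0 < c" "c < R - \<delta>"
  shows "0 < lam_of c v" "solve (lam_of c v) v \<delta> = c"
proof -
  obtain \<Lambda> where \<Lambda>: "0 \<le> \<Lambda>" "\<And>lam w. \<Lambda> \<le> lam \<Longrightarrow> w \<in> profiles \<Longrightarrow> v \<delta> \<le> w \<delta> \<Longrightarrow> c < solve lam w \<delta>"
    using solve_left_large[OF v(2) less_imp_le[OF c(1)] c(2)] by blast
  have zero: "solve 0 v \<delta> = 0"
    by (simp add: solve_left[OF v(1)] slope_def [abs_def])
  have "continuous_on {0..\<Lambda>} (\<lambda>lam. solve lam v \<delta>)"
    unfolding continuous_on_sequentially o_def
    using solve_tendsto[of "\<lambda>_. v" v] v by (auto intro!: tendsto_apply_bcontfun)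
  then obtain lam where lam: "0 \<le> lam" "solve lam v \<delta> = c"
    using IVT'[of "\<lambda>lam. solve lam v \<delta>" 0 c \<Lambda>] zero c \<Lambda>(1) \<Lambda>(2)[OF order_refl v(1) order_refl] by auto
  then have "lam \<noteq> 0"
    using zero c by auto
  with lam show "0 < lam_of c v" "solve (lam_of c v) v \<delta> = c"
    using lam_of_unique[OF v lam] by auto
qed

text \<open>The height of \<open>solve \<lambda> w\<close> is strictly increasing in \<open>\<lambda>\<close>, so it straddles \<open>d\<close> at \<open>L - e\<close> and \<open>L + e\<close>;
  the strict inequalities persist for nearby heights and profiles.\<close>

lemma lam_of_tendsto:
  assumes v: "\<And>n. v n \<in> profiles" "\<And>n. 0 < v n \<delta>" "w \<in> profiles" "0 < w \<delta>" "v \<longlonglongrightarrow> w"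
    and c: "\<And>n. 0 < c n" "\<And>n. c n < R - \<delta>" "0 < d" "d < R - \<delta>" "c \<longlonglongrightarrow> d"
  shows "(\<lambda>n. lam_of (c n) (v n)) \<longlonglongrightarrow> lam_of d w"
proof (rule tendstoI)
  fix e :: real assume "0 < e"
  define L where "L = lam_of d w"
  have L: "0 < L" "solve L w \<delta> = d"
    using lam_of[OF v(3,4) c(3,4)] by (auto simp: L_def)
  have lim: "(\<lambda>n. solve \<mu> (v n) \<delta>) \<longlonglongrightarrow> solve \<mu> w \<delta>" for \<mu>
    using solve_tendsto[OF v(1,3,5) tendsto_const] by (rule tendsto_apply_bcontfun)
  have up: "\<forall>\<^sub>F n in sequentially. c n < solve (L + e) (v n) \<delta>"
  proof -
    have "0 < solve (L + e) w \<delta> - d"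
      using solve_left_strict_mono[OF v(3,4), of L "L + e"] L \<open>0 < e\<close> by simp
    from order_tendstoD(1)[OF tendsto_diff[OF lim c(5)] this] show ?thesis
      by eventually_elim simp
  qed
  have down: "\<forall>\<^sub>F n in sequentially. solve (L - e) (v n) \<delta> < c n"
  proof -
    have "0 < d - solve (L - e) w \<delta>"
      using solve_left_strict_mono[OF v(3,4), of "L - e" L] L \<open>0 < e\<close> by simp
    from order_tendstoD(1)[OF tendsto_diff[OF c(5) lim] this] show ?thesis
      by eventually_elim simp
  qed
  from up down show "\<forall>\<^sub>F n in sequentially. dist (lam_of (c n) (v n)) (lam_of d w) < e"
  proof eventually_elim
    case (elim n)
    define M where "M = lam_of (c n) (v n)"
    have "solve M (v n) \<delta> = c n"
      using lam_of[OF v(1,2) c(1,2)] by (simp add: M_def)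
    with elim have "solve (L - e) (v n) \<delta> < solve M (v n) \<delta>" "solve M (v n) \<delta> < solve (L + e) (v n) \<delta>"
      by simp_all
    then have "L - e < M" "M < L + e"
      using solve_left_strict_mono[OF v(1,2), of M "L - e" n] solve_left_strict_mono[OF v(1,2), of "L + e" M n]
      by (metis less_asym less_irrefl linorder_neqE_linordered_idom)+
    then show ?case
      by (simp add: dist_real_def abs_less_iff flip: M_def L_def)
  qed
qed

text \<open>The nontrivial solutions of the boundary value problem, as profiles.\<close>

definition solutions :: "(real \<Rightarrow>\<^sub>C real) set" where
  "solutions = {v \<in> profiles. 0 < v \<delta> \<and> (\<exists>lam\<ge>0. solve lam v = v)}"

definition param :: "(real \<Rightarrow>\<^sub>C real) \<Rightarrow> real" where
  "param v = lam_of (v \<delta>) v"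

lemma solutionsD:
  assumes "v \<in> solutions"
  shows "v \<in> profiles" "0 < v \<delta>" "v \<delta> < R - \<delta>" "0 < param v" "solve (param v) v = v"
proof -
  from assms show v: "v \<in> profiles" "0 < v \<delta>"
    by (auto simp: solutions_def)
  from assms obtain lam where lam: "0 \<le> lam" "solve lam v = v"
    by (auto simp: solutions_def)
  show less: "v \<delta> < R - \<delta>"
    using solve_left_less[OF v(1), of lam] lam(2) by simp
  have "param v = lam"
    unfolding param_def using v lam by (intro lam_of_unique) auto
  then show "solve (param v) v = v"
    using lam by simp
  show "0 < param v"
    unfolding param_def using v less by (intro lam_of)
qed

lemma solutionsI:
  assumes "v \<in> profiles" "0 < v \<delta>" "0 \<le> lam" "solve lam v = v"
  shows "v \<in> solutions" "param v = lam"
  using assms by (auto simp: solutions_def param_def intro: lam_of_unique)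

lemma param_tendsto:
  assumes "\<And>n. v n \<in> solutions" "w \<in> profiles" "0 < w \<delta>" "w \<delta> < R - \<delta>" "v \<longlonglongrightarrow> w"
  shows "(\<lambda>n. param (v n)) \<longlonglongrightarrow> param w" "w \<in> solutions"
proof -
  show lim: "(\<lambda>n. param (v n)) \<longlonglongrightarrow> param w"
    unfolding param_def using assms solutionsD
    by (intro lam_of_tendsto tendsto_apply_bcontfun) auto
  have "(\<lambda>n. solve (param (v n)) (v n)) \<longlonglongrightarrow> solve (param w) w"
    using assms solutionsD lim by (intro solve_tendsto) auto
  then have "v \<longlonglongrightarrow> solve (param w) w"
    using solutionsD(5)[OF assms(1)] by simp
  with assms(5) have "solve (param w) w = w"
    using LIMSEQ_unique by blast
  moreover have "0 < param w"
    unfolding param_def using assms by (intro lam_of) auto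
  ultimately show "w \<in> solutions"
    using assms by (intro solutionsI(1)[where lam = "param w"]) auto
qed

text \<open>A limit of solutions is a solution unless its height is \<open>0\<close>, in which case it is the profile \<open>0\<close>, or
  \<open>R - \<delta>\<close>, which the bound \<open>b\<close> excludes.\<close>

lemma compact_solutions_below:
  assumes "b < R - \<delta>"
  shows "compact (insert 0 {v \<in> solutions. v \<delta> \<le> b})" (is "compact ?S")
proof -
  have "closed ?S"
    unfolding closed_sequential_limits
  proof (intro allI impI)
    fix x l assume *: "(\<forall>n. x n \<in> ?S) \<and> x \<longlonglongrightarrow> l"
    then have xp: "x n \<in> profiles" for n
      using * zero_profile solutionsD(1) by (metis (no_types, lifting) insertE mem_Collect_eq)
    then have l: "l \<in> profiles"
      using closed_sequentially[OF closed_profiles] * by blast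
    have lim: "(\<lambda>n. x n \<delta>) \<longlonglongrightarrow> l \<delta>"
      using * by (intro tendsto_apply_bcontfun) auto
    show "l \<in> ?S"
    proof (cases "l \<delta> = 0")
      case True
      then show ?thesis using profile_eq_0[OF l] by simp
    next
      case False
      then have pos: "0 < l \<delta>"
        using profile_nonneg[OF l, of \<delta>] by simp
      then obtain K where K: "\<And>n. K \<le> n \<Longrightarrow> 0 < x n \<delta>"
        using order_tendstoD(1)[OF lim pos] unfolding eventually_sequentially by blast
      have sol: "x (n + K) \<in> solutions \<and> x (n + K) \<delta> \<le> b" for n
        using * K[of "n + K"] by (metis (no_types, lifting) insertE le_add2 less_irrefl mem_Collect_eq zero_bcontfun.rep_eq)
      have lim': "(\<lambda>n. x (n + K)) \<longlonglongrightarrow> l"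
        using * LIMSEQ_ignore_initial_segment by blast
      have le: "l \<delta> \<le> b"
        by (rule LIMSEQ_le_const2[OF tendsto_apply_bcontfun[OF lim']]) (use sol in auto)
      with pos l sol lim' assms show ?thesis
        using param_tendsto(2)[of "\<lambda>n. x (n + K)" l] by auto
    qed
  qed
  moreover have "?S \<subseteq> profiles"
    using zero_profile solutionsD(1) by auto
  then have "profiles \<inter> ?S = ?S"
    by (rule Int_absorb1)
  ultimately show ?thesis
    using compact_Int_closed[OF compact_profiles, of ?S] by simp
qed

lemma profiles_between:
  assumes "0 \<le> a" "a \<le> b" "a \<le> R - \<delta>"
  defines "K \<equiv> {v \<in> profiles. a \<le> v \<delta> \<and> v \<delta> \<le> b}"
  shows "compact K" "convex K" "K \<noteq> {}"
proof -
  have "closed {v :: real \<Rightarrow>\<^sub>C real. a \<le> v \<delta> \<and> v \<delta> \<le> b}"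
    by (intro closed_Collect_conj closed_Collect_le continuous_on_eval_bcontfun continuous_intros)
  then show "compact K"
    using compact_Int_closed[OF compact_profiles] by (auto simp: K_def Collect_conj_eq)
  have ev: "(s *\<^sub>R v + t *\<^sub>R w) x = s * v x + t * w x" for s t x :: real and v w :: "real \<Rightarrow>\<^sub>C real"
    by (simp add: plus_bcontfun.rep_eq scaleR_bcontfun.rep_eq)
  show "convex K"
  proof (rule convexI)
    fix v w s t assume *: "v \<in> K" "w \<in> K" "0 \<le> s" "0 \<le> t" "s + t = (1::real)"
    have "s *\<^sub>R v + t *\<^sub>R w \<in> profiles"
      using * convexD[OF convex_profiles, of v w s t] by (simp add: K_def)
    moreover have "a \<le> s * v \<delta> + t * w \<delta>" "s * v \<delta> + t * w \<delta> \<le> b"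
      using * convex_bound_le[of "v \<delta>" b "w \<delta>" s t] convex_bound_le[of "- v \<delta>" "- a" "- w \<delta>" s t]
      by (simp_all add: K_def)
    ultimately show "s *\<^sub>R v + t *\<^sub>R w \<in> K"
      by (simp add: K_def ev)
  qed
  define k where "k = a / (R - \<delta>)"
  have k: "0 \<le> k" "k \<le> 1" "k * (R - \<delta>) = a"
    using assms \<delta> by (auto simp: k_def)
  have "0 \<le> k * (R - x) - k * (R - y) \<and> k * (R - x) - k * (R - y) \<le> y - x" if "x \<le> y" for x y
    using that k mult_right_mono[of k 1 "y - x"] by (simp flip: right_diff_distrib)
  then have "Bcontfun (\<lambda>x. k * (R - proj x)) \<in> profiles"
    "Bcontfun (\<lambda>x. k * (R - proj x)) \<delta> = k * (R - proj \<delta>)"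
    by (intro Bcontfun_proj_profile[of "\<lambda>x. k * (R - x)"] Bcontfun_proj[of "\<lambda>x. k * (R - x)"]; simp)+
  then have "Bcontfun (\<lambda>x. k * (R - proj x)) \<in> K"
    using k assms by (simp add: K_def)
  then show "K \<noteq> {}" by blast
qed

section \<open>Connected sets of solutions\<close>

text \<open>Schauder's theorem for the map that sends \<open>v\<close> to \<open>solve \<lambda> v\<close>, with \<open>\<lambda>\<close> adjusted so that the image
  has height \<open>h v\<close>. The map preserves the profiles with height in \<open>[a, b]\<close>, and its fixed points
  automatically have height \<open>h v\<close>.\<close>

lemma prescribed_left_solution:
  assumes ab: "0 < a" "a \<le> b" "b < R - \<delta>" and h: "continuous_on UNIV h" "\<And>v. h v \<in> {a..b}"
  obtains v where "v \<in> solutions" "v \<delta> = h v"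
proof -
  define K where "K = {v \<in> profiles. a \<le> v \<delta> \<and> v \<delta> \<le> b}"
  have hb: "0 < h v" "h v < R - \<delta>" "a \<le> h v" "h v \<le> b" for v
    using h(2)[of v] ab by auto
  define T where "T v = solve (lam_of (h v) v) v" for v
  have left: "T v \<delta> = h v" and pos: "0 < lam_of (h v) v" if "v \<in> K" for v
    using that lam_of[of v "h v"] hb[of v] ab by (auto simp: T_def K_def)
  obtain v where v: "v \<in> K" "T v = v"
  proof (rule schauder_fixpoint[of K T])
    show "compact K" "convex K" "K \<noteq> {}"
      unfolding K_def using profiles_between[of a b] ab by auto
    show "T \<in> K \<rightarrow> K"
      using left pos hb solve_profile by (auto simp: K_def T_def less_imp_le)
    show "continuous_on K T"
      unfolding continuous_on_sequentially
    proof (intro allI impI ballI)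
      fix x w assume w: "w \<in> K" and x: "(\<forall>n. x n \<in> K) \<and> x \<longlonglongrightarrow> w"
      have "(\<lambda>n. h (x n)) \<longlonglongrightarrow> h w"
        using x h(1) by (metis UNIV_I continuous_on_tendsto_compose eventually_sequentiallyI)
      then have "(\<lambda>n. lam_of (h (x n)) (x n)) \<longlonglongrightarrow> lam_of (h w) w"
        using x w ab hb by (intro lam_of_tendsto) (auto simp: K_def intro: less_le_trans)
      then show "(T \<circ> x) \<longlonglongrightarrow> T w"
        unfolding T_def o_def using x w by (intro solve_tendsto) (auto simp: K_def)
    qed
  qed blast
  show thesis
  proof
    show "v \<in> solutions"
      using v ab pos[OF v(1)] by (intro solutionsI(1)[where lam = "lam_of (h v) v"]) (auto simp: K_def T_def)
    show "v \<delta> = h v"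
      using left[OF v(1)] v(2) by simp
  qed
qed

text \<open>A separation \<open>A\<close>, \<open>B\<close> of the solutions of height at most \<open>b\<close> would permit a functional \<open>h\<close> that
  assigns to solutions in \<open>A\<close> the height \<open>b\<close>, which does not occur in \<open>A\<close>, and to those in \<open>B\<close> a
  height \<open>a > 0\<close> below all heights in \<open>B\<close>. No solution has the height that this \<open>h\<close> prescribes.\<close>

lemma connected_branch:
  assumes b: "0 < b" "b < R - \<delta>"
  obtains C where "connected C" "C \<subseteq> insert 0 solutions" "0 \<in> C" "\<exists>v\<in>C. v \<delta> = b"
proof -
  let ?S = "insert 0 {v \<in> solutions. v \<delta> \<le> b}"
  define D where "D = {v \<in> ?S. v \<delta> = b}"
  have D: "closed D" "D \<subseteq> ?S"
  proof -
    have "closed {v :: real \<Rightarrow>\<^sub>C real. v \<delta> = b}"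
      by (intro closed_Collect_eq continuous_on_eval_bcontfun continuous_intros)
    moreover have "D = ?S \<inter> {v. apply_bcontfun v \<delta> = b}"
      by (auto simp: D_def)
    ultimately show "closed D"
      by (simp only: closed_Int compact_imp_closed[OF compact_solutions_below[OF b(2)]])
  qed (auto simp: D_def)
  from compact_solutions_below[OF b(2)] D show thesis
  proof (rule connected_subset_joining_or_separation[where x = 0])
    fix A B assume A: "compact A" "0 \<in> A" and B: "compact B" "D \<subseteq> B" and AB: "A \<union> B = ?S" "A \<inter> B = {}"
    have Bpos: "0 < v \<delta>" if "v \<in> B" for v
      using that A(2) AB solutionsD(2) by blast
    obtain a where a: "0 < a" "a < b" "\<And>v. v \<in> B \<Longrightarrow> a < v \<delta>"
    proof (cases "B = {}")
      case False
      then obtain w where w: "w \<in> B" "\<And>v. v \<in> B \<Longrightarrow> w \<delta> \<le> v \<delta>"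
        using continuous_attains_inf[OF B(1) _ continuous_on_eval_bcontfun] by blast
      show thesis
        using that[of "min (b / 2) (w \<delta> / 2)"] b Bpos[OF w(1)] w(2) by fastforce
    qed (use that[of "b / 2"] b in auto)
    have "normal_space (euclidean :: (real \<Rightarrow>\<^sub>C real) topology)"
      by (intro metrizable_imp_normal_space metrizable_space_euclidean)
    moreover have "closedin euclidean B" "closedin euclidean A" "disjnt B A"
      using A B AB by (auto simp: disjnt_def compact_imp_closed)
    ultimately obtain h where h: "continuous_map euclidean (top_of_set {a..b}) h" "h ` B \<subseteq> {a}" "h ` A \<subseteq> {b}"
      using less_imp_le[OF a(2)] by (rule Urysohn_lemma)
    have h': "continuous_on UNIV h" "\<And>v. h v \<in> {a..b}"
      using h(1) by (auto simp: continuous_map_in_subtopology)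
    obtain v where v: "v \<in> solutions" "v \<delta> = h v"
      using prescribed_left_solution[OF a(1) less_imp_le[OF a(2)] b(2) h'] by blast
    then have vS: "v \<in> A \<union> B"
      using AB h'(2)[of v] by auto
    show thesis
    proof (cases "v \<in> B")
      case True
      then have "v \<delta> = a" using h(2) v(2) by auto
      with a(3)[OF True] show ?thesis by simp
    next
      case False
      then have "v \<delta> = b" using vS h(3) v(2) by auto
      then have "v \<in> D" using v by (auto simp: D_def)
      with False B(2) show ?thesis by blast
    qed
  next
    fix C assume "connected C" "C \<subseteq> ?S" "0 \<in> C" "C \<inter> D \<noteq> {}"
    then show thesis
      using that[of C] by (auto simp: D_def)
  qed auto
qed

section \<open>Small solutions and the linearised problem\<close>

lemma f_zero:
  assumes r: "r \<in> {\<delta>..R}"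
  shows "f r 0 = 0"
proof -
  have "continuous_on {0..<\<alpha>} (\<lambda>s. f r s)"
    using r by (intro continuous_on_f_compose continuous_on_id continuous_on_const) auto
  then have "((\<lambda>s. f r s) \<longlongrightarrow> f r 0) (at 0 within {0..<\<alpha>})"
    using \<delta> \<alpha> by (auto simp: continuous_on_def)
  then have "((\<lambda>s. f r s) \<longlongrightarrow> f r 0) (at 0 within {0..R})"
    by (rule tendsto_within_subset) (use \<alpha> in auto)
  then have 1: "((\<lambda>s. f r s) \<longlongrightarrow> f r 0) (at_right 0)"
    using \<delta> at_within_Icc_at_right[of 0 R] by simp
  have "((\<lambda>s. s * (f r s / s)) \<longlongrightarrow> 0 * m r) (at_right 0)"
    by (intro tendsto_mult tendsto_ident_at tendsto_uniform_limitI[OF f_linear r])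
  moreover have "\<forall>\<^sub>F s in at_right 0. s * (f r s / s) = f r s"
    by (auto simp: eventually_at_filter)
  ultimately have 2: "((\<lambda>s. f r s) \<longlongrightarrow> 0) (at_right 0)"
    by (simp add: tendsto_cong)
  show ?thesis
    using tendsto_unique[OF _ 1 2] by simp
qed

text \<open>Linearisation of \<open>f\<close> at \<open>0\<close>, in a form that includes \<open>s = 0\<close>.\<close>

lemma f_asymptotic:
  assumes "0 < \<epsilon>"
  obtains \<sigma> where "0 < \<sigma>" "\<And>r s. r \<in> {\<delta>..R} \<Longrightarrow> 0 \<le> s \<Longrightarrow> s < \<sigma> \<Longrightarrow> \<bar>f r s - m r * s\<bar> \<le> \<epsilon> * s"
proof -
  from uniform_limitD[OF f_linear assms]
  obtain \<sigma> where \<sigma>: "0 < \<sigma>" "\<And>r s. r \<in> {\<delta>..R} \<Longrightarrow> 0 < s \<Longrightarrow> s < \<sigma> \<Longrightarrow> dist (f r s / s) (m r) < \<epsilon>"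
    unfolding eventually_at_right_field by blast
  show thesis
  proof (rule that[OF \<sigma>(1)])
    fix r s :: real assume *: "r \<in> {\<delta>..R}" "0 \<le> s" "s < \<sigma>"
    show "\<bar>f r s - m r * s\<bar> \<le> \<epsilon> * s"
    proof (cases "s = 0")
      case False
      then have "\<bar>f r s / s - m r\<bar> * s \<le> \<epsilon> * s"
        using \<sigma>(2)[of r s] * by (intro mult_right_mono) (auto simp: dist_real_def)
      moreover have "\<bar>f r s / s - m r\<bar> * s = \<bar>f r s - m r * s\<bar>"
        using False * by (simp add: abs_mult_pos left_diff_distrib)
      ultimately show ?thesis by simp
    qed (use f_zero[OF *(1)] in simp)
  qed
qed

lemma m_bounded: obtains M where "0 < M" "\<And>r. r \<in> {\<delta>..R} \<Longrightarrow> m r \<le> M"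
proof -
  obtain M where "\<forall>y\<in>m ` {\<delta>..R}. norm y \<le> M"
    using compact_imp_bounded[OF compact_continuous_image[OF m_cont compact_Icc]]
    unfolding bounded_iff by blast
  then show thesis
    by (intro that[of "max M 1"]) force+
qed

lemma m_pos_point:
  assumes "\<delta> \<le> a" "a < b" "b \<le> R"
  obtains t where "t \<in> {a<..b}" "0 < m t"
proof -
  obtain t where t: "t \<in> {(a + b) / 2..b}" "m t \<noteq> 0"
    using m_nonzero[of "(a + b) / 2" b] assms by auto
  then have "a < t" "t \<le> b"
    using assms(2) by auto
  then show thesis
    using m_nonneg[of t] t(2) assms that[of t] by auto
qed

lemma solution_integral:
  assumes v: "v \<in> solutions" and r: "r \<in> {\<delta>..R}"
  shows "v r = integral {r..R} (slope (param v) v)"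
  using solve_apply[OF solutionsD(1)[OF v], of "param v" r] solutionsD(5)[OF v] proj_id[OF r] by simp

lemma solution_pos:
  assumes v: "v \<in> solutions" and r: "r \<in> {\<delta>..<R}"
  shows "0 < v r"
proof -
  have "integral {r..R} (\<lambda>_. 0) < integral {r..R} (slope (param v) v)"
  proof (rule integral_less_real)
    fix s assume "s \<in> {r<..<R}"
    then have "0 < param v * rhs v s"
      using solutionsD[OF v] r by (intro mult_pos_pos rhs_pos) auto
    then show "0 < slope (param v) v s"
      unfolding slope_def using phi1_inv_strict_mono by fastforce
  qed (use r solutionsD[OF v] in \<open>auto intro!: continuous_intros continuous_on_subset[OF continuous_on_slope]\<close>)
  then show ?thesis
    using solution_integral[OF v, of r] r by simp
qed

text \<open>Let \<open>x\<close> be the value of the solution at the midpoint \<open>c\<close> of the interval. To the left of \<open>c\<close> the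
  solution is at least \<open>x\<close>, and \<open>f(t, s) \<ge> k(t) s\<close> for small \<open>s\<close> with some \<open>k \<ge> 0\<close> that does not vanish
  identically. Hence the slope on \<open>[c, R]\<close> is at least \<open>\<phi>\<^sub>1\<^sup>-\<^sup>1(L x)\<close> with \<open>L = \<lambda> \<kappa>\<close>. Integrating from \<open>c\<close>
  to \<open>R\<close> gives \<open>x \<ge> (R - c) \<phi>\<^sub>1\<^sup>-\<^sup>1(L x)\<close>, which bounds \<open>L\<close> as soon as \<open>x\<close> is at most \<open>(R - c) / 2\<close>.\<close>

lemma param_bounded:
  obtains \<Lambda> \<sigma> where "0 < \<sigma>" "\<And>v. v \<in> solutions \<Longrightarrow> v \<delta> < \<sigma> \<Longrightarrow> param v \<le> \<Lambda>"
proof -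
  define c where "c = (\<delta> + R) / 2"
  have c: "\<delta> < c" "c < R" using \<delta> by (auto simp: c_def)
  obtain t0 where t0: "t0 \<in> {\<delta><..c}" "0 < m t0"
    using m_pos_point[of \<delta> c] c by auto
  define \<epsilon> where "\<epsilon> = m t0 / 2"
  have "0 < \<epsilon>" using t0 by (simp add: \<epsilon>_def)
  then obtain \<sigma> where \<sigma>: "0 < \<sigma>" "\<And>r s. r \<in> {\<delta>..R} \<Longrightarrow> 0 \<le> s \<Longrightarrow> s < \<sigma> \<Longrightarrow> \<bar>f r s - m r * s\<bar> \<le> \<epsilon> * s"
    using f_asymptotic by blast
  define k where "k t = max 0 (m t - \<epsilon>)" for t
  have k: "continuous_on {\<delta>..R} k" "\<And>t. 0 \<le> k t" "0 < k t0"
    using t0 by (auto simp: k_def \<epsilon>_def intro!: continuous_intros m_cont)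
  define \<kappa> where "\<kappa> = integral {\<delta>..c} (\<lambda>t. t ^ (N - 1) * k t) / R ^ (N - 1)"
  have "0 < integral {\<delta>..c} (\<lambda>t. t ^ (N - 1) * k t)"
    using k t0 c by (intro weighted_integral_pos[where ?t0.0 = t0]) auto
  then have \<kappa>: "0 < \<kappa>"
    using \<delta> by (simp add: \<kappa>_def)
  show thesis
  proof (rule that[of "min \<sigma> ((R - c) / 2)" "2 / ((R - c) * \<kappa>)"])
    fix v assume v: "v \<in> solutions" "v \<delta> < min \<sigma> ((R - c) / 2)"
    note vp = solutionsD(1)[OF v(1)]
    define x where "x = v c"
    define L where "L = param v * \<kappa>"
    have x: "0 < x" "x \<le> (R - c) / 2"
      using solution_pos[OF v(1), of c] profile_le_left[OF vp, of c] v(2) c by (auto simp: x_def)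
    have L: "0 < L"
      using solutionsD(4)[OF v(1)] \<kappa> by (simp add: L_def)
    have rhs: "\<kappa> * x \<le> rhs v s" if s: "s \<in> {c..R}" for s
    proof -
      have "integral {\<delta>..c} (\<lambda>t. t ^ (N - 1) * (k t * x)) / R ^ (N - 1) \<le> rhs v s"
        unfolding rhs_def
      proof (rule flux_lower_bound)
        fix t assume t: "t \<in> {\<delta>..c}"
        have "\<bar>f t (v t) - m t * v t\<bar> \<le> \<epsilon> * v t"
          using t c v(2) profile_nonneg[OF vp, of t] profile_le_left[OF vp, of t] by (intro \<sigma>(2)) auto
        then have "(m t - \<epsilon>) * v t \<le> f t (v t)"
          by (simp add: algebra_simps abs_le_iff)
        moreover have "0 \<le> f t (v t)"
          using t c by (intro profile_source_nonneg vp) auto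
        ultimately have "k t * v t \<le> f t (v t)"
          by (auto simp: k_def max_def)
        moreover have "k t * x \<le> k t * v t"
          using profile_antimono[OF vp, of t c] t k(2) by (auto simp: x_def intro!: mult_left_mono)
        ultimately show "k t * x \<le> f t (v t)" by simp
        show "0 \<le> k t * x" using k(2) x by simp
      qed (use c s k x vp in \<open>auto intro!: continuous_intros profile_source_continuous profile_source_nonneg\<close>)
      moreover have "integral {\<delta>..c} (\<lambda>t. t ^ (N - 1) * (k t * x)) / R ^ (N - 1) = \<kappa> * x"
        by (simp add: \<kappa>_def flip: mult.assoc)
      ultimately show ?thesis by simp
    qed
    have "x = integral {c..R} (slope (param v) v)"
      unfolding x_def using c by (intro solution_integral v) auto
    moreover have "integral {c..R} (\<lambda>_. phi1_inv (L * x)) \<le> integral {c..R} (slope (param v) v)"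
      using c vp rhs solutionsD(4)[OF v(1)]
      by (intro integral_le slope_integrable) (auto simp: slope_def L_def mult.assoc intro!: phi1_inv_mono mult_left_mono)
    ultimately have "(R - c) * phi1_inv (L * x) \<le> x"
      using c by simp
    then have "(R - c) * L * x / sqrt (1 + (L * x)\<^sup>2) \<le> 1 * x"
      by (simp add: phi1_inv_def mult.assoc)
    then have "(R - c) * L * x \<le> x * sqrt (1 + (L * x)\<^sup>2)"
      by (subst (asm) pos_divide_le_eq) auto
    then have "(R - c) * L \<le> sqrt (1 + (L * x)\<^sup>2)"
      using x(1) by (simp add: mult.commute[of _ x] mult.left_commute[of _ x])
    then have "((R - c) * L)\<^sup>2 \<le> 1 + (L * x)\<^sup>2"
      using c L by (metis abs_of_nonneg diff_ge_0_iff_ge less_imp_le mult_nonneg_nonneg one_plus_sq_pos power2_abs power_mono real_sqrt_pow2)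
    also have "(L * x)\<^sup>2 \<le> (L * ((R - c) / 2))\<^sup>2"
      using L x by (intro power_mono mult_left_mono) auto
    finally have "((R - c) * L)\<^sup>2 \<le> 1 + ((R - c) * L)\<^sup>2 / 4"
      by (simp add: power_mult_distrib power_divide mult.commute)
    then have "((R - c) * L)\<^sup>2 \<le> 2\<^sup>2"
      by simp
    then have "(R - c) * L \<le> 2"
      by (rule power2_le_imp_le) simp
    then show "param v \<le> 2 / ((R - c) * \<kappa>)"
      using c \<kappa> by (simp add: L_def pos_le_divide_eq mult_ac)
  qed (use \<sigma> c in auto)
qed

text \<open>Integration over \<open>[r, R]\<close> is Lipschitz for the supremum norm.\<close>

lemma integral_uniform_limit:
  fixes g :: "nat \<Rightarrow> real \<Rightarrow> real"
  assumes "\<And>n. continuous_on {\<delta>..R} (g n)" "continuous_on {\<delta>..R} l" "uniform_limit {\<delta>..R} g l sequentially"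
    and r: "r \<in> {\<delta>..R}"
  shows "(\<lambda>n. integral {r..R} (g n)) \<longlonglongrightarrow> integral {r..R} l"
proof (rule tendstoI)
  fix e :: real assume e: "0 < e"
  then have "0 < e / (2 * (R - \<delta>))" using \<delta> by simp
  from uniform_limitD[OF assms(3) this]
  show "\<forall>\<^sub>F n in sequentially. dist (integral {r..R} (g n)) (integral {r..R} l) < e"
  proof eventually_elim
    case (elim n)
    have "\<bar>integral {r..R} (\<lambda>s. g n s - l s)\<bar> \<le> e / (2 * (R - \<delta>)) * (R - r)"
      using elim r by (intro abs_integral_le continuous_intros assms) (auto simp: dist_real_def less_imp_le)
    also have "\<dots> \<le> e / (2 * (R - \<delta>)) * (R - \<delta>)"
      using e \<delta> r by (intro mult_left_mono) auto
    also have "\<dots> < e"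
      using e \<delta> by (simp add: field_simps)
    finally show ?case
      using assms(1)[of n] assms(2) r
      by (subst (asm) Henstock_Kurzweil_Integration.integral_diff)
        (auto simp: dist_real_def intro!: integrable_continuous_real elim: continuous_on_subset)
  qed
qed

text \<open>The eigenvalue problem in integrated form, for eigenfunctions normalised to height 1.\<close>

definition linear_solution :: "real \<Rightarrow> (real \<Rightarrow> real) \<Rightarrow> bool" where
  "linear_solution lam w \<longleftrightarrow> continuous_on {\<delta>..R} w \<and> w \<delta> = 1 \<and> 0 \<le> lam \<and> (\<forall>r\<in>{\<delta>..R}. 0 \<le> w r \<and>
     w r = integral {r..R} (\<lambda>s. lam * flux N \<delta> (\<lambda>t. m t * w t) s))"

text \<open>Divide the solutions by their heights \<open>d n\<close>. Since \<open>f(t, s) / s\<close> is bounded near \<open>s = 0\<close>, the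
  quotients are uniformly Lipschitz, so a subsequence converges uniformly; \<open>f(t, s) / s \<rightarrow> m(t)\<close> and
  \<open>\<phi>\<^sub>1\<^sup>-\<^sup>1(y) / y \<rightarrow> 1\<close> turn the integrated equation into the linear one.\<close>

lemma normalized_limit:
  assumes v: "\<And>n. v n \<in> solutions" "(\<lambda>n. v n \<delta>) \<longlonglongrightarrow> 0" "\<And>n. param (v n) \<le> \<Lambda>"
  obtains k lam w where "strict_mono (k :: nat \<Rightarrow> nat)" "(\<lambda>n. param (v (k n))) \<longlonglongrightarrow> lam" "linear_solution lam w"
proof -
  obtain M where M: "0 < M" "\<And>r. r \<in> {\<delta>..R} \<Longrightarrow> m r \<le> M"
    using m_bounded by blast
  obtain \<sigma> where \<sigma>: "0 < \<sigma>" "\<And>r s. r \<in> {\<delta>..R} \<Longrightarrow> 0 \<le> s \<Longrightarrow> s < \<sigma> \<Longrightarrow> \<bar>f r s - m r * s\<bar> \<le> 1 * s"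
    using f_asymptotic[of 1] by auto
  obtain K where K: "\<And>n. K \<le> n \<Longrightarrow> v n \<delta> < \<sigma>"
    using order_tendstoD(2)[OF v(2) \<sigma>(1)] unfolding eventually_sequentially by blast
  \<comment> \<open>The tail of the sequence on which \<open>f(t, s) \<le> (m(t) + 1) s\<close> is available.\<close>
  define u where "u n = v (n + K)" for n
  define d where "d n = u n \<delta>" for n
  have u: "u n \<in> solutions" "u n \<in> profiles" "0 < d n" "d n < \<sigma>" "param (u n) \<in> {0..\<Lambda>}" for n
    using v solutionsD(1-3) less_imp_le[OF solutionsD(4)] K[of "n + K"] by (auto simp: u_def d_def)
  have d0: "d \<longlonglongrightarrow> 0"
    unfolding d_def u_def using v(2) by (rule LIMSEQ_ignore_initial_segment)
  have ud: "0 \<le> u n t" "u n t \<le> d n" for n t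
    using u(2) profile_nonneg profile_le_left by (auto simp: d_def)
  define h where "h n t = f t (u n t) / d n" for n t
  have h_cont: "continuous_on {\<delta>..R} (h n)" for n
    unfolding h_def using u(3)[of n] by (intro continuous_intros profile_source_continuous u) auto
  have h_bound: "\<bar>h n t\<bar> \<le> M + 1" if t: "t \<in> {\<delta>..R}" for n t
  proof -
    have "\<bar>f t (u n t) - m t * u n t\<bar> \<le> 1 * u n t"
      using ud(1) order.strict_trans1[OF ud(2) u(4)] t by (intro \<sigma>(2)) auto
    then have "f t (u n t) \<le> (m t + 1) * u n t"
      by (simp add: algebra_simps abs_le_iff)
    also have "\<dots> \<le> (M + 1) * d n"
      using ud M(1) M(2)[OF t] m_nonneg[OF t] by (intro mult_mono) auto
    finally show ?thesis
      using u(3)[of n] profile_source_nonneg[OF u(2) t, of n] by (simp add: h_def pos_divide_le_eq)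
  qed
  have rhs_u: "rhs (u n) s = d n * flux N \<delta> (h n) s" for n s
  proof -
    have "rhs (u n) s = flux N \<delta> (\<lambda>t. d n * h n t) s"
      using u(3)[of n] by (simp add: rhs_def h_def)
    then show ?thesis by (simp add: flux_scale)
  qed
  define p where "p n s = param (u n) * flux N \<delta> (h n) s" for n s
  define B where "B = \<Lambda> * ((M + 1) * (R - \<delta>))"
  have "0 \<le> \<Lambda>" using u(5)[of 0] by auto
  have p_bound: "\<bar>p n s\<bar> \<le> B" if s: "s \<in> {\<delta>..R}" for n s
  proof -
    have "\<bar>flux N \<delta> (h n) s\<bar> \<le> (M + 1) * (s - \<delta>)"
      using h_bound s by (intro flux_bound h_cont) auto
    also have "\<dots> \<le> (M + 1) * (R - \<delta>)"
      using s M(1) by (intro mult_left_mono) auto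
    finally show ?thesis
      unfolding p_def B_def abs_mult using u(5)[of n] by (intro mult_mono) auto
  qed
  have slope_u: "slope (param (u n)) (u n) s = phi1_inv (d n * p n s)" for n s
    by (simp add: slope_def rhs_u p_def mult_ac)
  define w where "w n t = u n t / d n" for n t
  have w_int: "w n r = integral {r..R} (\<lambda>s. phi1_inv (d n * p n s) / d n)" if "r \<in> {\<delta>..R}" for n r
    using solution_integral[OF u(1) that, of n] by (simp add: w_def flip: slope_u)
  have g_bound: "\<bar>phi1_inv (d n * p n s) / d n\<bar> \<le> B" if s: "s \<in> {\<delta>..R}" for n s
  proof -
    have "\<bar>phi1_inv (d n * p n s)\<bar> \<le> \<bar>d n * p n s\<bar>"
      using phi1_inv_Lipschitz[of _ 0] by simp
    also have "\<dots> \<le> d n * B"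
      using p_bound[OF s, of n] u(3)[of n] by (simp add: abs_mult)
    finally show ?thesis
      using u(3)[of n] by (simp add: abs_divide pos_divide_le_eq mult.commute)
  qed
  have p_cont: "continuous_on {\<delta>..R} (p n)" for n
    unfolding p_def by (intro continuous_intros continuous_on_flux h_cont)
  have g_cont: "continuous_on {\<delta>..R} (\<lambda>s. phi1_inv (d n * p n s) / d n)" for n
    using u(3)[of n] by (intro continuous_intros p_cont) auto
  have w_Lip: "\<bar>w n x - w n y\<bar> \<le> B * (y - x)" if "\<delta> \<le> x" "x \<le> y" "y \<le> R" for n x y
  proof -
    have "w n x - w n y = integral {x..y} (\<lambda>s. phi1_inv (d n * p n s) / d n)"
      using w_int[of x n] w_int[of y n] that
        Henstock_Kurzweil_Integration.integral_combine[of x y R "\<lambda>s. phi1_inv (d n * p n s) / d n"]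
        integrable_continuous_real[OF continuous_on_subset[OF g_cont, of "{x..R}" n]] by auto
    then show ?thesis
      using abs_integral_le[OF g_cont g_bound, of x y n] that by simp
  qed
  have "0 \<le> B"
    using p_bound[of \<delta> 0] \<delta> by force
  obtain w0 k1 where k1: "strict_mono (k1 :: nat \<Rightarrow> nat)" and w0_cont: "continuous_on {\<delta>..R} w0"
    and w0: "\<And>e. 0 < e \<Longrightarrow> \<exists>N. \<forall>n x. n \<ge> N \<and> x \<in> {\<delta>..R} \<longrightarrow> norm (w (k1 n) x - w0 x) < e"
  proof (rule Arzela_Ascoli[of "{\<delta>..R}" w 1])
    show "norm (w n x) \<le> 1" for n x
      using ud[of n x] u(3)[of n] by (simp add: w_def)
    show "\<exists>d>0. \<forall>n y. y \<in> {\<delta>..R} \<and> norm (x - y) < d \<longrightarrow> norm (w n x - w n y) < e"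
      if x: "x \<in> {\<delta>..R}" and e: "0 < e" for x e
    proof (intro exI[of _ "e / (B + 1)"] conjI allI impI)
      show "0 < e / (B + 1)" using e \<open>0 \<le> B\<close> by simp
      fix n y assume y: "y \<in> {\<delta>..R} \<and> norm (x - y) < e / (B + 1)"
      have "\<bar>w n x - w n y\<bar> \<le> B * \<bar>x - y\<bar>"
        using w_Lip[of x y n] w_Lip[of y x n] x y by (cases "x \<le> y") (auto simp: abs_minus_commute)
      also have "\<dots> \<le> (B + 1) * \<bar>x - y\<bar>"
        by (intro mult_right_mono) auto
      also have "\<dots> < e"
        using y \<open>0 \<le> B\<close> by (simp add: pos_less_divide_eq mult.commute)
      finally show "norm (w n x - w n y) < e" by simp
    qed
  qed auto
  obtain lam k2 where k2: "strict_mono (k2 :: nat \<Rightarrow> nat)" and lam: "lam \<in> {0..\<Lambda>}"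
    and lam_lim: "((\<lambda>n. param (u (k1 n))) \<circ> k2) \<longlonglongrightarrow> lam"
    using compact_Icc[of 0 \<Lambda>] u(5) unfolding compact_eq_seq_compact_metric seq_compact_def by metis
  define k where "k n = k1 (k2 n)" for n
  have k: "strict_mono k"
    using strict_mono_o[OF k1 k2] by (simp add: k_def [abs_def] o_def)
  have dk: "(\<lambda>n. d (k n)) \<longlonglongrightarrow> 0"
    using LIMSEQ_subseq_LIMSEQ[OF d0 k] by (simp add: o_def)
  have lamk: "(\<lambda>n. param (u (k n))) \<longlonglongrightarrow> lam"
    using lam_lim by (simp add: k_def o_def)
  have wk1: "uniform_limit {\<delta>..R} (\<lambda>n. w (k1 n)) w0 sequentially"
  proof (rule uniform_limitI)
    fix e :: real assume "0 < e"
    from w0[OF this] show "\<forall>\<^sub>F n in sequentially. \<forall>x\<in>{\<delta>..R}. dist (w (k1 n) x) (w0 x) < e"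
      unfolding eventually_sequentially dist_norm by blast
  qed
  have wk: "uniform_limit {\<delta>..R} (\<lambda>n. w (k n)) w0 sequentially"
  proof (rule uniform_limitI)
    fix e :: real assume "0 < e"
    from eventually_subseq[OF k2 uniform_limitD[OF wk1 this]]
    show "\<forall>\<^sub>F n in sequentially. \<forall>x\<in>{\<delta>..R}. dist (w (k n) x) (w0 x) < e"
      by (simp add: k_def)
  qed
  have hk: "uniform_limit {\<delta>..R} (\<lambda>n. h (k n)) (\<lambda>t. m t * w0 t) sequentially"
  proof (rule uniform_limitI)
    fix e :: real assume e: "0 < e"
    then obtain \<tau> where \<tau>: "0 < \<tau>" "\<And>r s. r \<in> {\<delta>..R} \<Longrightarrow> 0 \<le> s \<Longrightarrow> s < \<tau> \<Longrightarrow> \<bar>f r s - m r * s\<bar> \<le> (e / 2) * s"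
      using f_asymptotic[of "e / 2"] by auto
    have "0 < e / (2 * M)" using e M by simp
    from uniform_limitD[OF wk this] order_tendstoD(2)[OF dk \<tau>(1)]
    show "\<forall>\<^sub>F n in sequentially. \<forall>t\<in>{\<delta>..R}. dist (h (k n) t) (m t * w0 t) < e"
    proof eventually_elim
      case (elim n)
      show ?case
      proof
        fix t assume t: "t \<in> {\<delta>..R}"
        have "\<bar>f t (u (k n) t) - m t * u (k n) t\<bar> \<le> (e / 2) * u (k n) t"
          using ud(1) order.strict_trans1[OF ud(2) elim(2)] t by (intro \<tau>(2)) auto
        also have "\<dots> \<le> (e / 2) * d (k n)"
          using e ud by (intro mult_left_mono) auto
        finally have "\<bar>f t (u (k n) t) - m t * u (k n) t\<bar> / d (k n) \<le> e / 2"
          using u(3)[of "k n"] by (simp add: pos_divide_le_eq)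
        moreover have "\<bar>f t (u (k n) t) - m t * u (k n) t\<bar> / d (k n) = \<bar>h (k n) t - m t * w (k n) t\<bar>"
          by (simp only: abs_divide_pos[OF u(3)] h_def w_def diff_divide_distrib times_divide_eq_right)
        moreover have "\<bar>m t * w (k n) t - m t * w0 t\<bar> < e / 2"
        proof -
          have "\<bar>m t * w (k n) t - m t * w0 t\<bar> = m t * \<bar>w (k n) t - w0 t\<bar>"
            using m_nonneg[OF t] by (simp add: abs_mult flip: right_diff_distrib)
          also have "\<dots> \<le> M * \<bar>w (k n) t - w0 t\<bar>"
            using M(2)[OF t] by (intro mult_right_mono) auto
          also have "\<dots> < M * (e / (2 * M))"
            using elim(1) t M(1) by (intro mult_strict_left_mono) (auto simp: dist_real_def)
          finally show ?thesis using M(1) by simp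
        qed
        ultimately show "dist (h (k n) t) (m t * w0 t) < e"
          unfolding dist_real_def by linarith
      qed
    qed
  qed
  define p0 where "p0 s = lam * flux N \<delta> (\<lambda>t. m t * w0 t) s" for s
  have mw: "continuous_on {\<delta>..R} (\<lambda>t. m t * w0 t)"
    by (intro continuous_intros m_cont w0_cont)
  have p0_cont: "continuous_on {\<delta>..R} p0"
    unfolding p0_def by (intro continuous_intros continuous_on_flux mw)
  have pk: "uniform_limit {\<delta>..R} (\<lambda>n. p (k n)) p0 sequentially"
    unfolding p_def p0_def
    by (intro uniform_limit_scale flux_uniform_limit h_cont mw hk lamk
        compact_imp_bounded compact_continuous_image continuous_on_flux) auto
  have gk: "uniform_limit {\<delta>..R} (\<lambda>n s. phi1_inv (d (k n) * p (k n) s) / d (k n)) p0 sequentially"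
  proof (rule uniform_limitI)
    fix e :: real assume e: "0 < e"
    have e2: "0 < e / 2" "0 < e / (2 * (B\<^sup>2 + 1))" using e by (auto simp: add_nonneg_pos)
    from uniform_limitD[OF pk e2(1)] order_tendstoD(2)[OF dk e2(2)]
    show "\<forall>\<^sub>F n in sequentially. \<forall>s\<in>{\<delta>..R}. dist (phi1_inv (d (k n) * p (k n) s) / d (k n)) (p0 s) < e"
    proof eventually_elim
      case (elim n)
      show ?case
      proof
        fix s assume s: "s \<in> {\<delta>..R}"
        have D: "0 < d (k n)" by (rule u)
        have "\<bar>phi1_inv (d (k n) * p (k n) s) / d (k n) - p (k n) s\<bar>
            = \<bar>phi1_inv (d (k n) * p (k n) s) - d (k n) * p (k n) s\<bar> / d (k n)"
          by (simp only: abs_divide_pos[OF D] diff_divide_distrib nonzero_mult_div_cancel_left[OF less_imp_neq[OF D, symmetric]])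
        also have "\<dots> \<le> (d (k n) * p (k n) s)\<^sup>2 / d (k n)"
          using D by (intro divide_right_mono phi1_inv_quadratic) auto
        also have "\<dots> = d (k n) * (p (k n) s)\<^sup>2"
          using D by (simp add: power2_eq_square)
        also have "\<dots> \<le> d (k n) * B\<^sup>2"
          using D p_bound[OF s, of "k n"] \<open>0 \<le> B\<close> by (intro mult_left_mono) (auto simp: abs_le_square_iff[symmetric])
        also have "\<dots> \<le> d (k n) * (B\<^sup>2 + 1)"
          using D by (intro mult_left_mono) auto
        also have "\<dots> < e / 2"
        proof -
          have "0 < 2 * (B\<^sup>2 + 1)" by (simp add: add_nonneg_pos)
          with elim(2) have "d (k n) * (2 * (B\<^sup>2 + 1)) < e"
            by (simp only: pos_less_divide_eq)
          then show ?thesis by (simp add: algebra_simps)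
        qed
        finally show "dist (phi1_inv (d (k n) * p (k n) s) / d (k n)) (p0 s) < e"
          using bspec[OF elim(1) s] unfolding dist_real_def by linarith
      qed
    qed
  qed
  have lim: "(\<lambda>n. w (k n) r) \<longlonglongrightarrow> w0 r" if "r \<in> {\<delta>..R}" for r
    using wk that by (rule tendsto_uniform_limitI)
  have "linear_solution lam w0"
    unfolding linear_solution_def
  proof (intro conjI ballI w0_cont)
    have "w (k n) \<delta> = 1" for n
      using u(3)[of "k n"] by (simp add: w_def d_def)
    then have "(\<lambda>_. 1) \<longlonglongrightarrow> w0 \<delta>"
      using lim[of \<delta>] \<delta> by simp
    from LIMSEQ_unique[OF this tendsto_const] show "w0 \<delta> = 1" .
    show "0 \<le> lam" using lam by simp
    fix r assume r: "r \<in> {\<delta>..R}"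
    show "0 \<le> w0 r"
      by (rule LIMSEQ_le_const[OF lim[OF r]]) (use ud u(3) in \<open>auto simp: w_def less_imp_le\<close>)
    have "(\<lambda>n. w (k n) r) \<longlonglongrightarrow> integral {r..R} p0"
      using integral_uniform_limit[OF g_cont p0_cont gk r] by (simp add: w_int[OF r])
    then show "w0 r = integral {r..R} (\<lambda>s. lam * flux N \<delta> (\<lambda>t. m t * w0 t) s)"
      using LIMSEQ_unique[OF lim[OF r]] by (simp add: p0_def [abs_def])
  qed
  moreover have "strict_mono (\<lambda>n. k n + K)"
    using k by (simp add: strict_mono_def)
  ultimately show thesis
    using lamk by (intro that[of "\<lambda>n. k n + K" lam w0]) (auto simp: u_def)
qed

section \<open>The principal eigenvalue\<close>

abbreviation lam1 :: real where
  "lam1 \<equiv> principal_eigenvalue N R m \<delta>"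

text \<open>Positivity holds because \<open>w\<close> is positive near \<open>\<delta>\<close>, where \<open>m\<close> is not identically zero: the flux of
  \<open>m w\<close>, and with it \<open>- w'\<close>, is positive from some point on up to \<open>R\<close>.\<close>

lemma linear_solution_eigenfunction:
  assumes "linear_solution lam w"
  shows "0 < lam" "is_eigenfunction N \<delta> R m lam w" "\<And>r. r \<in> {\<delta>..<R} \<Longrightarrow> 0 < w r"
proof -
  define F where "F = flux N \<delta> (\<lambda>t. m t * w t)"
  have w: "continuous_on {\<delta>..R} w" "w \<delta> = 1" "\<And>r. r \<in> {\<delta>..R} \<Longrightarrow> 0 \<le> w r"
      "\<And>r. r \<in> {\<delta>..R} \<Longrightarrow> w r = integral {r..R} (\<lambda>s. lam * F s)" and lam0: "0 \<le> lam"
    using assms unfolding linear_solution_def F_def by blast+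
  have "lam \<noteq> 0"
    using w(2) w(4)[of \<delta>] \<delta> by auto
  with lam0 show lam: "0 < lam" by simp
  have mw: "continuous_on {\<delta>..R} (\<lambda>t. m t * w t)"
    by (intro continuous_intros m_cont w)
  have F: "continuous_on {\<delta>..R} F"
    unfolding F_def by (rule continuous_on_flux[OF mw])
  have Fnonneg: "0 \<le> F s" if "s \<in> {\<delta>..R}" for s
    unfolding F_def using that w(3) m_nonneg by (intro flux_nonneg mw) auto
  have wderiv: "(w has_real_derivative - (lam * F r)) (at r within {\<delta>..R})" if r: "r \<in> {\<delta>..R}" for r
  proof (rule has_field_derivative_transform_within[OF _ zero_less_one r])
    show "((\<lambda>r. integral {r..R} (\<lambda>s. lam * F s)) has_real_derivative - (lam * F r)) (at r within {\<delta>..R})"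
      by (intro integral_has_real_derivative' continuous_intros F r)
  qed (use w(4) in auto)
  have C1: "C1_on \<delta> R w" and w': "\<And>r. r \<in> {\<delta>..R} \<Longrightarrow> iderivative \<delta> R w r = - (lam * F r)"
    using C1_on_realI[OF \<delta>(2) wderiv continuous_on_minus[OF continuous_on_mult_left[OF F]]] by blast+
  have flux_deriv: "((\<lambda>r. r ^ (N - 1) * iderivative \<delta> R w r) has_real_derivative - (lam * (r ^ (N - 1) * (m r * w r))))
      (at r within {\<delta>..R})" if r: "r \<in> {\<delta>..R}" for r
  proof (rule has_field_derivative_transform_within[OF _ zero_less_one r])
    show "((\<lambda>r. - (lam * (r ^ (N - 1) * F r))) has_real_derivative - (lam * (r ^ (N - 1) * (m r * w r))))
        (at r within {\<delta>..R})"
      unfolding F_def by (intro DERIV_minus DERIV_cmult flux_has_derivative mw r)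
  qed (simp add: w')
  have C1': "C1_on \<delta> R (\<lambda>r. r ^ (N - 1) * iderivative \<delta> R w r)"
    and flux': "\<And>r. r \<in> {\<delta>..R} \<Longrightarrow>
      iderivative \<delta> R (\<lambda>r. r ^ (N - 1) * iderivative \<delta> R w r) r = - (lam * (r ^ (N - 1) * (m r * w r)))"
  proof -
    have "continuous_on {\<delta>..R} (\<lambda>r. - (lam * (r ^ (N - 1) * (m r * w r))))"
      by (intro continuous_intros mw)
    from C1_on_realI[OF \<delta>(2) flux_deriv this]
    show "C1_on \<delta> R (\<lambda>r. r ^ (N - 1) * iderivative \<delta> R w r)"
      "\<And>r. r \<in> {\<delta>..R} \<Longrightarrow>
      iderivative \<delta> R (\<lambda>r. r ^ (N - 1) * iderivative \<delta> R w r) r = - (lam * (r ^ (N - 1) * (m r * w r)))"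
      by blast+
  qed
  show "is_eigenfunction N \<delta> R m lam w"
    unfolding is_eigenfunction_def
  proof (intro conjI C1 C1' ballI)
    fix r assume "r \<in> {\<delta><..<R}"
    then show "- iderivative \<delta> R (\<lambda>t. t ^ (N - 1) * iderivative \<delta> R w t) r = lam * r ^ (N - 1) * m r * w r"
      using flux'[of r] by simp
  next
    show "iderivative \<delta> R w \<delta> = 0"
      using w'[of \<delta>] \<delta> by (simp add: F_def)
    show "w R = 0"
      using w(4)[of R] \<delta> by simp
    show "\<exists>r\<in>{\<delta>..R}. w r \<noteq> 0"
      using w(2) \<delta> by (intro bexI[of _ \<delta>]) auto
  qed
  have "\<forall>\<^sub>F r in at \<delta> within {\<delta>..R}. 0 < w r"
  proof (rule order_tendstoD(1))
    show "(w \<longlongrightarrow> w \<delta>) (at \<delta> within {\<delta>..R})"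
      using w(1) \<delta> by (auto simp: continuous_on_def)
  qed (use w(2) in simp)
  then obtain \<eta> where \<eta>: "0 < \<eta>" "\<And>r. r \<in> {\<delta>..R} \<Longrightarrow> r \<noteq> \<delta> \<Longrightarrow> dist r \<delta> < \<eta> \<Longrightarrow> 0 < w r"
    unfolding eventually_at by blast
  define b where "b = min (\<delta> + \<eta> / 2) ((\<delta> + R) / 2)"
  have b: "\<delta> < b" "b < R" "b < \<delta> + \<eta>"
    using \<eta>(1) \<delta> by (auto simp: b_def min_def field_simps)
  obtain t0 where t0: "t0 \<in> {\<delta><..b}" "0 < m t0"
    using m_pos_point[of \<delta> b] b by auto
  then have "0 < w t0"
    using b by (intro \<eta>(2)) (auto simp: dist_real_def)
  then have Fpos: "0 < F s" if "s \<in> {t0..R}" for s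
    unfolding F_def using that t0 w(3) m_nonneg by (intro flux_pos[OF mw, where ?t0.0 = t0]) auto
  fix r assume r: "r \<in> {\<delta>..<R}"
  define c where "c = max r t0"
  have c: "r \<le> c" "t0 \<le> c" "c < R" "\<delta> \<le> c"
    using r t0 b by (auto simp: c_def)
  have int: "(\<lambda>s. lam * F s) integrable_on {a..R}" if "\<delta> \<le> a" for a
    using that by (intro integrable_continuous_real continuous_intros continuous_on_subset[OF F]) auto
  have "0 = integral {c..R} (\<lambda>_. 0::real)" by simp
  also have "\<dots> < integral {c..R} (\<lambda>s. lam * F s)"
    using c lam Fpos by (intro integral_less_real continuous_intros continuous_on_subset[OF F]) auto
  also have "\<dots> \<le> integral {r..R} (\<lambda>s. lam * F s)"
    using c r lam Fnonneg by (intro integral_subset_le int) auto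
  also have "\<dots> = w r"
    using w(4)[of r] r by simp
  finally show "0 < w r" .
qed

text \<open>Green's identity: the derivative of \<open>r\<^sup>N\<^sup>-\<^sup>1 (v u' - u v')\<close> is \<open>(\<mu> - \<lambda>) r\<^sup>N\<^sup>-\<^sup>1 m u v\<close>, and the boundary
  terms vanish.\<close>

lemma positive_eigenvalue_unique:
  assumes u: "is_eigenfunction N \<delta> R m lam u" "\<And>r. r \<in> {\<delta>..<R} \<Longrightarrow> 0 < u r"
    and v: "is_eigenfunction N \<delta> R m \<mu> v" "\<And>r. r \<in> {\<delta>..<R} \<Longrightarrow> 0 < v r"
  shows "lam = \<mu>"
proof -
  define U where "U r = r ^ (N - 1) * iderivative \<delta> R u r" for r
  define V where "V r = r ^ (N - 1) * iderivative \<delta> R v r" for r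
  define k where "k r = m r * (u r * v r)" for r
  have uC: "C1_on \<delta> R u" "C1_on \<delta> R U" and vC: "C1_on \<delta> R v" "C1_on \<delta> R V"
    using u v by (auto simp: is_eigenfunction_def U_def [abs_def] V_def [abs_def])
  have eqU: "iderivative \<delta> R U r = - (lam * r ^ (N - 1) * m r * u r)"
    and eqV: "iderivative \<delta> R V r = - (\<mu> * r ^ (N - 1) * m r * v r)" if "r \<in> {\<delta><..<R}" for r
    using u(1) v(1) that unfolding is_eigenfunction_def U_def [abs_def] V_def [abs_def] by fastforce+
  have bc: "u R = 0" "v R = 0" "U \<delta> = 0" "V \<delta> = 0"
    using u(1) v(1) by (auto simp: is_eigenfunction_def U_def V_def)
  have at: "(g has_real_derivative iderivative \<delta> R g r) (at r)" if "C1_on \<delta> R g" "r \<in> {\<delta><..<R}" for g r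
    using C1_on_has_real_derivative[OF that(1), of r] that(2) by (simp add: at_within_Icc_at)
  define G where "G r = v r * U r - u r * V r" for r
  have "((\<lambda>r. (\<mu> - lam) * (r ^ (N - 1) * k r)) has_integral (G R - G \<delta>)) {\<delta>..R}"
  proof (rule fundamental_theorem_of_calculus_interior)
    show "continuous_on {\<delta>..R} G"
      unfolding G_def by (intro continuous_intros C1_on_continuous uC vC)
    fix r assume r: "r \<in> {\<delta><..<R}"
    have "(G has_real_derivative (\<mu> - lam) * (r ^ (N - 1) * k r)) (at r)"
      unfolding G_def
      by (rule derivative_eq_intros at[OF uC(1) r] at[OF uC(2) r] at[OF vC(1) r] at[OF vC(2) r] refl)+
        (simp add: eqU[OF r] eqV[OF r] U_def V_def k_def algebra_simps)
    then show "(G has_vector_derivative (\<mu> - lam) * (r ^ (N - 1) * k r)) (at r)"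
      by (simp add: has_real_derivative_iff_has_vector_derivative)
  qed (use \<delta> in simp)
  then have "(\<mu> - lam) * integral {\<delta>..R} (\<lambda>r. r ^ (N - 1) * k r) = 0"
    using bc by (simp add: G_def has_integral_iff)
  moreover have "0 < integral {\<delta>..R} (\<lambda>r. r ^ (N - 1) * k r)"
  proof -
    obtain t0 where t0: "t0 \<in> {\<delta><..(\<delta> + R) / 2}" "0 < m t0"
      using m_pos_point[of \<delta> "(\<delta> + R) / 2"] \<delta> by auto
    then have "t0 < R" using \<delta> by auto
    show ?thesis
    proof (rule weighted_integral_pos)
      show "continuous_on {\<delta>..R} k"
        unfolding k_def by (intro continuous_intros m_cont C1_on_continuous uC vC)
      show "0 \<le> k t" if "t \<in> {\<delta>..R}" for t
        using that m_nonneg u(2)[of t] v(2)[of t] bc by (cases "t = R") (auto simp: k_def less_imp_le)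
      show "t0 \<in> {\<delta><..R}" "0 < k t0"
        using t0 \<open>t0 < R\<close> u(2)[of t0] v(2)[of t0] by (auto simp: k_def)
    qed (use \<delta> in auto)
  qed
  ultimately show ?thesis by simp
qed

lemma linear_solution_principal:
  assumes "linear_solution lam w"
  shows "lam1 = lam"
  unfolding principal_eigenvalue_def
proof (rule the_equality)
  show "\<exists>u. is_eigenfunction N \<delta> R m lam u \<and> (\<forall>r\<in>{\<delta>..<R}. 0 < u r)"
    using linear_solution_eigenfunction[OF assms] by blast
  show "\<mu> = lam" if "\<exists>u. is_eigenfunction N \<delta> R m \<mu> u \<and> (\<forall>r\<in>{\<delta>..<R}. 0 < u r)" for \<mu>
    using that positive_eigenvalue_unique linear_solution_eigenfunction[OF assms] by blast
qed

text \<open>Otherwise there are solutions with heights tending to \<open>0\<close> and parameters away from \<open>lam1\<close>, but along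
  a subsequence their parameters converge to an eigenvalue with a positive eigenfunction.\<close>

lemma param_near_lam1:
  assumes "0 < \<epsilon>"
  obtains \<sigma> where "0 < \<sigma>" "\<And>v. v \<in> solutions \<Longrightarrow> v \<delta> < \<sigma> \<Longrightarrow> \<bar>param v - lam1\<bar> < \<epsilon>"
proof (rule ccontr)
  assume contra: "\<not> thesis"
  obtain \<Lambda> \<sigma> where \<sigma>: "0 < \<sigma>" "\<And>v. v \<in> solutions \<Longrightarrow> v \<delta> < \<sigma> \<Longrightarrow> param v \<le> \<Lambda>"
    using param_bounded by blast
  have "\<exists>v. v \<in> solutions \<and> v \<delta> < min \<sigma> (1 / real (Suc n)) \<and> \<epsilon> \<le> \<bar>param v - lam1\<bar>" for n
  proof (rule ccontr)
    assume no: "\<nexists>v. v \<in> solutions \<and> v \<delta> < min \<sigma> (1 / real (Suc n)) \<and> \<epsilon> \<le> \<bar>param v - lam1\<bar>"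
    have thesis
    proof (rule that[of "min \<sigma> (1 / real (Suc n))"])
      show "0 < min \<sigma> (1 / real (Suc n))"
        using \<sigma>(1) by simp
      show "\<bar>param v - lam1\<bar> < \<epsilon>" if "v \<in> solutions" "v \<delta> < min \<sigma> (1 / real (Suc n))" for v
        using no that linorder_not_le by blast
    qed
    with contra show False ..
  qed
  then obtain v where v: "\<And>n. v n \<in> solutions" "\<And>n. v n \<delta> < min \<sigma> (1 / real (Suc n))"
    "\<And>n. \<epsilon> \<le> \<bar>param (v n) - lam1\<bar>"
    by metis
  have "(\<lambda>n. v n \<delta>) \<longlonglongrightarrow> 0"
  proof (rule tendsto_sandwich[OF always_eventually always_eventually tendsto_const])
    show "(\<lambda>n. 1 / real (Suc n)) \<longlonglongrightarrow> 0"
      using LIMSEQ_inverse_real_of_nat by (simp add: inverse_eq_divide)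
  qed (use v(2) solutionsD(2)[OF v(1)] in \<open>auto simp: less_imp_le\<close>)
  moreover have "param (v n) \<le> \<Lambda>" for n
    using \<sigma>(2)[OF v(1)] v(2)[of n] by simp
  ultimately obtain k lam w where "strict_mono (k :: nat \<Rightarrow> nat)"
    and k: "(\<lambda>n. param (v (k n))) \<longlonglongrightarrow> lam" "linear_solution lam w"
    by (rule normalized_limit[OF v(1)])
  have "(\<lambda>n. \<bar>param (v (k n)) - lam1\<bar>) \<longlonglongrightarrow> \<bar>lam - lam1\<bar>"
    by (intro tendsto_intros k)
  then have "\<epsilon> \<le> \<bar>lam - lam1\<bar>"
    by (rule LIMSEQ_le_const) (use v(3) in auto)
  then show False
    using assms linear_solution_principal[OF k(2)] by simp
qed

lemma lam1_pos: "0 < lam1"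
proof -
  obtain \<Lambda> \<sigma> where \<sigma>: "0 < \<sigma>" "\<And>v. v \<in> solutions \<Longrightarrow> v \<delta> < \<sigma> \<Longrightarrow> param v \<le> \<Lambda>"
    using param_bounded by blast
  define c where "c n = min (\<sigma> / 2) ((R - \<delta>) / 2) / real (Suc n)" for n
  have c0: "0 < min (\<sigma> / 2) ((R - \<delta>) / 2)" using \<sigma> \<delta> by simp
  have c: "0 < c n" "c n < \<sigma>" "c n < R - \<delta>" for n
  proof -
    have "c n \<le> min (\<sigma> / 2) ((R - \<delta>) / 2) / 1"
      unfolding c_def using c0 by (intro divide_left_mono) auto
    then show "c n < \<sigma>" "c n < R - \<delta>" using \<sigma> \<delta> by auto
    show "0 < c n" unfolding c_def using c0 by (intro divide_pos_pos) auto
  qed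
  have "\<exists>v\<in>solutions. v \<delta> = c n" for n
    using prescribed_left_solution[of "c n" "c n" "\<lambda>_. c n"] c[of n] by auto
  then obtain v where v: "\<And>n. v n \<in> solutions" "\<And>n. v n \<delta> = c n"
    by metis
  have "c \<longlonglongrightarrow> 0"
    unfolding c_def by (intro real_tendsto_divide_at_top[OF tendsto_const] filterlim_compose[OF filterlim_real_sequentially filterlim_Suc])
  then have "(\<lambda>n. v n \<delta>) \<longlonglongrightarrow> 0"
    by (simp add: v(2))
  moreover have "param (v n) \<le> \<Lambda>" for n
    using \<sigma>(2)[OF v(1)] v(2)[of n] c(2) by simp
  ultimately obtain k lam w where "strict_mono (k :: nat \<Rightarrow> nat)"
    "(\<lambda>n. param (v (k n))) \<longlonglongrightarrow> lam" "linear_solution lam w"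
    by (rule normalized_limit[OF v(1)])
  then show ?thesis
    using linear_solution_principal linear_solution_eigenfunction(1) by simp
qed

section \<open>The closure of the nontrivial solutions\<close>

text \<open>The representation of functions on \<open>[\<delta>, R]\<close> that \<open>E\<close> prescribes.\<close>

definition zero_ext :: "(real \<Rightarrow>\<^sub>C real) \<Rightarrow> real \<Rightarrow> real" where
  "zero_ext v r = (if r \<in> {\<delta>..R} then v r else 0)"

text \<open>The profile \<open>0\<close> is adjoined as the bifurcation point. It solves \<open>v = solve \<lambda> v\<close> for every \<open>\<lambda>\<close>, and
  \<open>branch_param\<close> gives it the value \<open>lam1\<close>, which makes \<open>branch_param\<close> continuous.\<close>

definition branch :: "(real \<Rightarrow>\<^sub>C real) set" where
  "branch = insert 0 solutions"

definition branch_param :: "(real \<Rightarrow>\<^sub>C real) \<Rightarrow> real" where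
  "branch_param v = (if v = 0 then lam1 else param v)"

lemma zero_ext_0 [simp]: "zero_ext 0 = (\<lambda>_. 0)"
  by (simp add: zero_ext_def fun_eq_iff)

lemma branch_param_0 [simp]: "branch_param 0 = lam1"
  by (simp add: branch_param_def)

lemma solutions_nonzero: "v \<in> solutions \<Longrightarrow> v \<noteq> 0"
  using solutionsD(2) by force

lemma branch_param_solution: "v \<in> solutions \<Longrightarrow> branch_param v = param v"
  using solutions_nonzero by (simp add: branch_param_def)

lemma rhs_0: "s \<in> {\<delta>..R} \<Longrightarrow> rhs 0 s = 0"
  unfolding rhs_def using flux_cong[of s "\<lambda>t. f t 0" "\<lambda>_. 0"] f_zero
  by (simp add: flux_def)

lemma solve_0: "0 \<le> lam \<Longrightarrow> solve lam 0 = 0"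
proof (rule profile_eqI)
  fix x assume "x \<in> {\<delta>..R}"
  have "integral {proj x..R} (slope lam 0) = integral {proj x..R} (\<lambda>_. 0)"
  proof (rule Henstock_Kurzweil_Integration.integral_cong)
    fix s assume "s \<in> {proj x..R}"
    then have "s \<in> {\<delta>..R}" using order_trans[OF proj_ge, of x s] by simp
    then show "slope lam 0 s = 0" by (simp add: slope_def rhs_0)
  qed
  then show "solve lam 0 x = apply_bcontfun 0 x"
    by (simp add: solve_apply zero_profile)
qed (simp_all add: zero_profile solve_profile)

lemma branchD:
  assumes "v \<in> branch"
  shows "v \<in> profiles" "0 < branch_param v" "solve (branch_param v) v = v"
  using assms lam1_pos solutionsD zero_profile solve_0[of lam1]
  by (auto simp: branch_def branch_param_solution)

lemma branchI:
  assumes "v \<in> profiles" "0 \<le> lam" "solve lam v = v" "v \<noteq> 0"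
  shows "v \<in> solutions" "branch_param v = lam"
proof -
  have "0 < v \<delta>"
    using profile_eq_0[OF assms(1)] assms(4) profile_nonneg[OF assms(1), of \<delta>] by fastforce
  then show "v \<in> solutions" "branch_param v = lam"
    using solutionsI[OF assms(1) _ assms(2,3)] assms(4) by (auto simp: branch_param_def)
qed

lemma zero_ext_has_derivative:
  assumes "v \<in> branch" "r \<in> {\<delta>..R}"
  shows "(zero_ext v has_real_derivative - slope (branch_param v) v r) (at r within {\<delta>..R})"
proof (rule has_field_derivative_transform_within[OF _ zero_less_one assms(2)])
  show "(v has_real_derivative - slope (branch_param v) v r) (at r within {\<delta>..R})"
    using solve_has_derivative[OF branchD(1)[OF assms(1)] assms(2), of "branch_param v"] branchD(3)[OF assms(1)] by simp
qed (simp add: zero_ext_def)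

lemma
  assumes "v \<in> branch"
  shows C1_on_zero_ext: "C1_on \<delta> R (zero_ext v)"
    and iderivative_zero_ext: "\<And>r. r \<in> {\<delta>..R} \<Longrightarrow> iderivative \<delta> R (zero_ext v) r = - slope (branch_param v) v r"
  using C1_on_realI[OF \<delta>(2) zero_ext_has_derivative[OF assms] continuous_on_minus[OF continuous_on_slope[OF branchD(1)[OF assms]]]]
  by blast+

lemma slope_at_left: "slope lam v \<delta> = 0"
  by (simp add: slope_def rhs_def)

lemma zero_ext_in_E:
  assumes "v \<in> branch"
  shows "zero_ext v \<in> E \<delta> R"
  using C1_on_zero_ext[OF assms] iderivative_zero_ext[OF assms, of \<delta>] \<delta> profile_right[OF branchD(1)[OF assms]]
  by (simp add: E_def slope_at_left) (simp add: zero_ext_def)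

lemma solution_nontrivial:
  assumes v: "v \<in> solutions"
  shows "(param v, zero_ext v) \<in> nontrivial_solutions N \<delta> R \<alpha> f"
proof -
  have vb: "v \<in> branch" using v by (simp add: branch_def)
  note vp = solutionsD(1)[OF v]
  note id = iderivative_zero_ext[OF vb, unfolded branch_param_solution[OF v]]
  let ?P = "\<lambda>r. r ^ (N - 1) * phi1 (iderivative \<delta> R (zero_ext v) r)"
  have P_deriv: "(?P has_real_derivative - (param v * (r ^ (N - 1) * f r (v r)))) (at r within {\<delta>..R})"
    if r: "r \<in> {\<delta>..R}" for r
  proof (rule has_field_derivative_transform_within[OF _ zero_less_one r])
    show "((\<lambda>r. - (param v * (r ^ (N - 1) * rhs v r))) has_real_derivative - (param v * (r ^ (N - 1) * f r (v r))))
        (at r within {\<delta>..R})"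
      unfolding rhs_def
      by (intro DERIV_minus DERIV_cmult flux_has_derivative profile_source_continuous vp r)
  qed (simp add: id slope_def phi1_minus)
  have P_cont: "continuous_on {\<delta>..R} (\<lambda>r. - (param v * (r ^ (N - 1) * f r (v r))))"
    by (intro continuous_intros profile_source_continuous vp)
  note P = C1_on_realI[OF \<delta>(2) P_deriv P_cont]
  have "is_solution N \<delta> R \<alpha> f (param v) (zero_ext v)"
    unfolding is_solution_def
  proof (intro conjI ballI C1_on_zero_ext[OF vb])
    fix r assume r: "r \<in> {\<delta>..R}"
    show "0 \<le> zero_ext v r" "zero_ext v r < \<alpha>"
      using profile_range[OF vp, of r] r by (auto simp: zero_ext_def)
    show "\<bar>iderivative \<delta> R (zero_ext v) r\<bar> < 1"
      using id[OF r] abs_phi1_inv_less_1 by (simp add: slope_def)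
  next
    show "C1_on \<delta> R ?P"
      using P(1) by blast
  next
    fix r assume r: "r \<in> {\<delta><..<R}"
    then show "iderivative \<delta> R ?P r + param v * r ^ (N - 1) * f r (zero_ext v r) = 0"
      using P(2)[of r] by (simp add: zero_ext_def)
  next
    show "iderivative \<delta> R (zero_ext v) \<delta> = 0" "zero_ext v R = 0"
      using zero_ext_in_E[OF vb] by (auto simp: E_def)
  qed
  moreover have "\<exists>r\<in>{\<delta>..R}. zero_ext v r \<noteq> 0"
    using solutionsD(2)[OF v] \<delta> by (intro bexI[of _ \<delta>]) (auto simp: zero_ext_def)
  ultimately show ?thesis
    using zero_ext_in_E[OF vb] solutionsD(4)[OF v] by (auto simp: nontrivial_solutions_def)
qed

text \<open>Integrate the equation from \<open>\<delta>\<close>, where \<open>r\<^sup>N\<^sup>-\<^sup>1 \<phi>\<^sub>1(u')\<close> vanishes, and solve for \<open>u'\<close>. The result shows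
  \<open>-1 < u' \<le> 0\<close>, so that \<open>u\<close>, extended by constants, is a profile.\<close>

lemma nontrivial_is_solution:
  assumes "(lam, u) \<in> nontrivial_solutions N \<delta> R \<alpha> f"
  obtains v where "v \<in> solutions" "lam = param v" "u = zero_ext v"
proof -
  let ?D = "iderivative \<delta> R u"
  have lam: "0 \<le> lam" and uE: "u \<in> E \<delta> R" and ne: "\<exists>r\<in>{\<delta>..R}. u r \<noteq> 0"
    and sol: "is_solution N \<delta> R \<alpha> f lam u"
    using assms by (auto simp: nontrivial_solutions_def)
  define P where "P r = r ^ (N - 1) * phi1 (?D r)" for r
  have C1: "C1_on \<delta> R u" and PC1: "C1_on \<delta> R P"
    and range: "\<And>r. r \<in> {\<delta>..R} \<Longrightarrow> 0 \<le> u r \<and> u r < \<alpha> \<and> \<bar>?D r\<bar> < 1"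
    and ode': "\<And>r. r \<in> {\<delta><..<R} \<Longrightarrow> iderivative \<delta> R P r + lam * r ^ (N - 1) * f r (u r) = 0"
    and bc: "?D \<delta> = 0" "u R = 0"
    using sol unfolding is_solution_def P_def [abs_def] by blast+
  have ode: "iderivative \<delta> R P r = - (lam * (r ^ (N - 1) * f r (u r)))" if "r \<in> {\<delta><..<R}" for r
    using ode'[OF that] by (simp add: eq_neg_iff_add_eq_0 mult.assoc)
  have ucont: "continuous_on {\<delta>..R} u" by (rule C1_on_continuous[OF C1])
  have hcont: "continuous_on {\<delta>..R} (\<lambda>t. f t (u t))"
    using range by (intro continuous_on_f_compose continuous_on_id ucont) auto
  define F where "F = flux N \<delta> (\<lambda>t. f t (u t))"
  have Fcont: "continuous_on {\<delta>..R} F"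
    unfolding F_def by (rule continuous_on_flux[OF hcont])
  have Fnonneg: "0 \<le> F s" if "s \<in> {\<delta>..R}" for s
    unfolding F_def using that range by (intro flux_nonneg hcont f_nonneg) auto
  have PF: "P r = - (lam * (r ^ (N - 1) * F r))" if r: "r \<in> {\<delta>..R}" for r
  proof -
    have "((\<lambda>t. - (lam * (t ^ (N - 1) * f t (u t)))) has_integral (P r - P \<delta>)) {\<delta>..r}"
    proof (rule fundamental_theorem_of_calculus_interior)
      show "continuous_on {\<delta>..r} P"
        using r by (intro continuous_on_subset[OF C1_on_continuous(1)[OF PC1]]) auto
      fix t assume t: "t \<in> {\<delta><..<r}"
      then have "(P has_real_derivative iderivative \<delta> R P t) (at t)"
        using C1_on_has_real_derivative[OF PC1, of t] r by (simp add: at_within_Icc_at)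
      then show "(P has_vector_derivative - (lam * (t ^ (N - 1) * f t (u t)))) (at t)"
        using ode[of t] t r by (simp add: has_real_derivative_iff_has_vector_derivative)
    qed (use r in simp)
    then have "P r - P \<delta> = - (lam * integral {\<delta>..r} (\<lambda>t. t ^ (N - 1) * f t (u t)))"
      by (simp add: has_integral_iff)
    moreover have "P \<delta> = 0" using bc by (simp add: P_def phi1_def)
    ultimately show ?thesis
      using power_times_flux[OF r, of "\<lambda>t. f t (u t)"] by (simp add: F_def)
  qed
  have DF: "?D r = - phi1_inv (lam * F r)" if r: "r \<in> {\<delta>..R}" for r
  proof (cases "r = \<delta>")
    case True
    then show ?thesis using bc by (simp add: F_def)
  next
    case False
    then have nz: "r ^ (N - 1) \<noteq> 0" using r \<delta> by auto
    have "r ^ (N - 1) * phi1 (?D r) = r ^ (N - 1) * (- (lam * F r))"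
      using PF[OF r] by (simp add: P_def mult.left_commute)
    then have "phi1 (?D r) = - (lam * F r)"
      by (simp only: mult_left_cancel[OF nz])
    then have "phi1_inv (phi1 (?D r)) = - phi1_inv (lam * F r)"
      by (simp add: phi1_inv_minus)
    then show ?thesis
      using phi1_inv_phi1 range[OF r] by simp
  qed
  have gcont: "continuous_on {\<delta>..R} (\<lambda>s. phi1_inv (lam * F s))"
    by (intro continuous_intros Fcont)
  have udiff: "u x - u y = integral {x..y} (\<lambda>s. phi1_inv (lam * F s))" if "\<delta> \<le> x" "x \<le> y" "y \<le> R" for x y
  proof -
    have "((\<lambda>s. - phi1_inv (lam * F s)) has_integral (u y - u x)) {x..y}"
    proof (rule fundamental_theorem_of_calculus[OF that(2)])
      fix s assume s: "s \<in> {x..y}"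
      then have "(u has_vector_derivative ?D s) (at s within {\<delta>..R})"
        using that by (intro iderivative_has[OF C1]) auto
      then show "(u has_vector_derivative - phi1_inv (lam * F s)) (at s within {x..y})"
        using DF[of s] s that by (auto intro: has_vector_derivative_within_subset)
    qed
    then show ?thesis
      by (simp add: has_integral_iff)
  qed
  have mono: "0 \<le> u x - u y" "u x - u y \<le> y - x" if "\<delta> \<le> x" "x \<le> y" "y \<le> R" for x y
  proof -
    show "0 \<le> u x - u y"
      unfolding udiff[OF that] using that lam Fnonneg
      by (intro Henstock_Kurzweil_Integration.integral_nonneg integrable_continuous_real continuous_on_subset[OF gcont])
        (auto intro!: phi1_inv_nonneg)
    have "\<bar>integral {x..y} (\<lambda>s. phi1_inv (lam * F s))\<bar> \<le> 1 * (y - x)"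
      using that abs_phi1_inv_less_1 by (intro abs_integral_le gcont) (auto simp: less_imp_le)
    then show "u x - u y \<le> y - x"
      using udiff[OF that] by simp
  qed
  define v where "v = Bcontfun (\<lambda>x. u (proj x))"
  have vp: "v \<in> profiles" and v_app: "v x = u (proj x)" for x
    unfolding v_def using mono bc by (intro Bcontfun_proj_profile Bcontfun_proj; simp)+
  have vu: "v x = u x" if "x \<in> {\<delta>..R}" for x
    using that by (simp add: v_app proj_id)
  have rhsF: "rhs v s = F s" if "s \<in> {\<delta>..R}" for s
    unfolding rhs_def F_def using that by (intro flux_cong) (simp add: vu)
  have "solve lam v = v"
  proof (rule profile_eqI[OF solve_profile[OF vp lam] vp])
    fix x assume x: "x \<in> {\<delta>..R}"
    have "solve lam v x = integral {x..R} (\<lambda>s. phi1_inv (lam * F s))"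
      unfolding solve_apply[OF vp] proj_id[OF x] using x
      by (intro Henstock_Kurzweil_Integration.integral_cong) (simp add: slope_def rhsF)
    also have "\<dots> = v x"
      using udiff[of x R] x bc by (simp add: vu)
    finally show "solve lam v x = v x" .
  qed
  moreover have "v \<noteq> 0"
    using ne vu by auto
  ultimately have "v \<in> solutions" "branch_param v = lam"
    using branchI[OF vp lam] by auto
  moreover have "u = zero_ext v"
  proof
    show "u r = zero_ext v r" for r
      using uE vu by (simp add: zero_ext_def E_def)
  qed
  ultimately show thesis
    using that branch_param_solution by metis
qed

lemma nontrivial_solutions_eq:
  "nontrivial_solutions N \<delta> R \<alpha> f = (\<lambda>v. (branch_param v, zero_ext v)) ` solutions"
proof (intro equalityI subsetI)
  fix p assume "p \<in> nontrivial_solutions N \<delta> R \<alpha> f"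
  then show "p \<in> (\<lambda>v. (branch_param v, zero_ext v)) ` solutions"
    by (cases p) (auto elim!: nontrivial_is_solution simp: branch_param_solution)
qed (auto simp: branch_param_solution solution_nontrivial)

text \<open>The equation \<open>v = solve \<lambda> v\<close> passes to the limit, and a limit profile \<open>0\<close> forces the limit parameter
  \<open>lam1\<close>. In particular the heights cannot tend to \<open>R - \<delta>\<close> while the parameters converge.\<close>

lemma branch_limit:
  assumes "\<And>n. v n \<in> branch" "v \<longlonglongrightarrow> w" "(\<lambda>n. branch_param (v n)) \<longlonglongrightarrow> L"
  shows "w \<in> branch" "branch_param w = L"
proof -
  have vp: "v n \<in> profiles" for n
    using branchD(1)[OF assms(1)] .
  then have w: "w \<in> profiles"
    using closed_sequentially[OF closed_profiles] assms(2) by blast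
  have L: "0 \<le> L"
    by (rule LIMSEQ_le_const[OF assms(3)]) (use branchD(2)[OF assms(1)] in \<open>auto simp: less_imp_le\<close>)
  have "(\<lambda>n. solve (branch_param (v n)) (v n)) \<longlonglongrightarrow> solve L w"
    using vp w assms by (intro solve_tendsto)
  then have fp: "solve L w = w"
    by (simp add: branchD(3)[OF assms(1)] LIMSEQ_unique[OF _ assms(2)])
  have "w \<in> branch \<and> branch_param w = L"
  proof (cases "w = 0")
    case True
    have "L = lam1"
    proof (rule ccontr)
      assume "L \<noteq> lam1"
      then have e: "0 < \<bar>L - lam1\<bar> / 2" by simp
      then obtain \<sigma> where \<sigma>: "0 < \<sigma>" "\<And>v. v \<in> solutions \<Longrightarrow> v \<delta> < \<sigma> \<Longrightarrow> \<bar>param v - lam1\<bar> < \<bar>L - lam1\<bar> / 2"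
        using param_near_lam1 by blast
      have "(\<lambda>n. v n \<delta>) \<longlonglongrightarrow> 0"
        using tendsto_apply_bcontfun[OF assms(2), of \<delta>] True by simp
      from order_tendstoD(2)[OF this \<sigma>(1)] tendstoD[OF assms(3) e]
      have "\<forall>\<^sub>F n in sequentially. False"
      proof eventually_elim
        case (elim n)
        have "\<bar>branch_param (v n) - lam1\<bar> < \<bar>L - lam1\<bar> / 2"
          using assms(1)[of n] \<sigma>(2)[of "v n"] elim(1) e by (auto simp: branch_def branch_param_solution)
        moreover have "\<bar>branch_param (v n) - L\<bar> < \<bar>L - lam1\<bar> / 2"
          using elim(2) by (simp add: dist_real_def)
        moreover have "\<bar>L - lam1\<bar> \<le> \<bar>branch_param (v n) - L\<bar> + \<bar>branch_param (v n) - lam1\<bar>"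
          using abs_triangle_ineq4[of "branch_param (v n) - lam1" "branch_param (v n) - L"] by simp
        ultimately show False by argo
      qed
      then show False by simp
    qed
    then show ?thesis using True by (simp add: branch_def)
  next
    case False
    then show ?thesis
      using branchI[OF w L fp] by (simp add: branch_def)
  qed
  then show "w \<in> branch" "branch_param w = L" by auto
qed

lemma continuous_on_branch_param: "continuous_on branch branch_param"
  unfolding continuous_on_sequentially o_def
proof (intro allI ballI impI)
  fix v w assume w: "w \<in> branch" and v: "(\<forall>n. v n \<in> branch) \<and> v \<longlonglongrightarrow> w"
  show "(\<lambda>n. branch_param (v n)) \<longlonglongrightarrow> branch_param w"
  proof (cases "w = 0")
    case True
    show ?thesis
    proof (rule tendstoI)
      fix e :: real assume e: "0 < e"
      then obtain \<sigma> where \<sigma>: "0 < \<sigma>" "\<And>v. v \<in> solutions \<Longrightarrow> v \<delta> < \<sigma> \<Longrightarrow> \<bar>param v - lam1\<bar> < e"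
        using param_near_lam1 by blast
      have "(\<lambda>n. v n \<delta>) \<longlonglongrightarrow> 0"
        using tendsto_apply_bcontfun[of v w sequentially \<delta>] v True by simp
      from order_tendstoD(2)[OF this \<sigma>(1)]
      show "\<forall>\<^sub>F n in sequentially. dist (branch_param (v n)) (branch_param w) < e"
      proof eventually_elim
        case (elim n)
        have "v n \<in> branch" using v by blast
        then show ?case
          using \<sigma>(2)[of "v n"] elim e True by (auto simp: branch_def branch_param_solution dist_real_def)
      qed
    qed
  next
    case False
    then have ws: "w \<in> solutions" using w by (simp add: branch_def)
    have "(\<lambda>n. v n \<delta>) \<longlonglongrightarrow> w \<delta>"
      using v by (intro tendsto_apply_bcontfun) auto
    from order_tendstoD(1)[OF this solutionsD(2)[OF ws]]
    obtain K where K: "\<And>n. K \<le> n \<Longrightarrow> 0 < v n \<delta>"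
      unfolding eventually_sequentially by blast
    have vs: "v (n + K) \<in> solutions" for n
    proof -
      have "v (n + K) \<in> branch" using v by blast
      moreover have "v (n + K) \<noteq> 0" using K[of "n + K"] by force
      ultimately show ?thesis by (simp add: branch_def)
    qed
    have "(\<lambda>n. v (n + K)) \<longlonglongrightarrow> w"
      using v LIMSEQ_ignore_initial_segment by blast
    then have "(\<lambda>n. param (v (n + K))) \<longlonglongrightarrow> param w"
      using vs solutionsD[OF ws] by (intro param_tendsto(1)) auto
    then have "(\<lambda>n. branch_param (v (n + K))) \<longlonglongrightarrow> branch_param w"
      using vs ws by (simp add: branch_param_solution)
    then show ?thesis
      by (rule LIMSEQ_offset)
  qed
qed

text \<open>On the branch uniform convergence already implies convergence in \<open>C\<^sup>1\<close>, since the derivative is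
  expressed by the profile and the parameter through \<open>slope\<close>.\<close>

lemma E_dist_zero_ext_tendsto:
  assumes "\<And>n. v n \<in> branch" "w \<in> branch" "v \<longlonglongrightarrow> w"
  shows "(\<lambda>n. E_dist \<delta> R (zero_ext w) (zero_ext (v n))) \<longlonglongrightarrow> 0"
proof (rule tendstoI)
  fix e :: real assume e: "0 < e"
  then have e3: "0 < e / 3" by simp
  have "(\<lambda>n. branch_param (v n)) \<longlonglongrightarrow> branch_param w"
    using continuous_on_branch_param assms unfolding continuous_on_sequentially o_def by blast
  then have "uniform_limit {\<delta>..R} (\<lambda>n. slope (branch_param (v n)) (v n)) (slope (branch_param w) w) sequentially"
    using assms branchD(1) by (intro slope_limit) auto
  from uniform_limitD[OF this e3] tendstoD[OF assms(3) e3]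
  show "\<forall>\<^sub>F n in sequentially. dist (E_dist \<delta> R (zero_ext w) (zero_ext (v n))) 0 < e"
  proof eventually_elim
    case (elim n)
    note E = zero_ext_in_E[OF assms(2)] zero_ext_in_E[OF assms(1)[of n]]
    have "E_dist \<delta> R (zero_ext w) (zero_ext (v n)) \<le> e / 3 + e / 3"
    proof (intro E_dist_le \<delta> E)
      fix r assume r: "r \<in> {\<delta>..R}"
      show "\<bar>zero_ext w r - zero_ext (v n) r\<bar> \<le> e / 3"
      proof -
        have "\<bar>zero_ext w r - zero_ext (v n) r\<bar> = dist (v n r) (w r)"
          using r by (simp add: zero_ext_def dist_real_def abs_minus_commute)
        also have "\<dots> \<le> e / 3"
          using dist_bounded[of "v n" r w] elim(2) by linarith
        finally show ?thesis .
      qed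
      show "\<bar>iderivative \<delta> R (zero_ext w) r - iderivative \<delta> R (zero_ext (v n)) r\<bar> \<le> e / 3"
        using bspec[OF elim(1) r] r assms by (simp add: iderivative_zero_ext dist_real_def)
    qed
    then show ?case
      using e Metric_space.nonneg[OF E_Metric_space[OF \<delta>(2)], of "zero_ext w" "zero_ext (v n)"] by (simp add: dist_real_def)
  qed
qed

lemma continuous_map_zero_ext: "continuous_map (top_of_set branch) (E_topology \<delta> R) zero_ext"
  unfolding E_topology_def Metric_space.continuous_map_to_metric[OF E_Metric_space[OF \<delta>(2)]]
proof (intro ballI allI impI)
  fix w and \<epsilon> :: real assume w: "w \<in> topspace (top_of_set branch)" and \<epsilon>: "0 < \<epsilon>"
  then have wb: "w \<in> branch" by simp
  have zero: "E_dist \<delta> R (zero_ext w) (zero_ext w) = 0"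
    using Metric_space.zero[OF E_Metric_space[OF \<delta>(2)]] zero_ext_in_E[OF wb] by simp
  have "continuous (at w within branch) (\<lambda>v. E_dist \<delta> R (zero_ext w) (zero_ext v))"
    unfolding continuous_within_sequentially o_def zero
    using E_dist_zero_ext_tendsto[OF _ wb] by blast
  then have "((\<lambda>v. E_dist \<delta> R (zero_ext w) (zero_ext v)) \<longlongrightarrow> 0) (at w within branch)"
    by (simp add: continuous_within zero)
  from tendstoD[OF this \<epsilon>] obtain d where d: "0 < d"
    "\<And>v. v \<in> branch \<Longrightarrow> v \<noteq> w \<Longrightarrow> dist v w < d \<Longrightarrow> \<bar>E_dist \<delta> R (zero_ext w) (zero_ext v)\<bar> < \<epsilon>"
    unfolding eventually_at by (auto simp: dist_real_def)
  have "zero_ext v \<in> Metric_space.mball (E \<delta> R) (E_dist \<delta> R) (zero_ext w) \<epsilon>" if "v \<in> branch \<inter> ball w d" for v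
    using that d(2)[of v] zero \<epsilon> zero_ext_in_E wb
    by (cases "v = w") (auto simp: Metric_space.in_mball[OF E_Metric_space[OF \<delta>(2)]] dist_commute)
  then show "\<exists>U. openin (top_of_set branch) U \<and> w \<in> U \<and>
      (\<forall>v\<in>U. zero_ext v \<in> Metric_space.mball (E \<delta> R) (E_dist \<delta> R) (zero_ext w) \<epsilon>)"
    using wb d(1) by (intro exI[of _ "branch \<inter> ball w d"]) auto
qed

definition branch_point :: "(real \<Rightarrow>\<^sub>C real) \<Rightarrow> real \<times> (real \<Rightarrow> real)" where
  "branch_point v = (branch_param v, zero_ext v)"

lemma continuous_map_branch_point: "continuous_map (top_of_set branch) (RE_topology \<delta> R) branch_point"
  unfolding RE_topology_def continuous_map_pairwise
  using continuous_map_zero_ext continuous_on_branch_param by (simp add: branch_point_def o_def)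

lemma zero_in_closure_solutions: "0 \<in> closure solutions"
  unfolding closure_approachable
proof (intro allI impI)
  fix e :: real assume e: "0 < e"
  define c where "c = min (e / 2) ((R - \<delta>) / 2)"
  have c: "0 < c" "c < e" "c < R - \<delta>"
    using e \<delta> by (auto simp: c_def min_def field_simps)
  obtain v where v: "v \<in> solutions" "v \<delta> = c"
    using prescribed_left_solution[of c c "\<lambda>_. c"] c by auto
  have "dist v 0 \<le> c"
    using v profile_nonneg[OF solutionsD(1)[OF v(1)]] profile_le_left[OF solutionsD(1)[OF v(1)]]
    by (intro dist_bound) (simp add: dist_real_def)
  then show "\<exists>y\<in>solutions. dist y 0 < e"
    using v(1) c by (intro bexI[of _ v]) auto
qed

lemma topspace_E: "topspace (E_topology \<delta> R) = E \<delta> R"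
  unfolding E_topology_def by (rule Metric_space.topspace_mtopology[OF E_Metric_space[OF \<delta>(2)]])

text \<open>Points of the closure are limits of solutions with convergent parameter; a subsequence of the
  profiles converges by compactness, and \<open>branch_limit\<close> identifies the limit. Conversely, the
  bifurcation point is a limit of solutions because solutions of every small height exist.\<close>

lemma Sigma_sol_eq: "Sigma_sol N \<delta> R \<alpha> f = branch_point ` branch"
proof
  show "branch_point ` branch \<subseteq> Sigma_sol N \<delta> R \<alpha> f"
  proof -
    have "branch \<inter> solutions = solutions" "branch \<subseteq> closure solutions"
      using zero_in_closure_solutions closure_subset[of solutions] by (auto simp: branch_def)
    then have "branch \<subseteq> top_of_set branch closure_of solutions"
      by (simp add: closure_of_subtopology)
    then have "branch_point ` branch \<subseteq> RE_topology \<delta> R closure_of (branch_point ` solutions)"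
      using continuous_map_image_closure_subset[OF continuous_map_branch_point, of solutions] by blast
    then show ?thesis
      by (simp add: Sigma_sol_def nontrivial_solutions_eq branch_point_def [abs_def])
  qed
next
  show "Sigma_sol N \<delta> R \<alpha> f \<subseteq> branch_point ` branch"
  proof
    fix p assume p: "p \<in> Sigma_sol N \<delta> R \<alpha> f"
    obtain lam u where pu: "p = (lam, u)" by (cases p)
    have cl: "(lam, u) \<in> topspace (RE_topology \<delta> R)"
      "\<And>T. openin (RE_topology \<delta> R) T \<Longrightarrow> (lam, u) \<in> T \<Longrightarrow> \<exists>y\<in>branch_point ` solutions. y \<in> T"
      using p by (auto simp: Sigma_sol_def in_closure_of pu nontrivial_solutions_eq branch_point_def [abs_def])
    have uE: "u \<in> E \<delta> R"
      using cl(1) by (simp add: RE_topology_def topspace_E)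
    have "\<exists>v\<in>solutions. dist (branch_param v) lam < 1 / real (Suc n) \<and> E_dist \<delta> R u (zero_ext v) < 1 / real (Suc n)" for n
    proof -
      let ?B = "Metric_space.mball (E \<delta> R) (E_dist \<delta> R) u (1 / real (Suc n))"
      have "openin (RE_topology \<delta> R) (ball lam (1 / real (Suc n)) \<times> ?B)"
        unfolding RE_topology_def openin_prod_Times_iff E_topology_def
        using Metric_space.openin_mball[OF E_Metric_space[OF \<delta>(2)]] by auto
      moreover have "(lam, u) \<in> ball lam (1 / real (Suc n)) \<times> ?B"
        using uE Metric_space.zero[OF E_Metric_space[OF \<delta>(2)] uE uE]
        by (auto simp: Metric_space.in_mball[OF E_Metric_space[OF \<delta>(2)]])
      ultimately show ?thesis
        using cl(2) by (fastforce simp: branch_point_def Metric_space.in_mball[OF E_Metric_space[OF \<delta>(2)]] dist_commute)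
    qed
    then obtain v where v: "\<And>n. v n \<in> solutions" "\<And>n. dist (branch_param (v n)) lam < 1 / real (Suc n)"
      "\<And>n. E_dist \<delta> R u (zero_ext (v n)) < 1 / real (Suc n)"
      by metis
    have inv0: "(\<lambda>n. 1 / real (Suc n)) \<longlonglongrightarrow> 0"
      using LIMSEQ_inverse_real_of_nat by (simp add: inverse_eq_divide)
    have vb: "v n \<in> branch" for n using v(1) by (simp add: branch_def)
    have lim1: "(\<lambda>n. branch_param (v n)) \<longlonglongrightarrow> lam"
      by (rule metric_tendsto_imp_tendsto[OF inv0]) (use v(2) in \<open>auto simp: less_imp_le dist_real_def\<close>)
    have lim2: "(\<lambda>n. v n r) \<longlonglongrightarrow> u r" if r: "r \<in> {\<delta>..R}" for r
    proof (rule metric_tendsto_imp_tendsto[OF inv0], intro always_eventually allI)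
      fix n
      have "\<bar>u r - zero_ext (v n) r\<bar> \<le> 1 / real (Suc n)"
        using E_dist_ge(1)[OF \<delta>(2) uE zero_ext_in_E[OF vb[of n]] r] v(3)[of n] by linarith
      then show "dist (v n r) (u r) \<le> dist (1 / real (Suc n)) 0"
        using r by (simp add: zero_ext_def dist_real_def abs_minus_commute)
    qed
    obtain w k where w: "w \<in> profiles" and k: "strict_mono (k :: nat \<Rightarrow> nat)" "(v \<circ> k) \<longlonglongrightarrow> w"
      using compact_profiles v(1) solutionsD(1) unfolding compact_eq_seq_compact_metric seq_compact_def by meson
    have lim3: "(\<lambda>n. branch_param (v (k n))) \<longlonglongrightarrow> lam"
      using LIMSEQ_subseq_LIMSEQ[OF lim1 k(1)] by (simp add: o_def)
    have wb: "w \<in> branch" "branch_param w = lam"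
      using branch_limit[of "\<lambda>n. v (k n)" w lam] vb k(2) lim3 by (auto simp: o_def)
    have "u = zero_ext w"
    proof
      fix r
      show "u r = zero_ext w r"
      proof (cases "r \<in> {\<delta>..R}")
        case True
        have "(\<lambda>n. v (k n) r) \<longlonglongrightarrow> w r"
          using tendsto_apply_bcontfun[OF k(2), of r] by (simp add: o_def)
        moreover have "(\<lambda>n. v (k n) r) \<longlonglongrightarrow> u r"
          using LIMSEQ_subseq_LIMSEQ[OF lim2[OF True] k(1)] by (simp add: o_def)
        ultimately show ?thesis
          using True LIMSEQ_unique by (auto simp: zero_ext_def)
      next
        case False
        then show ?thesis using uE by (auto simp: zero_ext_def E_def)
      qed
    qed
    then show "p \<in> branch_point ` branch"
      using wb pu by (auto simp: branch_point_def)
  qed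
qed

section \<open>Individual solutions: large parameters and interior of the cone\<close>

text \<open>If the parameter is at most \<open>\<Lambda>\<close>, then the slope is at most some \<open>q < 1\<close>, and the height at most
  \<open>q (R - \<delta>)\<close>.\<close>

lemma param_large_near_top:
  obtains b where "0 < b" "b < R - \<delta>" "\<And>v. v \<in> solutions \<Longrightarrow> b \<le> v \<delta> \<Longrightarrow> \<Lambda> < param v"
proof -
  obtain B where B: "0 < B" "\<And>r s. r \<in> {\<delta>..R} \<Longrightarrow> s \<in> {0..R - \<delta>} \<Longrightarrow> f r s \<le> B"
    using f_bounded by blast
  define q where "q = phi1_inv (max 0 \<Lambda> * (B * (R - \<delta>)))"
  have q: "0 \<le> q" "q < 1"
    unfolding q_def using B(1) \<delta> by (auto intro!: phi1_inv_nonneg phi1_inv_less_1)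
  define b where "b = (1 + q) / 2 * (R - \<delta>)"
  show thesis
  proof (rule that[of b])
    show "0 < b" using q \<delta> by (simp add: b_def)
    have "(1 + q) / 2 * (R - \<delta>) < 1 * (R - \<delta>)"
      using q \<delta> by (intro mult_strict_right_mono) auto
    then show "b < R - \<delta>" by (simp add: b_def)
    fix v assume v: "v \<in> solutions" "b \<le> v \<delta>"
    note vp = solutionsD(1)[OF v(1)]
    show "\<Lambda> < param v"
    proof (rule ccontr)
      assume "\<not> \<Lambda> < param v"
      then have le: "param v \<le> max 0 \<Lambda>" by simp
      have "slope (param v) v s \<le> q" if s: "s \<in> {\<delta>..R}" for s
      proof -
        have "\<bar>rhs v s\<bar> \<le> B * (s - \<delta>)"
          unfolding rhs_def using s profile_source_nonneg[OF vp] profile_nonneg[OF vp] profile_le[OF vp]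
          by (intro flux_bound profile_source_continuous vp) (auto intro!: B(2))
        also have "\<dots> \<le> B * (R - \<delta>)"
          using s B(1) by (intro mult_left_mono) auto
        finally show ?thesis
          unfolding slope_def q_def using le rhs_nonneg[OF vp s]
          by (intro phi1_inv_mono mult_mono) auto
      qed
      then have "integral {\<delta>..R} (slope (param v) v) \<le> integral {\<delta>..R} (\<lambda>_. q)"
        using vp by (intro integral_le slope_integrable) auto
      then have "v \<delta> \<le> q * (R - \<delta>)"
        using solution_integral[OF v(1), of \<delta>] \<delta> by (simp add: mult.commute)
      also have "\<dots> < b"
        unfolding b_def using q \<delta> by (intro mult_strict_right_mono) auto
      finally show False using v(2) by simp
    qed
  qed
qed

text \<open>Solutions of small height have parameter close to \<open>lam1\<close>; for the others \<open>solve_left_large\<close> applies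
  uniformly.\<close>

lemma top_near_param_large:
  assumes "c < R - \<delta>"
  obtains \<Lambda> where "lam1 < \<Lambda>" "\<And>v. v \<in> solutions \<Longrightarrow> \<Lambda> \<le> param v \<Longrightarrow> c < v \<delta>"
proof -
  obtain \<sigma> where \<sigma>: "0 < \<sigma>" "\<And>v. v \<in> solutions \<Longrightarrow> v \<delta> < \<sigma> \<Longrightarrow> \<bar>param v - lam1\<bar> < 1"
    using param_near_lam1[of 1] by auto
  have c: "0 \<le> max 0 c" "max 0 c < R - \<delta>"
    using assms \<delta> by auto
  obtain \<Lambda> where "0 \<le> \<Lambda>"
    and \<Lambda>: "\<And>lam v. \<Lambda> \<le> lam \<Longrightarrow> v \<in> profiles \<Longrightarrow> \<sigma> \<le> v \<delta> \<Longrightarrow> max 0 c < solve lam v \<delta>"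
    using solve_left_large[OF \<sigma>(1) c] by blast
  show thesis
  proof (rule that[of "max \<Lambda> (lam1 + 1)"])
    fix v assume v: "v \<in> solutions" "max \<Lambda> (lam1 + 1) \<le> param v"
    then have "\<sigma> \<le> v \<delta>"
      using \<sigma>(2)[OF v(1)] by linarith
    then show "c < v \<delta>"
      using \<Lambda>[of "param v" v] v solutionsD(1,5)[OF v(1)] by simp
  qed simp
qed

text \<open>Near \<open>R\<close> the derivative of the solution is bounded away from \<open>0\<close>, and elsewhere the solution itself
  is. A function close in \<open>C\<^sup>1\<close> therefore decreases to its value \<open>0\<close> at \<open>R\<close> on \<open>[s, R]\<close> and is positive on
  \<open>[\<delta>, s]\<close>.\<close>

lemma solution_interior:
  assumes v: "v \<in> solutions"
  shows "zero_ext v \<in> E_topology \<delta> R interior_of P_cone \<delta> R"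
proof -
  have vb: "v \<in> branch" using v by (simp add: branch_def)
  note vp = solutionsD(1)[OF v]
  note id = iderivative_zero_ext[OF vb, unfolded branch_param_solution[OF v]]
  define c where "c = slope (param v) v R"
  have c: "0 < c"
    unfolding c_def slope_def using phi1_inv_strict_mono[of 0 "param v * rhs v R"]
      rhs_pos[OF vp solutionsD(2)[OF v], of R] solutionsD(4)[OF v] \<delta> by simp
  have "\<forall>\<^sub>F r in at R within {\<delta>..R}. c / 2 < slope (param v) v r"
  proof (rule order_tendstoD(1))
    show "(slope (param v) v \<longlongrightarrow> c) (at R within {\<delta>..R})"
      using continuous_on_slope[OF vp, of "param v"] \<delta> by (auto simp: continuous_on_def c_def)
  qed (use c in simp)
  then obtain d where d: "0 < d" "\<And>r. r \<in> {\<delta>..R} \<Longrightarrow> r \<noteq> R \<Longrightarrow> dist r R < d \<Longrightarrow> c / 2 < slope (param v) v r"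
    unfolding eventually_at by blast
  define s where "s = max \<delta> (R - d / 2)"
  have s: "\<delta> \<le> s" "s < R"
    using d \<delta> by (auto simp: s_def)
  have slope: "c / 2 < slope (param v) v r" if "r \<in> {s..R}" for r
    using that d(1) d(2)[of r] c \<delta> by (cases "r = R") (auto simp: s_def c_def dist_real_def)
  define e where "e = min (c / 2) (v s)"
  have e: "0 < e" "e \<le> c / 2" "e \<le> v s"
    using c solution_pos[OF v, of s] s by (auto simp: e_def)
  interpret M: Metric_space "E \<delta> R" "E_dist \<delta> R"
    by (rule E_Metric_space[OF \<delta>(2)])
  have "M.mball (zero_ext v) e \<subseteq> P_cone \<delta> R"
  proof
    fix w assume "w \<in> M.mball (zero_ext v) e"
    then have w: "w \<in> E \<delta> R" "E_dist \<delta> R (zero_ext v) w < e"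
      by auto
    have C1: "C1_on \<delta> R w" and wR: "w R = 0"
      using w(1) by (auto simp: E_def)
    have near: "\<bar>v r - w r\<bar> < e" "\<bar>- slope (param v) v r - iderivative \<delta> R w r\<bar> < e" if r: "r \<in> {\<delta>..R}" for r
      using E_dist_ge[OF \<delta>(2) zero_ext_in_E[OF vb] w(1) r] w(2) id[OF r] r by (auto simp: zero_ext_def)
    have "0 \<le> w t" if t: "t \<in> {\<delta>..R}" for t
    proof (cases "t \<le> s")
      case True
      then have "v s \<le> v t" by (rule profile_antimono[OF vp])
      then show ?thesis using near(1)[OF t] e by linarith
    next
      case False
      have "((\<lambda>r. iderivative \<delta> R w r) has_integral (w R - w t)) {t..R}"
      proof (rule fundamental_theorem_of_calculus)
        fix x assume "x \<in> {t..R}"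
        then show "(w has_vector_derivative iderivative \<delta> R w x) (at x within {t..R})"
          using t by (intro has_vector_derivative_within_subset[OF iderivative_has[OF C1]]) auto
      qed (use t in simp)
      moreover have "iderivative \<delta> R w x \<le> 0" if "x \<in> {t..R}" for x
        using near(2)[of x] slope[of x] e that t False by auto
      ultimately have "w R - w t \<le> 0"
        by (rule has_integral_le[OF _ has_integral_0])
      then show ?thesis using wR by simp
    qed
    then show "w \<in> P_cone \<delta> R"
      using w(1) by (simp add: P_cone_def)
  qed
  moreover have "zero_ext v \<in> M.mball (zero_ext v) e"
    using e(1) zero_ext_in_E[OF vb] by simp
  ultimately show ?thesis
    unfolding E_topology_def interior_of_def using M.openin_mball by blast
qed

lemma C_norm_solution:
  assumes v: "v \<in> solutions"
  shows "C_norm \<delta> R (zero_ext v) = v \<delta>"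
  unfolding C_norm_def
proof (rule cSup_eq_maximum)
  note vp = solutionsD(1)[OF v]
  show "v \<delta> \<in> (\<lambda>r. \<bar>zero_ext v r\<bar>) ` {\<delta>..R}"
    using solutionsD(2)[OF v] \<delta> by (intro image_eqI[of _ _ \<delta>]) (auto simp: zero_ext_def)
  show "x \<le> v \<delta>" if "x \<in> (\<lambda>r. \<bar>zero_ext v r\<bar>) ` {\<delta>..R}" for x
    using that profile_nonneg[OF vp] profile_le_left[OF vp] by (auto simp: zero_ext_def)
qed

text \<open>Markov's inequality for the nonnegative function \<open>1 + u'\<close>, whose integral is \<open>R - \<delta> - v \<delta>\<close>.\<close>

lemma measure_slope_defect:
  assumes v: "v \<in> solutions" and k: "0 < k"
  shows "measure lebesgue {r\<in>{\<delta>..R}. \<bar>iderivative \<delta> R (zero_ext v) r - (-1)\<bar> > k} \<le> (R - \<delta> - v \<delta>) / k"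
proof -
  have vb: "v \<in> branch" using v by (simp add: branch_def)
  note vp = solutionsD(1)[OF v]
  note id = iderivative_zero_ext[OF vb, unfolded branch_param_solution[OF v]]
  define g where "g r = 1 - slope (param v) v r" for r
  have g: "continuous_on {\<delta>..R} g"
    unfolding g_def by (intro continuous_intros continuous_on_slope vp)
  have g0: "0 \<le> g r" for r
    using slope_less_1[of "param v" v r] by (simp add: g_def)
  define A where "A = {r\<in>{\<delta>..R}. k < g r}"
  have set_eq: "{r\<in>{\<delta>..R}. \<bar>iderivative \<delta> R (zero_ext v) r - (-1)\<bar> > k} = A"
    using g0 by (auto simp: A_def id g_def)
  have "closed {r\<in>{\<delta>..R}. g r \<le> k}"
    by (intro continuous_on_closed_Collect_le g continuous_intros closed_atLeastAtMost)
  then have "compact {r\<in>{\<delta>..R}. g r \<le> k}"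
    unfolding compact_eq_bounded_closed by (auto intro: bounded_subset[OF bounded_closed_interval])
  then have "{\<delta>..R} - {r\<in>{\<delta>..R}. g r \<le> k} \<in> lmeasurable"
    by (intro fmeasurable_Diff lmeasurable_compact fmeasurableD compact_Icc)
  then have A: "A \<in> lmeasurable"
    by (rule back_subst[of "\<lambda>S. S \<in> lmeasurable"]) (auto simp: A_def)
  have "((\<lambda>r. if r \<in> A then k else 0) has_integral k * measure lebesgue A) {\<delta>..R}"
  proof -
    have "((\<lambda>r. 1) has_integral measure lebesgue A) A"
      using A by (simp add: has_integral_iff lmeasure_integral integrable_on_const)
    then have "((\<lambda>r. k * 1) has_integral k * measure lebesgue A) A"
      by (rule has_integral_mult_right)
    then show ?thesis
      by (subst has_integral_restrict) (auto simp: A_def)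
  qed
  moreover have "(g has_integral integral {\<delta>..R} g) {\<delta>..R}"
    using g by (simp add: integrable_integral integrable_continuous_real)
  ultimately have "k * measure lebesgue A \<le> integral {\<delta>..R} g"
    by (rule has_integral_le) (use g0 in \<open>auto simp: A_def\<close>)
  moreover have "integral {\<delta>..R} g = R - \<delta> - v \<delta>"
    unfolding g_def using solution_integral[OF v, of \<delta>] \<delta> slope_integrable[OF vp, of \<delta> R "param v"]
    by (subst Henstock_Kurzweil_Integration.integral_diff) auto
  ultimately show ?thesis
    unfolding set_eq using k by (simp add: pos_le_divide_eq mult.commute)
qed

section \<open>The component through the bifurcation point\<close>

definition continuum :: "(real \<times> (real \<Rightarrow> real)) set" where
  "continuum = connected_component_of_set (subtopology (RE_topology \<delta> R) (Sigma_sol N \<delta> R \<alpha> f)) (branch_point 0)"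

lemma zero_in_branch: "0 \<in> branch"
  by (simp add: branch_def)

lemma branch_point_0: "branch_point 0 = (lam1, \<lambda>_. 0)"
  by (simp add: branch_point_def)

lemma topspace_Sigma: "topspace (subtopology (RE_topology \<delta> R) (Sigma_sol N \<delta> R \<alpha> f)) = branch_point ` branch"
  using continuous_map_image_subset_topspace[OF continuous_map_branch_point] by (auto simp: Sigma_sol_eq)

lemma continuum_component:
  "continuum \<in> connected_components_of (subtopology (RE_topology \<delta> R) (Sigma_sol N \<delta> R \<alpha> f))"
  unfolding continuum_def connected_components_of_def using topspace_Sigma zero_in_branch by blast

lemma continuum_subset: "continuum \<subseteq> branch_point ` branch"
  unfolding continuum_def topspace_Sigma[symmetric] by (rule connected_component_of_subset_topspace)

lemma branch_point_0_in_continuum: "branch_point 0 \<in> continuum"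
  unfolding continuum_def using topspace_Sigma zero_in_branch by (simp add: connected_component_of_refl)

lemma continuum_cases:
  assumes "p \<in> continuum"
  obtains "p = branch_point 0" | v where "v \<in> solutions" "p = (param v, zero_ext v)"
  using assms continuum_subset by (auto simp: branch_def branch_point_def branch_param_solution)

text \<open>The component contains the image of every connected set of solutions through \<open>0\<close>, in particular of
  one that reaches a height forcing the parameter above \<open>\<Lambda>\<close>.\<close>

lemma continuum_unbounded:
  obtains v where "v \<in> solutions" "branch_point v \<in> continuum" "\<Lambda> < param v"
proof -
  obtain b where b: "0 < b" "b < R - \<delta>" "\<And>v. v \<in> solutions \<Longrightarrow> b \<le> v \<delta> \<Longrightarrow> \<Lambda> < param v"
    using param_large_near_top by blast
  obtain C v where C: "connected C" "C \<subseteq> insert 0 solutions" "0 \<in> C" and v: "v \<in> C" "v \<delta> = b"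
    using connected_branch[OF b(1,2)] by blast
  have Cb: "C \<subseteq> branch" using C by (simp add: branch_def)
  have "continuous_map (top_of_set branch) (subtopology (RE_topology \<delta> R) (Sigma_sol N \<delta> R \<alpha> f)) branch_point"
    using continuous_map_branch_point by (simp add: continuous_map_in_subtopology Sigma_sol_eq)
  moreover have "connectedin (top_of_set branch) C"
    using C Cb by (simp add: connectedin_subtopology)
  ultimately have "connectedin (subtopology (RE_topology \<delta> R) (Sigma_sol N \<delta> R \<alpha> f)) (branch_point ` C)"
    by (rule connectedin_continuous_map_image)
  then have "branch_point ` C \<subseteq> continuum"
    unfolding continuum_def using C(3) by (intro connected_component_of_maximal) auto
  moreover have "v \<in> solutions"
    using v C b(1) by auto
  ultimately show thesis
    using that[of v] v b(3) by auto
qed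

text \<open>The projection is connected and unbounded above. It contains its infimum \<open>L\<close>: a sequence in the
  component with parameters tending to \<open>L\<close> has a convergent subsequence of profiles, and components
  are closed.\<close>

lemma projection_interval: "\<exists>lam_star>0. fst ` continuum = {lam_star..}"
proof -
  let ?A = "fst ` continuum"
  have pos: "0 < x" if "x \<in> ?A" for x
    using that continuum_subset branchD(2) by (auto simp: branch_point_def)
  have conn: "connected ?A"
  proof -
    have "connectedin (subtopology (RE_topology \<delta> R) (Sigma_sol N \<delta> R \<alpha> f)) continuum"
      unfolding continuum_def by (rule connectedin_connected_component_of)
    then have "connectedin (RE_topology \<delta> R) continuum"
      by (simp add: connectedin_subtopology)
    then have "connectedin euclideanreal ?A"
      unfolding RE_topology_def by (rule connectedin_continuous_map_image[OF continuous_map_fst])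
    then show ?thesis by simp
  qed
  define L where "L = Inf ?A"
  have ne: "?A \<noteq> {}" and bdd: "bdd_below ?A"
    using branch_point_0_in_continuum pos by (auto intro!: bdd_belowI[of _ 0] less_imp_le)
  have LA: "L \<in> ?A"
  proof -
    have "\<exists>v\<in>branch. branch_point v \<in> continuum \<and> branch_param v < L + 1 / real (Suc n)" for n
    proof -
      have "\<exists>x\<in>?A. x < L + 1 / real (Suc n)"
        unfolding L_def using cInf_less_iff[OF ne bdd, of "Inf ?A + 1 / real (Suc n)"] by simp
      then show ?thesis
        using continuum_subset by (fastforce simp: branch_point_def)
    qed
    then obtain v where v: "\<And>n. v n \<in> branch" "\<And>n. branch_point (v n) \<in> continuum" "\<And>n. branch_param (v n) < L + 1 / real (Suc n)"
      by metis
    have ge: "L \<le> branch_param (v n)" for n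
      unfolding L_def using v(2)[of n] bdd by (intro cInf_lower) (force simp: branch_point_def)+
    have lim: "(\<lambda>n. branch_param (v n)) \<longlonglongrightarrow> L"
    proof (rule tendsto_sandwich[OF always_eventually always_eventually tendsto_const])
      have "(\<lambda>n. L + 1 / real (Suc n)) \<longlonglongrightarrow> L + 0"
        using LIMSEQ_inverse_real_of_nat by (intro tendsto_add tendsto_const) (simp add: inverse_eq_divide)
      then show "(\<lambda>n. L + 1 / real (Suc n)) \<longlonglongrightarrow> L" by simp
    qed (use ge v(3) in \<open>auto simp: less_imp_le\<close>)
    obtain w k where k: "strict_mono (k :: nat \<Rightarrow> nat)" "(v \<circ> k) \<longlonglongrightarrow> w"
      using compact_profiles v(1) branchD(1) unfolding compact_eq_seq_compact_metric seq_compact_def by meson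
    have "(\<lambda>n. branch_param (v (k n))) \<longlonglongrightarrow> L"
      using LIMSEQ_subseq_LIMSEQ[OF lim k(1)] by (simp add: o_def)
    then have w: "w \<in> branch" "branch_param w = L"
      using branch_limit[of "\<lambda>n. v (k n)" w L] v(1) k(2) by (auto simp: o_def)
    have "closedin (top_of_set branch) {v \<in> topspace (top_of_set branch). branch_point v \<in> continuum}"
    proof (rule closedin_continuous_map_preimage)
      show "continuous_map (top_of_set branch) (subtopology (RE_topology \<delta> R) (Sigma_sol N \<delta> R \<alpha> f)) branch_point"
        using continuous_map_branch_point by (simp add: continuous_map_in_subtopology Sigma_sol_eq)
      show "closedin (subtopology (RE_topology \<delta> R) (Sigma_sol N \<delta> R \<alpha> f)) continuum"
        unfolding continuum_def by (rule closedin_connected_component_of)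
    qed
    then obtain T where T: "closed T" "{v \<in> branch. branch_point v \<in> continuum} = branch \<inter> T"
      by (auto simp: closedin_closed)
    have "w \<in> T"
      using closed_sequentially[OF T(1) _ k(2)] T(2) v by auto
    then have "branch_point w \<in> continuum" using T(2) w(1) by blast
    then show ?thesis
      using w(2) by (force simp: branch_point_def)
  qed
  have "?A = {L..}"
  proof
    show "?A \<subseteq> {L..}"
      unfolding L_def using bdd by (auto intro: cInf_lower)
    show "{L..} \<subseteq> ?A"
    proof
      fix x assume x: "x \<in> {L..}"
      obtain v where v: "v \<in> solutions" "branch_point v \<in> continuum" "x < param v"
        using continuum_unbounded by blast
      then have "param v \<in> ?A"
        by (force simp: branch_point_def branch_param_solution)
      then show "x \<in> ?A"
        using subsetD[OF connected_contains_Icc[OF conn LA], of "param v" x] x v(3) by simp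
    qed
  qed
  then show ?thesis
    using pos[OF LA] by blast
qed

lemma eventually_lambda_at_top_continuum:
  assumes "lam1 < \<Lambda>" "\<And>v. v \<in> solutions \<Longrightarrow> \<Lambda> \<le> param v \<Longrightarrow> Q (param v, zero_ext v)"
  shows "eventually Q (lambda_at_top continuum)"
proof -
  have "p \<in> continuum \<longrightarrow> Q p" if "\<Lambda> \<le> fst p" for p
  proof
    assume "p \<in> continuum"
    then show "Q p"
      by (rule continuum_cases) (use that assms in \<open>auto simp: branch_point_0\<close>)
  qed
  then show ?thesis
    unfolding lambda_at_top_def eventually_inf_principal eventually_filtercomap_at_top_linorder by blast
qed

lemma continuum_norm_limit: "((\<lambda>(lam, u). C_norm \<delta> R u) \<longlongrightarrow> R - \<delta>) (lambda_at_top continuum)"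
proof (rule tendstoI)
  fix e :: real assume "0 < e"
  then obtain \<Lambda> where \<Lambda>: "lam1 < \<Lambda>" "\<And>v. v \<in> solutions \<Longrightarrow> \<Lambda> \<le> param v \<Longrightarrow> R - \<delta> - e < v \<delta>"
    using top_near_param_large[of "R - \<delta> - e"] by auto
  show "\<forall>\<^sub>F p in lambda_at_top continuum. dist (case p of (lam, u) \<Rightarrow> C_norm \<delta> R u) (R - \<delta>) < e"
  proof (rule eventually_lambda_at_top_continuum[OF \<Lambda>(1)])
    fix v assume "v \<in> solutions" "\<Lambda> \<le> param v"
    then show "dist (case (param v, zero_ext v) of (lam, u) \<Rightarrow> C_norm \<delta> R u) (R - \<delta>) < e"
      using \<Lambda>(2)[of v] solutionsD(3)[of v] by (simp add: C_norm_solution dist_real_def)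
  qed
qed

lemma continuum_measure_limit:
  assumes "0 < k"
  shows "((\<lambda>(lam, u). measure lebesgue {r\<in>{\<delta>..R}. \<bar>iderivative \<delta> R u r - (-1)\<bar> > k}) \<longlongrightarrow> 0)
    (lambda_at_top continuum)"
proof (rule tendstoI)
  fix e :: real assume "0 < e"
  then have "R - \<delta> - e * k < R - \<delta>" using assms by simp
  then obtain \<Lambda> where \<Lambda>: "lam1 < \<Lambda>" "\<And>v. v \<in> solutions \<Longrightarrow> \<Lambda> \<le> param v \<Longrightarrow> R - \<delta> - e * k < v \<delta>"
    using top_near_param_large by blast
  show "\<forall>\<^sub>F p in lambda_at_top continuum. dist (case p of (lam, u) \<Rightarrow>
      measure lebesgue {r\<in>{\<delta>..R}. \<bar>iderivative \<delta> R u r - (-1)\<bar> > k}) 0 < e"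
  proof (rule eventually_lambda_at_top_continuum[OF \<Lambda>(1)])
    fix v assume v: "v \<in> solutions" "\<Lambda> \<le> param v"
    have "measure lebesgue {r\<in>{\<delta>..R}. \<bar>iderivative \<delta> R (zero_ext v) r - (-1)\<bar> > k} \<le> (R - \<delta> - v \<delta>) / k"
      by (rule measure_slope_defect[OF v(1) assms])
    also have "\<dots> < e"
      using \<Lambda>(2)[OF v] assms by (simp add: pos_divide_less_eq)
    finally show "dist (case (param v, zero_ext v) of (lam, u) \<Rightarrow>
        measure lebesgue {r\<in>{\<delta>..R}. \<bar>iderivative \<delta> R u r - (-1)\<bar> > k}) 0 < e"
      by (simp only: prod.case dist_real_def diff_0_right abs_of_nonneg[OF measure_nonneg])
  qed
qed

lemma continuum_interior:
  "continuum - {(lam1, \<lambda>_. 0)} \<subseteq> {0<..} \<times> (E_topology \<delta> R interior_of P_cone \<delta> R)"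
proof
  fix p assume p: "p \<in> continuum - {(lam1, \<lambda>_. 0)}"
  then have "p \<in> continuum" by simp
  then show "p \<in> {0<..} \<times> (E_topology \<delta> R interior_of P_cone \<delta> R)"
    by (rule continuum_cases) (use p in \<open>auto simp: branch_point_0 solution_interior solutionsD(4)\<close>)
qed

lemma continuum_joins: "joins_with_infinity continuum (lam1, \<lambda>_. 0)"
  unfolding joins_with_infinity_def
proof (intro conjI allI)
  show "(lam1, \<lambda>_. 0) \<in> continuum"
    using branch_point_0_in_continuum by (simp add: branch_point_0)
  show "\<exists>(lam, u)\<in>continuum. \<Lambda> < lam" for \<Lambda>
  proof -
    obtain v where "v \<in> solutions" "branch_point v \<in> continuum" "\<Lambda> < param v"
      by (rule continuum_unbounded)
    then show ?thesis
      by (intro bexI[of _ "branch_point v"]) (auto simp: branch_point_def branch_param_solution)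
  qed
qed

end

theorem theorem1p1:
  fixes N :: nat and R \<delta> \<alpha> :: real
    and f :: "real \<Rightarrow> real \<Rightarrow> real" and m :: "real \<Rightarrow> real"
  assumes "2 \<le> N" and "0 < R" and "0 \<le> \<delta>" and "\<delta> < R" and "R < \<alpha>"
    and "continuous_on ({\<delta>..R} \<times> {0..<\<alpha>}) (\<lambda>(r, s). f r s)"
    and "\<forall>r\<in>{\<delta>..R}. \<forall>s\<in>{0..<\<alpha>}. 0 \<le> f r s"
    and "\<forall>r\<in>{\<delta>..R}. \<forall>s\<in>{0<..<\<alpha>}. 0 < f r s"
    and "uniform_limit {\<delta>..R} (\<lambda>s r. f r s / s) m (at_right 0)"
    and "continuous_on {\<delta>..R} m"
    and "\<forall>r\<in>{\<delta>..R}. 0 \<le> m r"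
    and "\<forall>a b. \<delta> \<le> a \<and> a < b \<and> b \<le> R \<longrightarrow> (\<exists>r\<in>{a..b}. m r \<noteq> 0)"
  shows "\<exists>\<zeta> \<in> connected_components_of
              (subtopology (RE_topology \<delta> R) (Sigma_sol N \<delta> R \<alpha> f)).
     \<zeta> - {(principal_eigenvalue N R m \<delta>, \<lambda>_. 0)}
       \<subseteq> {0<..} \<times> (E_topology \<delta> R interior_of P_cone \<delta> R) \<and>
     joins_with_infinity \<zeta> (principal_eigenvalue N R m \<delta>, \<lambda>_. 0) \<and>
     (\<exists>lam_star>0. fst ` \<zeta> = {lam_star..}) \<and>
     (\<forall>n::nat. 1 \<le> n \<longrightarrow>
        ((\<lambda>(lam, u). measure lebesgue {r\<in>{\<delta>..R}. \<bar>iderivative \<delta> R u r - (-1)\<bar> > 1 / real n})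
           \<longlongrightarrow> 0) (lambda_at_top \<zeta>)) \<and>
     ((\<lambda>(lam, u). C_norm \<delta> R u) \<longlongrightarrow> R - \<delta>) (lambda_at_top \<zeta>)"
proof -
  interpret bvp N \<delta> R \<alpha> f m
    by unfold_locales (use assms in auto)
  show ?thesis
  proof (intro bexI[OF _ continuum_component] conjI allI impI)
    fix n :: nat assume "1 \<le> n"
    then show "((\<lambda>(lam, u). measure lebesgue {r\<in>{\<delta>..R}. \<bar>iderivative \<delta> R u r - (-1)\<bar> > 1 / real n})
           \<longlongrightarrow> 0) (lambda_at_top continuum)"
      by (intro continuum_measure_limit) simp
  qed (rule continuum_interior continuum_joins projection_interval continuum_norm_limit)+
qed

end
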